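(* Let $L>0$, $a>0$, $\alpha>0$ and $b,\delta,\beta\in\mathbb R$. Let $u:[0,\infty)\to L^2(\mathbb T)$, $\mathbb T=[-\frac L2,\frac L2]$, be a solution of the complex Ginzburg-Landau equation $$u_t-(a+bi)u_{xx}-\delta u+(\alpha+\beta i)|u|^2u=0\quad\text{in }\mathbb T$$ with $L$-periodic boundary conditions, which does not belong to the global attractor. Then $u$ cannot be extended to a global solution of the equation for all $t\in\mathbb R$; that is, any extension of $u$ backward in time blows up in finite time.
   Context: Functions are complex-valued and $L$-periodic; solutions take values in $L^2(\mathbb T)$ and blow-up is with respect to the $L^2(\mathbb T)$ norm. In this parameter regime the equation is globally well-posed forward in time; let $S(t)$, $t\ge 0$, be the solution semigroup on $L^2(\mathbb T)$. The global attractor $\mathcal A\subset L^2(\mathbb T)$ is the compact set with $S(t)\mathcal A=\mathcal A$ for all $t\ge 0$ attracting all bounded subsets of $L^2(\mathbb T)$ as $t\to\infty$. A solution "does not belong to the global attractor" if its trajectory is not contained in $\mathcal A$. "Global solution" means a solution defined for all $t\in\mathbb R$.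
   Formalization: "Any extension backward blows up" is literally false (u(t)=S(t+ε)w with w in L² discontinuous). Proved instead: every extension has finite backward life span, and its L² norm tends to infinity at the end unless it continues to a solution starting from an L² state there. *)

theory Defs
  imports "HOL-Analysis.Analysis"
begin

section \<open>Complex \<open>L\<^sup>2\<close> spaces as metric spaces of almost-everywhere classes\<close>

definition L2_fun :: "'a measure \<Rightarrow> ('a \<Rightarrow> complex) set" where
  "L2_fun M = {f. f \<in> borel_measurable M \<and> integrable M (\<lambda>x. (norm (f x))\<^sup>2)}"

definition L2_rel :: "'a measure \<Rightarrow> (('a \<Rightarrow> complex) \<times> ('a \<Rightarrow> complex)) set" where
  "L2_rel M = {(f, g). f \<in> L2_fun M \<and> g \<in> L2_fun M \<and> (AE x in M. f x = g x)}"

definition L2 :: "'a measure \<Rightarrow> ('a \<Rightarrow> complex) set set" where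
  "L2 M = L2_fun M // L2_rel M"

definition rep :: "('a \<Rightarrow> complex) set \<Rightarrow> 'a \<Rightarrow> complex" where
  "rep F = (SOME f. f \<in> F)"

definition L2_norm :: "'a measure \<Rightarrow> ('a \<Rightarrow> complex) set \<Rightarrow> real" where
  "L2_norm M F = sqrt (LINT x|M. (norm (rep F x))\<^sup>2)"

definition L2_dist :: "'a measure \<Rightarrow> ('a \<Rightarrow> complex) set \<Rightarrow> ('a \<Rightarrow> complex) set \<Rightarrow> real" where
  "L2_dist M F G = sqrt (LINT x|M. (norm (rep F x - rep G x))\<^sup>2)"

abbreviation L2_topology :: "'a measure \<Rightarrow> ('a \<Rightarrow> complex) set topology" where
  "L2_topology M \<equiv> Metric_space.mtopology (L2 M) (L2_dist M)"

lemma equiv_L2_rel: "equiv (L2_fun M) (L2_rel M)"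
proof (rule equivI)
  show "L2_rel M \<subseteq> L2_fun M \<times> L2_fun M"
    by (auto simp: L2_rel_def)
  show "refl_on (L2_fun M) (L2_rel M)"
    by (auto simp: refl_on_def L2_rel_def)
  show "sym (L2_rel M)"
    by (auto simp: sym_def L2_rel_def elim: eventually_mono)
  show "trans (L2_rel M)"
    unfolding trans_def L2_rel_def by (auto elim: eventually_elim2)
qed

lemma rep_in: "F \<in> L2 M \<Longrightarrow> rep F \<in> F"
  unfolding rep_def L2_def
  by (metis equiv_L2_rel in_quotient_imp_non_empty some_in_eq)

lemma rep_L2_fun: "F \<in> L2 M \<Longrightarrow> rep F \<in> L2_fun M"
  using rep_in[of F M] in_quotient_imp_subset[OF equiv_L2_rel] by (auto simp: L2_def)

lemma L2_eqI:
  assumes "F \<in> L2 M" "G \<in> L2 M" "AE x in M. rep F x = rep G x"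
  shows "F = G"
proof -
  have "(rep F, rep G) \<in> L2_rel M"
    using assms rep_L2_fun by (auto simp: L2_rel_def)
  then show ?thesis
    using quotient_eqI[OF equiv_L2_rel, of F M G "rep F" "rep G"] assms(1,2) rep_in
    by (auto simp: L2_def)
qed

lemma norm_add_sq_le:
  fixes a b :: complex and c :: real
  assumes "c > 0"
  shows "(norm (a + b))\<^sup>2 \<le> (1 + c) * (norm a)\<^sup>2 + (1 + 1 / c) * (norm b)\<^sup>2"
proof -
  have "(norm (a + b))\<^sup>2 \<le> (norm a + norm b)\<^sup>2"
    by (intro power_mono norm_triangle_ineq) auto
  moreover have "2 * norm a * norm b \<le> c * (norm a)\<^sup>2 + (norm b)\<^sup>2 / c"
  proof -
    have "0 \<le> (sqrt c * norm a - norm b / sqrt c)\<^sup>2" by simp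
    also have "\<dots> = c * (norm a)\<^sup>2 + (norm b)\<^sup>2 / c - 2 * norm a * norm b"
      using assms by (simp add: power2_diff power_mult_distrib power_divide)
    finally show ?thesis by simp
  qed
  ultimately show ?thesis
    by (simp add: power2_sum algebra_simps)
qed

lemma L2_fun_add:
  assumes "f \<in> L2_fun M" "g \<in> L2_fun M"
  shows "(\<lambda>x. f x + g x) \<in> L2_fun M"
proof -
  have [measurable]: "f \<in> borel_measurable M" "g \<in> borel_measurable M"
    using assms by (auto simp: L2_fun_def)
  have "integrable M (\<lambda>x. 2 * (norm (f x))\<^sup>2 + 2 * (norm (g x))\<^sup>2)"
    using assms by (auto simp: L2_fun_def)
  then have "integrable M (\<lambda>x. (norm (f x + g x))\<^sup>2)"
  proof (rule Bochner_Integration.integrable_bound)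
    show "AE x in M. norm ((norm (f x + g x))\<^sup>2) \<le> norm (2 * (norm (f x))\<^sup>2 + 2 * (norm (g x))\<^sup>2)"
      using norm_add_sq_le[of 1] by auto
  qed measurable
  then show ?thesis by (simp add: L2_fun_def)
qed

lemma L2_fun_uminus: "f \<in> L2_fun M \<Longrightarrow> (\<lambda>x. - f x) \<in> L2_fun M"
  by (auto simp: L2_fun_def)

lemma L2_fun_diff:
  assumes "f \<in> L2_fun M" "g \<in> L2_fun M"
  shows "(\<lambda>x. f x - g x) \<in> L2_fun M"
  using L2_fun_add[OF assms(1) L2_fun_uminus[OF assms(2)]] by simp

lemma L2_Minkowski:
  assumes "f \<in> L2_fun M" "g \<in> L2_fun M"
  shows "sqrt (LINT x|M. (norm (f x + g x))\<^sup>2)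
       \<le> sqrt (LINT x|M. (norm (f x))\<^sup>2) + sqrt (LINT x|M. (norm (g x))\<^sup>2)"
proof -
  define A where "A = sqrt (LINT x|M. (norm (f x))\<^sup>2)"
  define B where "B = sqrt (LINT x|M. (norm (g x))\<^sup>2)"
  have A: "A \<ge> 0" "A\<^sup>2 = (LINT x|M. (norm (f x))\<^sup>2)" and B: "B \<ge> 0" "B\<^sup>2 = (LINT x|M. (norm (g x))\<^sup>2)"
    by (simp_all add: A_def B_def integral_nonneg_AE)
  have bound: "(LINT x|M. (norm (f x + g x))\<^sup>2) \<le> (1 + c) * A\<^sup>2 + (1 + 1 / c) * B\<^sup>2" if "c > 0" for c
  proof -
    have i: "integrable M (\<lambda>x. (norm (f x))\<^sup>2)" "integrable M (\<lambda>x. (norm (g x))\<^sup>2)"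
      using assms by (auto simp: L2_fun_def)
    have "(LINT x|M. (norm (f x + g x))\<^sup>2)
        \<le> (LINT x|M. (1 + c) * (norm (f x))\<^sup>2 + (1 + 1 / c) * (norm (g x))\<^sup>2)"
      using i L2_fun_add[OF assms] norm_add_sq_le[OF that]
      by (intro integral_mono) (auto simp: L2_fun_def)
    also have "\<dots> = (1 + c) * A\<^sup>2 + (1 + 1 / c) * B\<^sup>2"
      using i A B by simp
    finally show ?thesis .
  qed
  have "(LINT x|M. (norm (f x + g x))\<^sup>2) \<le> (A + B)\<^sup>2"
  proof (rule field_le_epsilon)
    fix e :: real assume e: "e > 0"
    have lim: "((\<lambda>d. (A + d + (B + d))\<^sup>2) \<longlongrightarrow> (A + 0 + (B + 0))\<^sup>2) (at_right 0)"
      by (intro tendsto_intros)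
    have "eventually (\<lambda>d. (A + d + (B + d))\<^sup>2 < (A + B)\<^sup>2 + e) (at_right 0)"
      using order_tendstoD(2)[OF lim, of "(A + B)\<^sup>2 + e"] e by simp
    then obtain d where d: "d > 0" "(A + d + (B + d))\<^sup>2 < (A + B)\<^sup>2 + e"
      using eventually_happens'[OF trivial_limit_at_right_real]
            eventually_conj[OF _ eventually_at_right_less[of "0::real"]] by (metis (no_types, lifting))
    define a b where "a = A + d" and "b = B + d"
    have ab: "a > 0" "b > 0" "A\<^sup>2 \<le> a\<^sup>2" "B\<^sup>2 \<le> b\<^sup>2"
      using A(1) B(1) d(1) by (auto simp: a_def b_def intro!: power_mono)
    have "(LINT x|M. (norm (f x + g x))\<^sup>2) \<le> (1 + b / a) * A\<^sup>2 + (1 + 1 / (b / a)) * B\<^sup>2"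
      using ab by (intro bound) auto
    also have "\<dots> \<le> (1 + b / a) * a\<^sup>2 + (1 + 1 / (b / a)) * b\<^sup>2"
      using ab by (intro add_mono mult_left_mono) auto
    also have "\<dots> = (a + b)\<^sup>2"
      using ab by (simp add: field_simps power2_eq_square)
    finally show "(LINT x|M. (norm (f x + g x))\<^sup>2) \<le> (A + B)\<^sup>2 + e"
      using d(2) by (simp add: a_def b_def)
  qed
  then have "sqrt (LINT x|M. (norm (f x + g x))\<^sup>2) \<le> A + B"
    using A(1) B(1) by (intro real_le_lsqrt) auto
  then show ?thesis by (simp add: A_def B_def)
qed

lemma Metric_space_L2: "Metric_space (L2 M) (L2_dist M)"
proof
  fix F G H
  show "0 \<le> L2_dist M F G"
    by (simp add: L2_dist_def integral_nonneg_AE)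
  show "L2_dist M F G = L2_dist M G F"
    by (simp add: L2_dist_def norm_minus_commute)
  assume F: "F \<in> L2 M" and G: "G \<in> L2 M"
  have i: "integrable M (\<lambda>x. (norm (rep F x - rep G x))\<^sup>2)"
    using L2_fun_diff[OF rep_L2_fun[OF F] rep_L2_fun[OF G]] by (simp add: L2_fun_def)
  have "L2_dist M F G = 0 \<longleftrightarrow> (AE x in M. (norm (rep F x - rep G x))\<^sup>2 = 0)"
    unfolding L2_dist_def using integral_nonneg_eq_0_iff_AE[OF i] by simp
  also have "\<dots> \<longleftrightarrow> F = G"
    using L2_eqI[OF F G] by auto
  finally show "L2_dist M F G = 0 \<longleftrightarrow> F = G" .
  assume H: "H \<in> L2 M"
  show "L2_dist M F H \<le> L2_dist M F G + L2_dist M G H"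
    using L2_Minkowski[OF L2_fun_diff[OF rep_L2_fun[OF F] rep_L2_fun[OF G]]
                          L2_fun_diff[OF rep_L2_fun[OF G] rep_L2_fun[OF H]]]
    by (simp add: L2_dist_def)
qed


section \<open>The torus and weak derivatives\<close>

definition torus :: "real \<Rightarrow> real measure" where
  "torus L = lebesgue_on {- L / 2 .. L / 2}"

abbreviation D :: "(real \<Rightarrow> complex) \<Rightarrow> real \<Rightarrow> complex" where
  "D f \<equiv> (\<lambda>x. vector_derivative f (at x))"

definition smooth_periodic :: "real \<Rightarrow> (real \<Rightarrow> complex) set" where
  "smooth_periodic L =
     {\<phi>. (\<forall>x. \<phi> (x + L) = \<phi> x) \<and> (\<forall>n x. (D ^^ n) \<phi> differentiable at x)}"

text \<open>The test functions are periodic and need not vanish at the end points, so the derivative is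
  taken on the circle and the periodic boundary conditions are part of the definition:
  \<open>has_torus_deriv L F G\<close> says that \<open>F\<close> is in the periodic space \<open>H\<^sup>1\<close> and \<open>F\<^sub>x = G\<close>.\<close>

definition has_torus_deriv ::
    "real \<Rightarrow> (real \<Rightarrow> complex) set \<Rightarrow> (real \<Rightarrow> complex) set \<Rightarrow> bool" where
  "has_torus_deriv L F G \<longleftrightarrow> F \<in> L2 (torus L) \<and> G \<in> L2 (torus L) \<and>
     (\<forall>\<phi>\<in>smooth_periodic L.
        (LINT x|torus L. rep F x * D \<phi> x) = - (LINT x|torus L. rep G x * \<phi> x))"


section \<open>The complex Ginzburg-Landau equation\<close>

text \<open>Weak (energy class) solutions on a time interval \<open>J\<close>:
  \<open>u \<in> C(J; L\<^sup>2) \<inter> L\<^sup>2\<^sub>l\<^sub>o\<^sub>c(J; H\<^sup>1)\<close> and the equation holds in the sense of distributions, in the form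
  integrated over \<open>[s, t] \<subseteq> J\<close>.  For almost every \<open>r\<close> the function \<open>u r\<close> is in \<open>H\<^sup>1\<close>, hence bounded,
  so the cubic term is integrable.  The pairing is the bilinear one, without conjugation.\<close>

definition cgl_solution ::
    "real \<Rightarrow> real \<Rightarrow> real \<Rightarrow> real \<Rightarrow> real \<Rightarrow> real \<Rightarrow> real set \<Rightarrow> (real \<Rightarrow> (real \<Rightarrow> complex) set) \<Rightarrow> bool"
  where
  "cgl_solution L a b \<delta> \<alpha> \<beta> J u \<longleftrightarrow>
     continuous_map (top_of_set J) (L2_topology (torus L)) u \<and>
     (\<exists>p. \<forall>s\<in>J. \<forall>t\<in>J. s \<le> t \<longrightarrow>
        (AE r in lebesgue_on {s..t}. has_torus_deriv L (u r) (p r)) \<and>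
        integrable (lebesgue_on {s..t}) (\<lambda>r. (L2_norm (torus L) (p r))\<^sup>2)) \<and>
     (\<forall>\<phi>\<in>smooth_periodic L. \<forall>s\<in>J. \<forall>t\<in>J. s \<le> t \<longrightarrow>
        has_bochner_integral (lebesgue_on {s..t})
          (\<lambda>r. LINT x|torus L.
                 Complex a b * rep (u r) x * D (D \<phi>) x
                 + of_real \<delta> * rep (u r) x * \<phi> x
                 - Complex \<alpha> \<beta> * (of_real ((norm (rep (u r) x))\<^sup>2) * rep (u r) x) * \<phi> x)
          ((LINT x|torus L. rep (u t) x * \<phi> x) - (LINT x|torus L. rep (u s) x * \<phi> x)))"

definition cgl_semigroup ::
    "real \<Rightarrow> real \<Rightarrow> real \<Rightarrow> real \<Rightarrow> real \<Rightarrow> real \<Rightarrow>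
     real \<Rightarrow> (real \<Rightarrow> complex) set \<Rightarrow> (real \<Rightarrow> complex) set" where
  "cgl_semigroup L a b \<delta> \<alpha> \<beta> t F =
     (THE G. \<exists>u. cgl_solution L a b \<delta> \<alpha> \<beta> {0..} u \<and> u 0 = F \<and> u t = G)"

definition cgl_global_attractor ::
    "real \<Rightarrow> real \<Rightarrow> real \<Rightarrow> real \<Rightarrow> real \<Rightarrow> real \<Rightarrow> (real \<Rightarrow> complex) set set \<Rightarrow> bool" where
  "cgl_global_attractor L a b \<delta> \<alpha> \<beta> A \<longleftrightarrow>
     compactin (L2_topology (torus L)) A \<and>
     (\<forall>t\<ge>0. cgl_semigroup L a b \<delta> \<alpha> \<beta> t ` A = A) \<and>
     (\<forall>B. Metric_space.mbounded (L2 (torus L)) (L2_dist (torus L)) B \<longrightarrow>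
        (\<forall>\<epsilon>>0. \<forall>\<^sub>F t in at_top. \<forall>F\<in>B. \<exists>G\<in>A.
           L2_dist (torus L) (cgl_semigroup L a b \<delta> \<alpha> \<beta> t F) G < \<epsilon>))"

definition cgl_extension ::
    "real \<Rightarrow> real \<Rightarrow> real \<Rightarrow> real \<Rightarrow> real \<Rightarrow> real \<Rightarrow> (real \<Rightarrow> (real \<Rightarrow> complex) set) \<Rightarrow>
     real set \<Rightarrow> (real \<Rightarrow> (real \<Rightarrow> complex) set) \<Rightarrow> bool" where
  "cgl_extension L a b \<delta> \<alpha> \<beta> u J v \<longleftrightarrow>
     is_interval J \<and> {0..} \<subseteq> J \<and> cgl_solution L a b \<delta> \<alpha> \<beta> J v \<and> (\<forall>t\<ge>0. v t = u t)"

text \<open>Finite-time breakdown backward in time of a solution \<open>v\<close> on an interval \<open>J\<close> unbounded above.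
  A solution may begin at \<open>Inf J\<close> with an arbitrary state in \<open>L\<^sup>2\<close>, which in general (if it is not
  smooth) has no past at all although the norm stays bounded.  Norm blow-up is therefore asserted
  whenever \<open>v\<close> has no limiting state at \<open>Inf J\<close> from which it starts as a solution.\<close>

definition cgl_blows_up_backward ::
    "real \<Rightarrow> real \<Rightarrow> real \<Rightarrow> real \<Rightarrow> real \<Rightarrow> real \<Rightarrow>
     real set \<Rightarrow> (real \<Rightarrow> (real \<Rightarrow> complex) set) \<Rightarrow> bool" where
  "cgl_blows_up_backward L a b \<delta> \<alpha> \<beta> J v \<longleftrightarrow>
     bdd_below J \<and>
     ((\<nexists>w. cgl_solution L a b \<delta> \<alpha> \<beta> {Inf J..} w \<and> (\<forall>t\<in>J. w t = v t)) \<longrightarrow>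
        filterlim (\<lambda>t. L2_norm (torus L) (v t)) at_top (at_right (Inf J)))"

end

(*
  The mean energy y(t) = |u(t)|^2 in L^2 satisfies y' <= 2 delta y - (2 alpha / L) y^2, because the L^4 norm
  dominates the L^2 norm on the torus. Run backwards, this quadratic inequality blows up in finite time as soon
  as y exceeds max(0, delta L / alpha); so a solution on the whole real line is bounded by that number. Its range
  is then a bounded invariant set, which the attractor attracts and, being closed, contains.

  If the solution only lives on (T, oo) and the norm does not tend to infinity at T, then y is bounded near T
  (the same inequality bounds the growth of y forwards), so the energy identity makes |u_x|^2 integrable up to T.
  Comparing u with its translate u(. + h) backwards in time shows that u is uniformly continuous near T; the limit
  at T is a state from which u starts as a solution.

  Everything about weak solutions (energy identity, uniqueness, comparison with a translate) is read off the
  Fourier modes, which solve scalar integral equations; Parseval and dominated convergence sum the modes.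
*)
theory Submission
  imports Defs
begin

section \<open>Square-integrable functions\<close>

text \<open>A weak solution cannot serve as its own test function: it is not smooth in space and has
  no time derivative in L2. A single Fourier mode can be used instead, since its coefficient is
  absolutely continuous in time. All estimates then rest on one balance. In dimension one, sup |f|^2
  is controlled by |f|^2 + |f_x|^2, so the cubic term is Lipschitz with a constant that is affine in
  the squared norms of the derivatives. That constant is unbounded but integrable in time, and this
  is enough for uniqueness.

  The obstacle at the start T of an open half-line is that diffusion has the wrong sign backward in
  time, which would ruin a Gronwall argument for a solution and its translate. None is needed:
  |u_x|^2 is integrable up to T, so the wrong-signed diffusion and the growth of the cubic term are
  bounded by a multiple of the integral of |u_x|^2 near T plus a multiple of the elapsed time, and
  both tend to zero. The energy identity of one solution is the difference identity with zero as
  second solution.\<close>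

definition sqn :: "'a measure \<Rightarrow> ('a \<Rightarrow> complex) \<Rightarrow> real" where
  "sqn M f = (LINT x|M. (norm (f x))\<^sup>2)"

definition ip :: "'a measure \<Rightarrow> ('a \<Rightarrow> complex) \<Rightarrow> ('a \<Rightarrow> complex) \<Rightarrow> complex" where
  "ip M f g = (LINT x|M. f x * cnj (g x))"

lemma sqn_nonneg [simp]: "0 \<le> sqn M f"
  by (simp add: sqn_def integral_nonneg_AE)

lemma L2_fun_measurable [measurable_dest]: "f \<in> L2_fun M \<Longrightarrow> f \<in> borel_measurable M"
  by (simp add: L2_fun_def)

lemma L2_fun_integrable_sq: "f \<in> L2_fun M \<Longrightarrow> integrable M (\<lambda>x. (norm (f x))\<^sup>2)"
  by (simp add: L2_fun_def)

lemma L2_fun_prod_integrable: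
  assumes "f \<in> L2_fun M" "g \<in> L2_fun M"
  shows "integrable M (\<lambda>x. f x * g x)"
proof (rule Bochner_Integration.integrable_bound)
  show "integrable M (\<lambda>x. (norm (f x))\<^sup>2 + (norm (g x))\<^sup>2)"
    using assms by (intro Bochner_Integration.integrable_add L2_fun_integrable_sq)
  show "(\<lambda>x. f x * g x) \<in> borel_measurable M"
    using assms by (auto dest!: L2_fun_measurable)
  have "norm (f x * g x) \<le> (norm (f x))\<^sup>2 + (norm (g x))\<^sup>2" for x
  proof -
    have "2 * (norm (f x) * norm (g x)) \<le> (norm (f x))\<^sup>2 + (norm (g x))\<^sup>2"
      using zero_le_power2[of "norm (f x) - norm (g x)"] by (simp add: power2_diff algebra_simps)
    moreover have "0 \<le> norm (f x) * norm (g x)" by simp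
    ultimately show ?thesis unfolding norm_mult by linarith
  qed
  then show "AE x in M. norm (f x * g x) \<le> norm ((norm (f x))\<^sup>2 + (norm (g x))\<^sup>2)" by auto
qed

lemma L2_fun_cnj: "f \<in> L2_fun M \<Longrightarrow> (\<lambda>x. cnj (f x)) \<in> L2_fun M"
  using borel_measurable_continuous_on[of cnj f M] by (auto simp: L2_fun_def continuous_on_cnj)

lemma L2_fun_scale: "f \<in> L2_fun M \<Longrightarrow> (\<lambda>x. c * f x) \<in> L2_fun M"
  by (auto simp: L2_fun_def norm_mult power_mult_distrib)

lemma L2_fun_zero: "(\<lambda>x. 0) \<in> L2_fun M"
  by (auto simp: L2_fun_def)

lemma L2_fun_sum:
  "(\<And>i. i \<in> I \<Longrightarrow> f i \<in> L2_fun M) \<Longrightarrow> (\<lambda>x. \<Sum>i\<in>I. f i x) \<in> L2_fun M"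
  by (induction I rule: infinite_finite_induct) (auto intro: L2_fun_zero L2_fun_add)

lemma ip_integrable: "f \<in> L2_fun M \<Longrightarrow> g \<in> L2_fun M \<Longrightarrow> integrable M (\<lambda>x. f x * cnj (g x))"
  by (intro L2_fun_prod_integrable L2_fun_cnj)

lemma sqn_eq_ip: "complex_of_real (sqn M f) = ip M f f"
  unfolding sqn_def ip_def integral_complex_of_real[symmetric] complex_norm_square ..

lemma ip_add_left:
  "f \<in> L2_fun M \<Longrightarrow> g \<in> L2_fun M \<Longrightarrow> h \<in> L2_fun M \<Longrightarrow>
   ip M (\<lambda>x. f x + g x) h = ip M f h + ip M g h"
  unfolding ip_def by (simp add: distrib_right ip_integrable)

lemma ip_scale_left: "ip M (\<lambda>x. c * f x) h = c * ip M f h"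
  unfolding ip_def by (simp add: mult.assoc)

lemma ip_cnj: "ip M f g = cnj (ip M g f)"
  unfolding ip_def Bochner_Integration.integral_cnj[symmetric] by (simp add: mult.commute)

lemma ip_diff_left:
  "f \<in> L2_fun M \<Longrightarrow> g \<in> L2_fun M \<Longrightarrow> h \<in> L2_fun M \<Longrightarrow>
   ip M (\<lambda>x. f x - g x) h = ip M f h - ip M g h"
  using ip_add_left[of f M "\<lambda>x. (-1) * g x" h] L2_fun_scale[of g M "-1"]
  by (simp only: ip_scale_left) simp

lemma ip_sum_left:
  "(\<And>i. i \<in> I \<Longrightarrow> f i \<in> L2_fun M) \<Longrightarrow> h \<in> L2_fun M \<Longrightarrow>
   ip M (\<lambda>x. \<Sum>i\<in>I. f i x) h = (\<Sum>i\<in>I. ip M (f i) h)"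
proof (induction I rule: infinite_finite_induct)
  case (insert x F)
  then show ?case by (simp add: ip_add_left L2_fun_sum)
qed (auto simp: ip_def)

lemma sqn_diff:
  assumes "f \<in> L2_fun M" "g \<in> L2_fun M"
  shows "sqn M (\<lambda>x. f x - g x) = sqn M f - 2 * Re (ip M f g) + sqn M g"
proof -
  have d: "(\<lambda>x. f x - g x) \<in> L2_fun M" using assms by (rule L2_fun_diff)
  have "complex_of_real (sqn M (\<lambda>x. f x - g x)) =
     ip M f (\<lambda>x. f x - g x) - ip M g (\<lambda>x. f x - g x)"
    using assms d by (simp add: sqn_eq_ip ip_diff_left)
  also have "\<dots> = cnj (ip M f f - ip M g f) - cnj (ip M f g - ip M g g)"
    using ip_cnj[of M f "\<lambda>x. f x - g x"] ip_cnj[of M g "\<lambda>x. f x - g x"] assms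
    by (simp add: ip_diff_left)
  also have "\<dots> = sqn M f - (ip M f g + cnj (ip M f g)) + sqn M g"
    by (simp flip: sqn_eq_ip ip_cnj[of M f g] add: complex_cnj_diff)
  finally have "Re (complex_of_real (sqn M (\<lambda>x. f x - g x))) =
     Re (sqn M f - (ip M f g + cnj (ip M f g)) + sqn M g)" by simp
  then show ?thesis by simp
qed

lemma sqn_scale: "sqn M (\<lambda>x. c * f x) = (norm c)\<^sup>2 * sqn M f"
  by (simp add: sqn_def norm_mult power_mult_distrib)

lemma sqn_uminus: "sqn M (\<lambda>x. - f x) = sqn M f"
  by (simp add: sqn_def)

text \<open>Cauchy-Schwarz is read off Minkowski's inequality: expanding \<open>sqn\<close> of the
  sum and of the difference bounds the real part from both sides, and rotating \<open>f\<close> by a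
  unimodular constant turns the inner product into its modulus.\<close>

lemma ip_bound:
  assumes "f \<in> L2_fun M" "g \<in> L2_fun M"
  shows "norm (ip M f g) \<le> sqrt (sqn M f) * sqrt (sqn M g)"
proof -
  have *: "sqrt (sqn M (\<lambda>x. f x + g x)) \<le> sqrt (sqn M f) + sqrt (sqn M g)" 
    if "f \<in> L2_fun M" "g \<in> L2_fun M" for f g
    using L2_Minkowski[OF that] by (simp add: sqn_def)
  have re: "\<bar>Re (ip M f g)\<bar> \<le> sqrt (sqn M f) * sqrt (sqn M g)" 
    if f: "f \<in> L2_fun M" and g: "g \<in> L2_fun M" for f g
  proof -
    let ?a = "sqrt (sqn M f)" and ?b = "sqrt (sqn M g)"
    have m: "(\<lambda>x. - g x) \<in> L2_fun M" using g by (rule L2_fun_uminus)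
    have sq: "?a\<^sup>2 = sqn M f" "?b\<^sup>2 = sqn M g" by simp_all
    have i: "ip M f (\<lambda>x. - g x) = - ip M f g" by (simp add: ip_def)
    have "sqn M (\<lambda>x. f x - g x) \<le> (?a + ?b)\<^sup>2"
      using *[OF f m] by (simp add: sqn_uminus sqrt_le_D)
    moreover have "sqn M (\<lambda>x. f x + g x) \<le> (?a + ?b)\<^sup>2"
      using *[OF f g] by (simp add: sqrt_le_D)
    ultimately show ?thesis
      using sqn_diff[OF f g] sqn_diff[OF f m] i
      by (simp add: power2_sum sq sqn_uminus)
  qed
  define c where "c = (if ip M f g = 0 then 1 else cnj (ip M f g) / norm (ip M f g))"
  have c: "norm c = 1" "c * ip M f g = norm (ip M f g)"
    using complex_norm_square[of "ip M f g"]
    by (auto simp: c_def norm_divide power2_eq_square field_simps)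
  have "norm (ip M f g) = Re (ip M (\<lambda>x. c * f x) g)"
    by (simp add: ip_scale_left c)
  also have "\<dots> \<le> sqrt (sqn M (\<lambda>x. c * f x)) * sqrt (sqn M g)"
    using re[OF L2_fun_scale[OF assms(1), of c] assms(2)] by linarith
  also have "\<dots> = sqrt (sqn M f) * sqrt (sqn M g)"
    by (simp add: sqn_scale c)
  finally show ?thesis .
qed

lemma sqn_triangle:
  assumes "f \<in> L2_fun M" "g \<in> L2_fun M"
  shows "sqrt (sqn M (\<lambda>x. f x + g x)) \<le> sqrt (sqn M f) + sqrt (sqn M g)"
  using L2_Minkowski[OF assms] by (simp add: sqn_def)

lemma sqn_triangle_diff:
  assumes "f \<in> L2_fun M" "g \<in> L2_fun M"
  shows "sqrt (sqn M (\<lambda>x. f x - g x)) \<le> sqrt (sqn M f) + sqrt (sqn M g)"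
  using sqn_triangle[OF assms(1) L2_fun_uminus[OF assms(2)]] by (simp add: sqn_uminus)

lemma sqn_bound:
  assumes "f \<in> borel_measurable M" "g \<in> L2_fun M" "AE x in M. norm (f x) \<le> K * norm (g x)"
  shows "f \<in> L2_fun M" "sqn M f \<le> K\<^sup>2 * sqn M g"
proof -
  have ae: "AE x in M. (norm (f x))\<^sup>2 \<le> K\<^sup>2 * (norm (g x))\<^sup>2"
    using assms(3)
  proof eventually_elim
    case (elim x)
    then show ?case using power_mono[OF elim, of 2] by (simp add: power_mult_distrib)
  qed
  have i: "integrable M (\<lambda>x. K\<^sup>2 * (norm (g x))\<^sup>2)"
    using assms(2) by (simp add: L2_fun_integrable_sq)
  have "integrable M (\<lambda>x. (norm (f x))\<^sup>2)"
    by (rule Bochner_Integration.integrable_bound[OF i]) (use assms(1) ae in auto)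
  then show f: "f \<in> L2_fun M" using assms(1) by (simp add: L2_fun_def)
  have "sqn M f \<le> (LINT x|M. K\<^sup>2 * (norm (g x))\<^sup>2)"
    unfolding sqn_def by (rule integral_mono_AE) (use f i ae in \<open>auto simp: L2_fun_integrable_sq\<close>)
  then show "sqn M f \<le> K\<^sup>2 * sqn M g" by (simp add: sqn_def)
qed

lemma sqn_cong_AE:
  assumes "f \<in> L2_fun M" "g \<in> L2_fun M" "AE x in M. f x = g x"
  shows "sqn M f = sqn M g"
  unfolding sqn_def by (rule integral_cong_AE) (use assms in \<open>auto dest!: L2_fun_measurable\<close>)

lemma L2_norm_sqn: "L2_norm M F = sqrt (sqn M (rep F))"
  by (simp add: L2_norm_def sqn_def)

lemma L2_dist_sqn: "L2_dist M F G = sqrt (sqn M (\<lambda>x. rep F x - rep G x))"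
  by (simp add: L2_dist_def sqn_def)

section \<open>The torus as a finite measure space\<close>

abbreviation sqT :: "real \<Rightarrow> (real \<Rightarrow> complex) \<Rightarrow> real" where
  "sqT L \<equiv> sqn (torus L)"

abbreviation ipT :: "real \<Rightarrow> (real \<Rightarrow> complex) \<Rightarrow> (real \<Rightarrow> complex) \<Rightarrow> complex" where
  "ipT L \<equiv> ip (torus L)"

abbreviation L2T :: "real \<Rightarrow> (real \<Rightarrow> complex) set" where
  "L2T L \<equiv> L2_fun (torus L)"

abbreviation distT :: "real \<Rightarrow> (real \<Rightarrow> complex) set \<Rightarrow> (real \<Rightarrow> complex) set \<Rightarrow> real" where
  "distT L \<equiv> L2_dist (torus L)"

lemma torus_finite: "finite_measure (torus L)"
  by (simp add: torus_def finite_measure_lebesgue_on)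

lemma space_torus [simp]: "space (torus L) = {- L / 2 .. L / 2}"
  by (simp add: torus_def)

lemma measure_torus: "L > 0 \<Longrightarrow> measure (torus L) (space (torus L)) = L"
  by (simp add: torus_def measure_restrict_space)

lemma continuous_measurable_torus: 
  "continuous_on {- L / 2 .. L / 2} f \<Longrightarrow> f \<in> borel_measurable (torus L)"
  unfolding torus_def by (rule continuous_imp_measurable_on_sets_lebesgue) auto

lemma bounded_L2_fun:
  assumes "f \<in> borel_measurable (torus L)" "AE x in torus L. norm (f x) \<le> K"
  shows "f \<in> L2T L"
proof -
  interpret finite_measure "torus L" by (rule torus_finite)
  have "(\<lambda>x. 1) \<in> L2T L" by (simp add: L2_fun_def)
  from sqn_bound(1)[OF assms(1) this, of K] assms(2) show ?thesis by simp
qed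

lemma continuous_L2_fun:
  assumes "continuous_on UNIV f"
  shows "f \<in> L2T L"
proof -
  have c: "continuous_on {- L / 2 .. L / 2} f" using assms continuous_on_subset by blast
  then have "bounded (f ` {- L / 2 .. L / 2})"
    by (intro compact_imp_bounded compact_continuous_image) auto
  then obtain K where "\<forall>x\<in>{- L / 2 .. L / 2}. norm (f x) \<le> K"
    by (auto simp: bounded_iff)
  then show ?thesis
    by (intro bounded_L2_fun[of _ _ K] continuous_measurable_torus c AE_I2) auto
qed

text \<open>Cauchy-Schwarz against the constant 1, whose squared norm is L. Applied to the square of
  a modulus it compares the L4 and L2 norms, which produces the quadratic damping in the energy
  inequality.\<close>

lemma L2_fun_L1_bound:
  assumes "L > 0" "f \<in> L2T L"
  shows "integrable (torus L) f" "(LINT x|torus L. norm (f x)) \<le> sqrt L * sqrt (sqT L f)"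
proof -
  have 1: "(\<lambda>x. 1) \<in> L2T L" by (rule continuous_L2_fun) auto
  show "integrable (torus L) f" using L2_fun_prod_integrable[OF assms(2) 1] by simp
  have n: "(\<lambda>x. of_real (norm (f x))) \<in> L2T L"
    using assms(2) by (auto simp: L2_fun_def)
  have "sqT L (\<lambda>x. 1) = L" 
    using measure_torus[OF assms(1)] by (simp add: sqn_def)
  moreover have "sqT L (\<lambda>x. of_real (norm (f x))) = sqT L f"
    by (simp add: sqn_def)
  moreover have "ipT L (\<lambda>x. of_real (norm (f x))) (\<lambda>x. 1) = of_real (LINT x|torus L. norm (f x))"
    by (simp add: ip_def)
  ultimately show "(LINT x|torus L. norm (f x)) \<le> sqrt L * sqrt (sqT L f)"
    using ip_bound[OF n 1] by (simp add: mult.commute)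
qed

section \<open>Fourier series on the torus\<close>

definition freq :: "real \<Rightarrow> int \<Rightarrow> real" where
  "freq L k = 2 * pi * of_int k / L"

definition fexp :: "real \<Rightarrow> int \<Rightarrow> real \<Rightarrow> complex" where
  "fexp L k x = cis (freq L k * x)"

text \<open>The pairing with \<open>fexp L (- k)\<close> involves no conjugation, just as the test
  function pairing of the weak formulation; so a weak equation tested with this exponential is
  literally an equation for the coefficient. The division by L compensates that exponentials have
  squared norm L.\<close>

definition fc :: "real \<Rightarrow> (real \<Rightarrow> complex) \<Rightarrow> int \<Rightarrow> complex" where
  "fc L f k = (LINT x|torus L. f x * fexp L (- k) x) / of_real L"

definition fpart :: "real \<Rightarrow> nat \<Rightarrow> (real \<Rightarrow> complex) \<Rightarrow> real \<Rightarrow> complex" where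
  "fpart L N f x = (\<Sum>k\<in>{- int N..int N}. fc L f k * fexp L k x)"

lemma freq_uminus [simp]: "freq L (- k) = - freq L k"
  by (simp add: freq_def)

lemma cnj_fexp: "cnj (fexp L k x) = fexp L (- k) x"
  by (simp add: fexp_def cis_cnj)

lemma norm_fexp [simp]: "norm (fexp L k x) = 1"
  by (simp add: fexp_def)

lemma fexp_mult: "fexp L k x * fexp L l x = fexp L (k + l) x"
  by (simp add: fexp_def freq_def cis_mult algebra_simps add_divide_distrib)

lemma fexp_0 [simp]: "fexp L 0 x = 1"
  by (simp add: fexp_def freq_def)

lemma fexp_continuous: "continuous_on S (fexp L k)"
  unfolding fexp_def by (intro continuous_intros)

lemma fexp_L2_fun: "fexp L k \<in> L2T L"
  by (rule continuous_L2_fun[OF fexp_continuous])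

lemma fexp_deriv: "(fexp L k has_vector_derivative (\<i> * freq L k * fexp L k x)) (at x)"
proof -
  have "((\<lambda>z. exp (\<i> * freq L k * z)) has_field_derivative (exp (\<i> * freq L k * of_real x) * (\<i> * freq L k))) (at (of_real x))"
    by (auto intro!: derivative_eq_intros)
  from has_vector_derivative_real_field[OF this] show ?thesis
    by (simp add: o_def fexp_def[abs_def] cis_conv_exp mult_ac)
qed

lemma D_fexp: "D (\<lambda>x. c * fexp L k x) = (\<lambda>x. (\<i> * freq L k * c) * fexp L k x)"
  using has_vector_derivative_mult_right[OF fexp_deriv, of c L k]
  by (auto simp: fun_eq_iff mult_ac intro!: vector_derivative_at)

lemma D_fexp_pow: "(D ^^ n) (fexp L k) = (\<lambda>x. (\<i> * freq L k) ^ n * fexp L k x)"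
  by (induction n) (simp_all add: D_fexp mult.assoc)

text \<open>Exponentials are admissible test functions, which is what allows the weak equation to be
  split into scalar equations.\<close>

lemma fexp_smooth:
  assumes "L > 0" shows "fexp L k \<in> smooth_periodic L"
proof -
  have "fexp L k (x + L) = fexp L k x" for x
  proof -
    have "freq L k * (x + L) = freq L k * x + 2 * pi * of_int k"
      using assms by (simp add: freq_def field_simps)
    then have "fexp L k (x + L) = cis (freq L k * x) * cis (2 * pi * of_int k)"
      by (simp only: fexp_def cis_mult)
    then show ?thesis by (simp add: fexp_def)
  qed
  moreover have "(D ^^ n) (fexp L k) differentiable at x" for n x
    unfolding D_fexp_pow
    using has_vector_derivative_mult_right[OF fexp_deriv, of "(\<i> * freq L k) ^ n" L k x]
    by (auto simp: has_vector_derivative_def differentiable_def)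
  ultimately show ?thesis by (simp add: smooth_periodic_def)
qed

text \<open>For nonzero frequency an antiderivative is a multiple of the exponential itself, and by
  periodicity it takes the same value at both ends.\<close>

lemma integral_fexp:
  assumes "L > 0"
  shows "(LINT x|torus L. fexp L k x) = (if k = 0 then of_real L else 0)"
proof (cases "k = 0")
  case True
  then show ?thesis using measure_torus[OF assms] by (simp add: scaleR_conv_of_real)
next
  case False
  define c where "c = \<i> * freq L k"
  have c: "c \<noteq> 0" using False assms by (simp add: c_def freq_def)
  have "fexp L k (- L / 2) = fexp L k (- L / 2 + L)"
    using fexp_smooth[OF assms, of k] unfolding smooth_periodic_def mem_Collect_eq by metis
  then have per: "fexp L k (- (L / 2)) = fexp L k (L / 2)" by simp
  have "integrable (lebesgue_on {- L / 2..L / 2}) (fexp L k)"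
    using L2_fun_L1_bound(1)[OF assms fexp_L2_fun] by (simp add: torus_def)
  then have "((fexp L k) has_integral (LINT x|torus L. fexp L k x)) {- L / 2..L / 2}"
    unfolding torus_def by (intro has_integral_integral_lebesgue_on) auto
  moreover have "((\<lambda>x. fexp L k x) has_integral (inverse c * fexp L k (L / 2) - inverse c * fexp L k (- L / 2))) {- L / 2..L / 2}"
  proof (rule fundamental_theorem_of_calculus)
    fix x assume "x \<in> {- L / 2..L / 2}"
    have "((\<lambda>x. inverse c * fexp L k x) has_vector_derivative (inverse c * (c * fexp L k x))) (at x)"
      unfolding c_def by (rule has_vector_derivative_mult_right[OF fexp_deriv])
    moreover have "inverse c * (c * fexp L k x) = fexp L k x"
      using c by simp
    ultimately show "((\<lambda>x. inverse c * fexp L k x) has_vector_derivative fexp L k x) (at x within {- L / 2..L / 2})"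
      by (metis has_vector_derivative_at_within)
  qed (use assms in auto)
  ultimately have "(LINT x|torus L. fexp L k x) = inverse c * fexp L k (L / 2) - inverse c * fexp L k (- L / 2)"
    by (rule has_integral_unique)
  then show ?thesis using False per by simp
qed

lemma fc_ip: "L > 0 \<Longrightarrow> ipT L f (fexp L k) = of_real L * fc L f k"
  by (simp add: ip_def fc_def cnj_fexp)

lemma ip_fexp:
  "L > 0 \<Longrightarrow> ipT L (fexp L k) (fexp L l) = (if k = l then of_real L else 0)"
  by (simp add: ip_def cnj_fexp fexp_mult integral_fexp)

lemma fexp_left_ip: "L > 0 \<Longrightarrow> ipT L (fexp L k) g = of_real L * cnj (fc L g k)"
  by (subst ip_cnj) (simp add: fc_ip)

lemma fpart_L2_fun: "fpart L N f \<in> L2T L"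
  unfolding fpart_def[abs_def] by (intro L2_fun_sum L2_fun_scale fexp_L2_fun)

lemma fpart_ip:
  assumes "L > 0" "g \<in> L2T L"
  shows "ipT L (fpart L N f) g = of_real L * (\<Sum>k\<in>{- int N..int N}. fc L f k * cnj (fc L g k))"
  unfolding fpart_def[abs_def]
  using assms by (subst ip_sum_left)
    (auto intro!: L2_fun_scale fexp_L2_fun sum.cong simp: ip_scale_left fexp_left_ip sum_distrib_left mult_ac)

lemma fc_fpart:
  assumes "L > 0"
  shows "fc L (fpart L N f) k = (if k \<in> {- int N..int N} then fc L f k else 0)"
proof -
  have "of_real L * fc L (fpart L N f) k = ipT L (fpart L N f) (fexp L k)"
    using assms by (simp add: fc_ip)
  also have "\<dots> = (\<Sum>j\<in>{- int N..int N}. fc L f j * (if j = k then of_real L else 0))"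
    unfolding fpart_def[abs_def] using assms
    by (subst ip_sum_left) (auto intro!: L2_fun_scale fexp_L2_fun sum.cong simp: ip_scale_left ip_fexp)
  also have "\<dots> = of_real L * (if k \<in> {- int N..int N} then fc L f k else 0)"
    by (simp add: if_distrib cong: if_cong)
  finally show ?thesis using assms by (auto split: if_splits)
qed

lemma fc_diff:
  assumes "L > 0" "f \<in> L2T L" "g \<in> L2T L"
  shows "fc L (\<lambda>x. f x - g x) k = fc L f k - fc L g k"
proof -
  have "of_real L * fc L (\<lambda>x. f x - g x) k = of_real L * (fc L f k - fc L g k)"
    using assms fexp_L2_fun[of L k] by (simp add: ip_diff_left right_diff_distrib flip: fc_ip)
  then show ?thesis using assms by simp
qed

text \<open>Pythagoras: \<open>fpart\<close> is an orthogonal projection, so its inner product with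
  \<open>f\<close> equals its own squared norm. Bessel's inequality follows because the left-hand
  side is nonnegative.\<close>

lemma sqn_fpart_complement:
  assumes "L > 0" "f \<in> L2T L"
  shows "sqT L (\<lambda>x. f x - fpart L N f x) = sqT L f - sqT L (fpart L N f)"
proof -
  have "ipT L (fpart L N f) f = ipT L (fpart L N f) (fpart L N f)"
    using assms by (simp add: fpart_ip fpart_L2_fun fc_fpart)
  then have "Re (ipT L f (fpart L N f)) = sqT L (fpart L N f)"
    by (subst ip_cnj) (simp flip: sqn_eq_ip)
  then show ?thesis
    using sqn_diff[OF assms(2) fpart_L2_fun[of L N f]] by simp
qed

lemma sqn_fpart:
  assumes "L > 0"
  shows "sqT L (fpart L N f) = L * (\<Sum>k\<in>{- int N..int N}. (norm (fc L f k))\<^sup>2)"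
proof -
  have "complex_of_real (sqT L (fpart L N f)) = 
    complex_of_real (L * (\<Sum>k\<in>{- int N..int N}. (norm (fc L f k))\<^sup>2))"
    using assms by (simp add: sqn_eq_ip fpart_ip fpart_L2_fun fc_fpart complex_norm_square del: of_real_power)
  then show ?thesis using of_real_eq_iff by blast
qed

lemma bessel:
  assumes "L > 0" "f \<in> L2T L"
  shows "sqT L (fpart L N f) \<le> sqT L f"
proof -
  have "0 \<le> sqT L f - sqT L (fpart L N f)"
    unfolding sqn_fpart_complement[OF assms, symmetric] by (rule sqn_nonneg)
  then show ?thesis by simp
qed

section \<open>Density of trigonometric polynomials in L2\<close>

inductive trigp :: "real \<Rightarrow> (real \<Rightarrow> complex) \<Rightarrow> bool" for L where
  zero: "trigp L (\<lambda>x. 0)"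
| add_term: "trigp L p \<Longrightarrow> trigp L (\<lambda>x. p x + c * fexp L k x)"

lemma trigp_L2_fun: "trigp L p \<Longrightarrow> p \<in> L2T L"
proof (induction rule: trigp.induct)
  case (add_term p c k)
  show ?case by (rule L2_fun_add[OF add_term.IH L2_fun_scale[OF fexp_L2_fun]])
qed (rule L2_fun_zero)

lemma trigp_fexp: "trigp L (\<lambda>x. c * fexp L k x)"
  using trigp.add_term[OF trigp.zero, of L c k] by simp

lemma trigp_const: "trigp L (\<lambda>x. c)"
  using trigp_fexp[of L c 0] by simp

lemma trigp_add: "trigp L q \<Longrightarrow> trigp L p \<Longrightarrow> trigp L (\<lambda>x. p x + q x)"
proof (induction rule: trigp.induct)
  case (add_term q c k)
  from trigp.add_term[OF add_term.IH[OF add_term.prems], of c k] show ?case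
    by (simp add: add.assoc)
qed simp

lemma trigp_mult_fexp: "trigp L p \<Longrightarrow> trigp L (\<lambda>x. p x * (d * fexp L l x))"
proof (induction rule: trigp.induct)
  case (add_term q c k)
  have "(q x + c * fexp L k x) * (d * fexp L l x) = q x * (d * fexp L l x) + (c * d) * fexp L (k + l) x" for x
    unfolding fexp_mult[symmetric] by (simp add: algebra_simps)
  with trigp.add_term[OF add_term.IH, of "c * d" "k + l"] show ?case by simp
qed (simp add: trigp.zero)

lemma trigp_mult: "trigp L q \<Longrightarrow> trigp L p \<Longrightarrow> trigp L (\<lambda>x. p x * q x)"
proof (induction rule: trigp.induct)
  case (add_term q c k)
  from trigp_add[OF trigp_mult_fexp[OF add_term.prems, of c k] add_term.IH[OF add_term.prems]] show ?case
    by (simp add: distrib_left)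
qed (simp add: trigp.zero)

text \<open>A real-linear functional on the plane has the form \<open>A * z + B * cnj z\<close>,
  with \<open>A\<close> and \<open>B\<close> determined by its values at 1 and \<open>\<i>\<close>.
  On the unit circle \<open>cnj\<close> turns the exponential of frequency 1 into that of frequency
  -1, so this is a trigonometric polynomial; sums and products then preserve the class.\<close>

lemma trigp_real_polynomial:
  fixes g :: "complex \<Rightarrow> real"
  assumes "real_polynomial_function g"
  shows "trigp L (\<lambda>x. of_real (g (fexp L 1 x)))"
  using assms
proof (induction rule: real_polynomial_function.induct)
  case (linear f)
  have f: "f z = Re z * f 1 + Im z * f \<i>" for z
  proof -
    have "z = Re z *\<^sub>R 1 + Im z *\<^sub>R \<i>" by (simp add: complex_eq_iff)
    then have "f z = f (Re z *\<^sub>R 1 + Im z *\<^sub>R \<i>)" by simp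
    also have "\<dots> = Re z * f 1 + Im z * f \<i>"
      using linear by (simp add: bounded_linear.linear linear_add linear_scale)
    finally show ?thesis .
  qed
  define A where "A = (complex_of_real (f 1) - \<i> * of_real (f \<i>)) / 2"
  define B where "B = (complex_of_real (f 1) + \<i> * of_real (f \<i>)) / 2"
  have "complex_of_real (f z) = A * z + B * cnj z" for z
    by (subst f) (simp add: complex_eq_iff A_def B_def algebra_simps add_divide_distrib[symmetric])
  then have "complex_of_real (f (fexp L 1 x)) = A * fexp L 1 x + B * fexp L (- 1) x" for x
    by (simp add: cnj_fexp)
  then show ?case
    using trigp_add[OF trigp_fexp[of L B "- 1"] trigp_fexp[of L A 1]] by simp
next
  case (const c)
  show ?case by (rule trigp_const)
next
  case (add f g)
  then show ?case by (simp add: trigp_add)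
next
  case (mult f g)
  then show ?case by (simp add: trigp_mult)
qed

lemma trigp_polynomial:
  fixes g :: "complex \<Rightarrow> complex"
  assumes "polynomial_function g"
  shows "trigp L (\<lambda>x. g (fexp L 1 x))"
proof -
  have "real_polynomial_function (Re \<circ> g)" "real_polynomial_function (Im \<circ> g)"
    using assms bounded_linear_Re bounded_linear_Im by (auto simp: polynomial_function_def)
  from trigp_add[OF trigp_mult[OF trigp_const[of L \<i>] trigp_real_polynomial[OF this(2)]]
      trigp_real_polynomial[OF this(1), of L]]
  have "trigp L (\<lambda>x. of_real (Re (g (fexp L 1 x))) + of_real (Im (g (fexp L 1 x))) * \<i>)"
    by (simp add: o_def)
  moreover have "of_real (Re z) + of_real (Im z) * \<i> = z" for z by (simp add: complex_eq_iff)
  ultimately show ?thesis by simp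
qed

text \<open>As soon as N exceeds every frequency in \<open>p\<close>, the remainder of
  \<open>f\<close> has vanishing coefficients at all of them.\<close>

lemma trigp_orthogonal:
  assumes "L > 0" "trigp L p" 
  shows "\<exists>N0. \<forall>N\<ge>N0. \<forall>f\<in>L2T L. ipT L p (\<lambda>x. f x - fpart L N f x) = 0"
  using assms(2)
proof (induction rule: trigp.induct)
  case zero
  show ?case by (simp add: ip_def)
next
  case (add_term p c k)
  then obtain N0 where N0: "\<And>N f. N \<ge> N0 \<Longrightarrow> f\<in>L2T L \<Longrightarrow> ipT L p (\<lambda>x. f x - fpart L N f x) = 0"
    by blast
  have "ipT L (\<lambda>x. p x + c * fexp L k x) (\<lambda>x. f x - fpart L N f x) = 0"
    if N: "N \<ge> max N0 (nat \<bar>k\<bar>)" and f: "f \<in> L2T L" for N f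
  proof -
    have d: "(\<lambda>x. f x - fpart L N f x) \<in> L2T L"
      by (intro L2_fun_diff f fpart_L2_fun)
    have "k \<in> {- int N..int N}" using N by auto
    then have "fc L (\<lambda>x. f x - fpart L N f x) k = 0"
      using assms(1) f by (simp add: fc_diff fpart_L2_fun fc_fpart)
    then show ?thesis
      using N0[OF _ f, of N] N trigp_L2_fun[OF add_term.hyps] d assms(1)
      by (simp add: ip_add_left ip_scale_left L2_fun_scale fexp_L2_fun fexp_left_ip)
  qed
  then show ?case by blast
qed

text \<open>The error f - p is the remainder r minus q, where q = p - \<open>fpart\<close> is
  orthogonal to r for large N; hence its squared norm is that of r plus that of q.\<close>

lemma fpart_best:
  assumes "L > 0" "trigp L p" 
  shows "\<exists>N0. \<forall>N\<ge>N0. \<forall>f\<in>L2T L.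
    sqT L (\<lambda>x. f x - fpart L N f x) \<le> sqT L (\<lambda>x. f x - p x)"
proof -
  obtain N0 where N0: "\<And>N f. N \<ge> N0 \<Longrightarrow> f \<in> L2T L \<Longrightarrow> ipT L p (\<lambda>x. f x - fpart L N f x) = 0"
    using trigp_orthogonal[OF assms] by blast
  have "sqT L (\<lambda>x. f x - fpart L N f x) \<le> sqT L (\<lambda>x. f x - p x)"
    if N: "N \<ge> N0" and f: "f \<in> L2T L" for N f
  proof -
    let ?r = "\<lambda>x. f x - fpart L N f x" and ?q = "\<lambda>x. p x - fpart L N f x"
    have p: "p \<in> L2T L" by (rule trigp_L2_fun[OF assms(2)])
    have r: "?r \<in> L2T L" and q: "?q \<in> L2T L"
      by (intro L2_fun_diff f p fpart_L2_fun)+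
    have "ipT L (fpart L N f) ?r = 0"
      using assms(1) f r by (simp add: fpart_ip fc_diff fpart_L2_fun fc_fpart)
    then have "ipT L ?q ?r = 0"
      using N0[OF N f] r p by (simp add: ip_diff_left fpart_L2_fun)
    then have "Re (ipT L ?r ?q) = 0" by (subst ip_cnj) simp
    then have "sqT L (\<lambda>x. ?r x - ?q x) = sqT L ?r + sqT L ?q"
      using sqn_diff[OF r q] by simp
    then show ?thesis by simp
  qed
  then show ?thesis by blast
qed

lemma sqn_tendsto_0:
  assumes "f \<in> borel_measurable M" "\<And>n. g n \<in> borel_measurable M" "integrable M w"
    "\<And>n. AE x in M. (norm (f x - g n x))\<^sup>2 \<le> w x"
    "AE x in M. (\<lambda>n. g n x) \<longlonglongrightarrow> f x"
  shows "(\<lambda>n. sqn M (\<lambda>x. f x - g n x)) \<longlonglongrightarrow> 0"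
proof -
  have "(\<lambda>n. LINT x|M. (norm (f x - g n x))\<^sup>2) \<longlonglongrightarrow> (LINT x|M. (0::real))"
  proof (rule integral_dominated_convergence[of _ _ _ w])
    show "AE x in M. (\<lambda>n. (norm (f x - g n x))\<^sup>2) \<longlonglongrightarrow> 0"
      using assms(5)
    proof eventually_elim
      case (elim x)
      have "(\<lambda>n. (norm (f x - g n x))\<^sup>2) \<longlonglongrightarrow> (norm (f x - f x))\<^sup>2"
        by (intro tendsto_intros elim)
      then show ?case by simp
    qed
  qed (use assms in auto)
  then show ?thesis by (simp add: sqn_def)
qed

text \<open>This is membership in the L2 closure of the trigonometric polynomials. The class is
  enlarged step by step: continuous functions on the circle, bounded continuous functions on the
  line, bounded measurable functions, all of L2.\<close>

definition trig_approx :: "real \<Rightarrow> (real \<Rightarrow> complex) \<Rightarrow> bool" where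
  "trig_approx L f \<longleftrightarrow> f \<in> L2T L \<and> 
     (\<forall>e>0. \<exists>p. trigp L p \<and> sqrt (sqT L (\<lambda>x. f x - p x)) < e)"

lemma trig_approx_limit:
  assumes "f \<in> L2T L" "\<And>n. trig_approx L (g n)"
    "(\<lambda>n. sqT L (\<lambda>x. f x - g n x)) \<longlonglongrightarrow> 0"
  shows "trig_approx L f"
  unfolding trig_approx_def
proof (intro conjI allI impI)
  fix e :: real assume e: "e > 0"
  have "(\<lambda>n. sqrt (sqT L (\<lambda>x. f x - g n x))) \<longlonglongrightarrow> sqrt 0"
    by (intro tendsto_intros assms)
  then have "eventually (\<lambda>n. sqrt (sqT L (\<lambda>x. f x - g n x)) < e / 2) sequentially"
    using e by (intro order_tendstoD(2)[of _ "sqrt 0"]) auto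
  then obtain n where n: "sqrt (sqT L (\<lambda>x. f x - g n x)) < e / 2"
    by (auto simp: eventually_sequentially)
  have gn: "g n \<in> L2T L" using assms(2) by (simp add: trig_approx_def)
  obtain p where p: "trigp L p" "sqrt (sqT L (\<lambda>x. g n x - p x)) < e / 2"
    using assms(2)[of n] e unfolding trig_approx_def by (meson half_gt_zero)
  have "sqrt (sqT L (\<lambda>x. (f x - g n x) + (g n x - p x))) < e"
    using sqn_triangle[OF L2_fun_diff[OF assms(1) gn] L2_fun_diff[OF gn trigp_L2_fun[OF p(1)]]] n p(2)
    by linarith
  then show "\<exists>p. trigp L p \<and> sqrt (sqT L (\<lambda>x. f x - p x)) < e"
    using p(1) by auto
qed (rule assms)

text \<open>Stone-Weierstrass on the circle as a compact subset of the plane: polynomials in the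
  real and imaginary parts, composed with the basic exponential, are trigonometric
  polynomials.\<close>

lemma trig_approx_sphere:
  assumes "L > 0" "continuous_on (sphere 0 1) G"
  shows "trig_approx L (\<lambda>x. G (fexp L 1 x))"
proof -
  have "\<exists>p. trigp L p \<and> (\<forall>x. norm (G (fexp L 1 x) - p x) \<le> 1 / real (Suc n))" for n
  proof -
    obtain g where g: "polynomial_function g" "\<And>z. z \<in> sphere 0 1 \<Longrightarrow> norm (G z - g z) < 1 / real (Suc n)"
      using Stone_Weierstrass_polynomial_function[OF _ assms(2), of "1 / real (Suc n)"] by auto
    then show ?thesis
      by (intro exI[of _ "\<lambda>x. g (fexp L 1 x)"]) (auto intro!: trigp_polynomial less_imp_le)
  qed
  then obtain p where p: "\<And>n. trigp L (p n)" "\<And>n x. norm (G (fexp L 1 x) - p n x) \<le> 1 / real (Suc n)"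
    by metis
  have c: "continuous_on UNIV (\<lambda>x. G (fexp L 1 x))"
    by (rule continuous_on_compose2[OF assms(2) fexp_continuous]) auto
  have f: "(\<lambda>x. G (fexp L 1 x)) \<in> L2T L"
    by (rule continuous_L2_fun[OF c])
  show ?thesis
  proof (rule trig_approx_limit[OF f])
    show "trig_approx L (p n)" for n
      using p(1)[of n] trigp_L2_fun by (auto simp: trig_approx_def intro!: exI[of _ "p n"] simp: sqn_def)
    interpret finite_measure "torus L" by (rule torus_finite)
    show "(\<lambda>n. sqT L (\<lambda>x. G (fexp L 1 x) - p n x)) \<longlonglongrightarrow> 0"
    proof (rule sqn_tendsto_0[where w = "\<lambda>x. 1"])
      show "AE x in torus L. (norm (G (fexp L 1 x) - p n x))\<^sup>2 \<le> 1" for n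
      proof (rule AE_I2)
        fix x
        have "norm (G (fexp L 1 x) - p n x) \<le> 1 / real (Suc n)" by (rule p)
        also have "\<dots> \<le> 1" by simp
        finally show "(norm (G (fexp L 1 x) - p n x))\<^sup>2 \<le> 1" by (simp add: power_le_one)
      qed
      have "(\<lambda>n. p n x - G (fexp L 1 x)) \<longlonglongrightarrow> 0" for x
      proof (rule Lim_null_comparison)
        show "\<forall>\<^sub>F n in sequentially. norm (p n x - G (fexp L 1 x)) \<le> 1 / real (Suc n)"
          using p(2) by (simp add: norm_minus_commute)
        show "(\<lambda>n. 1 / real (Suc n)) \<longlonglongrightarrow> 0"
          by (rule LIMSEQ_Suc[OF lim_inverse_n'])
      qed
      then show "AE x in torus L. (\<lambda>n. p n x) \<longlonglongrightarrow> G (fexp L 1 x)"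
        by (simp add: LIM_zero_iff)
    qed (use f trigp_L2_fun[OF p(1)] in \<open>auto dest: L2_fun_measurable\<close>)
  qed
qed

text \<open>\<open>g\<close> need not be periodic, so its values at the two ends of the torus may
  disagree and it does not descend to a continuous function on the circle. Damping near the junction
  repairs this; convergence then fails at most at the two end points, a null set, and the bound
  \<open>M\<close> makes it dominated.\<close>

lemma trig_approx_continuous:
  assumes L: "L > 0" and g: "continuous_on UNIV g" and M: "\<And>x. norm (g x) \<le> M"
  shows "trig_approx L g"
proof -
  \<comment> \<open>The cutoff \<open>ct n\<close> vanishes at \<open>-1\<close>, where \<open>Arg\<close> jumps.\<close>
  define ct where "ct n z = complex_of_real (min 1 (real n * norm (z + 1)))" for n and z :: complex
  define G where "G n z = ct n z * g (L * Arg z / (2 * pi))" for n z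
  have ct: "norm (ct n z) \<le> 1" for n z by (simp add: ct_def)
  have cont: "continuous_on (sphere 0 1) (G n)" for n
    unfolding continuous_on_eq_continuous_within
  proof
    fix z :: complex assume z: "z \<in> sphere 0 1"
    show "continuous (at z within sphere 0 1) (G n)"
    proof (cases "z = -1")
      case False
      have nz: "z \<notin> \<real>\<^sub>\<le>\<^sub>0"
        using z False by (auto simp: complex_nonpos_Reals_iff complex_eq_iff cmod_def power2_eq_1_iff)
      have "isCont (\<lambda>z. L * Arg z / (2 * pi)) z"
        by (intro continuous_intros continuous_at_Arg nz) auto
      moreover have "isCont g (L * Arg z / (2 * pi))"
        using g by (simp add: continuous_on_eq_continuous_at)
      ultimately have "isCont (\<lambda>z. g (L * Arg z / (2 * pi))) z"
        by (rule isCont_o2)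
      moreover have "isCont (ct n) z"
        unfolding ct_def by (intro continuous_intros)
      ultimately have "isCont (G n) z" unfolding G_def by (intro continuous_intros)
      then show ?thesis by (rule continuous_at_imp_continuous_within)
    next
      case True
      have "(G n \<longlongrightarrow> 0) (at z)"
      proof (rule Lim_null_comparison)
        show "\<forall>\<^sub>F w in at z. norm (G n w) \<le> real n * norm (w + 1) * M"
          unfolding G_def norm_mult
          by (intro always_eventually allI mult_mono M) (auto simp: ct_def)
        have "((\<lambda>w. real n * norm (w + 1) * M) \<longlongrightarrow> real n * norm (z + 1) * M) (at z)"
          by (intro tendsto_intros)
        then show "((\<lambda>w. real n * norm (w + 1) * M) \<longlongrightarrow> 0) (at z)" using True by simp
      qed
      moreover have "G n z = 0" using True by (simp add: G_def ct_def)
      ultimately show ?thesis by (auto simp: continuous_within intro: tendsto_within_subset)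
    qed
  qed
  have gL: "g \<in> L2T L" by (rule continuous_L2_fun[OF g])
  interpret finite_measure "torus L" by (rule torus_finite)
  show ?thesis
  proof (rule trig_approx_limit[OF gL, where g = "\<lambda>n x. G n (fexp L 1 x)"])
    show t: "trig_approx L (\<lambda>x. G n (fexp L 1 x))" for n
      by (rule trig_approx_sphere[OF L cont])
    show "(\<lambda>n. sqT L (\<lambda>x. g x - G n (fexp L 1 x))) \<longlonglongrightarrow> 0"
    proof (rule sqn_tendsto_0[where w = "\<lambda>x. (M + M)\<^sup>2"])
      show "AE x in torus L. (norm (g x - G n (fexp L 1 x)))\<^sup>2 \<le> (M + M)\<^sup>2" for n
      proof (intro AE_I2 power_mono norm_ge_zero)
        fix x
        have "norm (G n (fexp L 1 x)) \<le> 1 * M"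
          unfolding G_def norm_mult by (intro mult_mono ct M) auto
        then show "norm (g x - G n (fexp L 1 x)) \<le> M + M"
          using M[of x] norm_triangle_ineq4[of "g x" "G n (fexp L 1 x)"] by linarith
      qed
      have lim: "(\<lambda>n. G n (fexp L 1 x)) \<longlonglongrightarrow> g x" if x: "- L / 2 < x" "x < L / 2" for x
      proof -
        have "\<bar>x\<bar> < L / 2" using x by (auto simp: abs_less_iff)
        then have "\<bar>x\<bar> * (2 * pi / L) < L / 2 * (2 * pi / L)"
          using L by (intro mult_strict_right_mono) auto
        then have "\<bar>freq L 1 * x\<bar> < pi"
          using L by (simp add: freq_def abs_mult field_simps)
        then have ran: "- pi < freq L 1 * x" "freq L 1 * x < pi" by (auto simp: abs_less_iff)
        then have arg: "Arg (fexp L 1 x) = freq L 1 * x"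
          unfolding fexp_def by (intro cis_Arg_unique) (auto simp: sgn_eq)
        have "fexp L 1 x \<noteq> -1"
        proof
          assume "fexp L 1 x = -1"
          then have "Arg (fexp L 1 x) = pi" by (simp add: Arg_eq_pi)
          then show False using arg ran by simp
        qed
        then have pos: "norm (fexp L 1 x + 1) > 0" by (simp add: add_eq_0_iff2)
        obtain n0 :: nat where n0: "1 / norm (fexp L 1 x + 1) < real n0"
          using reals_Archimedean2 by blast
        have "G n (fexp L 1 x) = g x" if "n \<ge> n0" for n
        proof -
          have "1 \<le> real n * norm (fexp L 1 x + 1)"
          proof -
            have "1 / norm (fexp L 1 x + 1) \<le> real n" using n0 that by linarith
            then show ?thesis using pos by (simp add: divide_le_eq)
          qed
          then show ?thesis using L by (simp add: G_def ct_def arg freq_def)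
        qed
        then have "\<forall>\<^sub>F n in sequentially. G n (fexp L 1 x) = g x"
          by (auto simp: eventually_sequentially)
        then show ?thesis by (rule tendsto_eventually)
      qed
      have "AE x in torus L. x \<notin> {- L / 2, L / 2}"
      proof -
        have "{- L / 2, L / 2} \<in> null_sets lebesgue"
          by (intro finite_imp_null_set_lborel[THEN null_sets_completionI]) auto
        then have "AE x in lebesgue. x \<notin> {- L / 2, L / 2}" by (rule AE_not_in)
        then show ?thesis unfolding torus_def by (subst AE_restrict_space_iff) auto
      qed
      with AE_space show "AE x in torus L. (\<lambda>n. G n (fexp L 1 x)) \<longlonglongrightarrow> g x"
        by eventually_elim (use lim in auto)
    qed (use gL t in \<open>auto simp: trig_approx_def dest: L2_fun_measurable\<close>)
  qed
qed

lemma trig_approx_bounded: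
  assumes L: "L > 0" and f: "f \<in> borel_measurable (torus L)" and M: "\<And>x. norm (f x) \<le> M"
  shows "trig_approx L f"
proof -
  \<comment> \<open>\<open>M\<close> may be 0, but the clipping below divides by a radius that has
    to be positive.\<close>
  define K where "K = M + 1"
  have K: "K > 0" "norm (f x) \<le> K" for x
    using M[of 0] M[of x] norm_ge_zero[of "f 0"] unfolding K_def by linarith+
  have fL: "f \<in> L2T L" by (rule bounded_L2_fun[OF f, of M]) (use M in auto)
  have "f measurable_on {- L / 2 .. L / 2}"
    using f by (subst measurable_on_iff_borel_measurable) (auto simp: torus_def)
  then obtain N g where N: "negligible N" and g: "\<And>n. continuous_on UNIV (g n)"
    and lim: "\<And>x. x \<notin> N \<Longrightarrow> (\<lambda>n. g n x) \<longlonglongrightarrow> (if x \<in> {- L / 2 .. L / 2} then f x else 0)"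
    unfolding measurable_on_def by blast
  \<comment> \<open>The continuous functions converging to \<open>f\<close> almost everywhere come
    without a common bound. This radial retraction supplies one; it is continuous and fixes the
    values of \<open>f\<close>, so the limit is unchanged.\<close>
  define clip where "clip z = of_real (K / max K (norm z)) * z" for z :: complex
  have clip_cont: "continuous_on UNIV clip"
    unfolding clip_def using K(1) by (intro continuous_intros) (auto simp: max_def)
  have clip_le: "norm (clip z) \<le> K" for z
    using K(1) by (auto simp: clip_def norm_mult norm_divide max_def)
  have clip_id: "norm z \<le> K \<Longrightarrow> clip z = z" for z
    using K(1) by (simp add: clip_def max_def)
  interpret finite_measure "torus L" by (rule torus_finite)
  show ?thesis
  proof (rule trig_approx_limit[OF fL, where g = "\<lambda>n x. clip (g n x)"])
    show t: "trig_approx L (\<lambda>x. clip (g n x))" for n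
      by (rule trig_approx_continuous[OF L _ clip_le])
        (rule continuous_on_compose2[OF clip_cont g], auto)
    show "(\<lambda>n. sqT L (\<lambda>x. f x - clip (g n x))) \<longlonglongrightarrow> 0"
    proof (rule sqn_tendsto_0[where w = "\<lambda>x. (K + K)\<^sup>2"])
      show "AE x in torus L. (norm (f x - clip (g n x)))\<^sup>2 \<le> (K + K)\<^sup>2" for n
      proof (intro AE_I2 power_mono norm_ge_zero)
        fix x show "norm (f x - clip (g n x)) \<le> K + K"
          using K(2)[of x] clip_le[of "g n x"] norm_triangle_ineq4[of "f x" "clip (g n x)"] by linarith
      qed
      have "AE x in lebesgue. x \<notin> N"
        using N by (intro AE_not_in) (simp add: negligible_iff_null_sets)
      moreover have "(\<lambda>n. clip (g n x)) \<longlonglongrightarrow> f x" if "x \<notin> N" "x \<in> {- L / 2..L / 2}" for x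
      proof -
        have "(\<lambda>n. g n x) \<longlonglongrightarrow> f x" using lim[OF that(1)] that(2) by (simp only: if_True)
        then have "(\<lambda>n. clip (g n x)) \<longlonglongrightarrow> clip (f x)"
          by (intro continuous_on_tendsto_compose[OF clip_cont]) auto
        then show ?thesis using clip_id K(2) by simp
      qed
      ultimately show "AE x in torus L. (\<lambda>n. clip (g n x)) \<longlonglongrightarrow> f x"
        unfolding torus_def by (subst AE_restrict_space_iff) (auto elim!: eventually_mono)
    qed (use fL t in \<open>auto simp: trig_approx_def dest: L2_fun_measurable\<close>)
  qed
qed

text \<open>Truncation by height: the truncated functions are bounded, and the square of the error
  is dominated by that of \<open>f\<close>.\<close>

lemma trig_approx_L2:
  assumes L: "L > 0" and f: "f \<in> L2T L"
  shows "trig_approx L f"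
proof (rule trig_approx_limit[OF f, where g = "\<lambda>n x. if norm (f x) \<le> real n then f x else 0"])
  have [measurable]: "f \<in> borel_measurable (torus L)" using f by (rule L2_fun_measurable)
  show t: "trig_approx L (\<lambda>x. if norm (f x) \<le> real n then f x else 0)" for n
    by (rule trig_approx_bounded[OF L, of _ "real n"]) auto
  show "(\<lambda>n. sqT L (\<lambda>x. f x - (if norm (f x) \<le> real n then f x else 0))) \<longlonglongrightarrow> 0"
  proof (rule sqn_tendsto_0[where w = "\<lambda>x. (norm (f x))\<^sup>2"])
    have "(\<lambda>n. if norm (f x) \<le> real n then f x else 0) \<longlonglongrightarrow> f x" for x
    proof (rule tendsto_eventually)
      obtain n0 :: nat where "norm (f x) \<le> real n0" using real_arch_simple by blast
      then show "\<forall>\<^sub>F n in sequentially. (if norm (f x) \<le> real n then f x else 0) = f x"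
        by (auto simp: eventually_sequentially intro!: exI[of _ n0])
    qed
    then show "AE x in torus L. (\<lambda>n. if norm (f x) \<le> real n then f x else 0) \<longlonglongrightarrow> f x" by simp
  qed (use f in \<open>auto simp: L2_fun_integrable_sq\<close>)
qed

lemma fourier_convergence:
  assumes L: "L > 0" and f: "f \<in> L2T L"
  shows "(\<lambda>N. sqT L (\<lambda>x. f x - fpart L N f x)) \<longlonglongrightarrow> 0"
proof (rule LIMSEQ_I)
  fix e :: real assume e: "e > 0"
  obtain p where p: "trigp L p" "sqrt (sqT L (\<lambda>x. f x - p x)) < sqrt e"
    using trig_approx_L2[OF assms] e unfolding trig_approx_def by (meson real_sqrt_gt_zero)
  then have "sqT L (\<lambda>x. f x - p x) < e" by simp
  then show "\<exists>N0. \<forall>N\<ge>N0. norm (sqT L (\<lambda>x. f x - fpart L N f x) - 0) < e"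
    using fpart_best[OF L p(1)] f by (auto) (meson order_le_less_trans)
qed

lemma parseval_ip:
  assumes L: "L > 0" and f: "f \<in> L2T L" and g: "g \<in> L2T L"
  shows "(\<lambda>N. of_real L * (\<Sum>k\<in>{- int N..int N}. fc L f k * cnj (fc L g k))) \<longlonglongrightarrow> ipT L f g"
proof -
  have "(\<lambda>N. ipT L (\<lambda>x. f x - fpart L N f x) g) \<longlonglongrightarrow> 0"
  proof (rule Lim_null_comparison)
    show "\<forall>\<^sub>F N in sequentially. norm (ipT L (\<lambda>x. f x - fpart L N f x) g)
       \<le> sqrt (sqT L (\<lambda>x. f x - fpart L N f x)) * sqrt (sqT L g)"
      by (intro always_eventually allI ip_bound L2_fun_diff f g fpart_L2_fun)
    have "(\<lambda>N. sqrt (sqT L (\<lambda>x. f x - fpart L N f x)) * sqrt (sqT L g))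
       \<longlonglongrightarrow> sqrt 0 * sqrt (sqT L g)"
      by (intro tendsto_intros fourier_convergence assms)
    then show "(\<lambda>N. sqrt (sqT L (\<lambda>x. f x - fpart L N f x)) * sqrt (sqT L g)) \<longlonglongrightarrow> 0"
      by simp
  qed
  then have "(\<lambda>N. ipT L f g - ipT L (\<lambda>x. f x - fpart L N f x) g) \<longlonglongrightarrow> ipT L f g - 0"
    by (intro tendsto_intros)
  then show ?thesis
    using f g L by (simp add: ip_diff_left fpart_L2_fun fpart_ip)
qed

lemma parseval_sqn:
  assumes L: "L > 0" and f: "f \<in> L2T L"
  shows "(\<lambda>N. L * (\<Sum>k\<in>{- int N..int N}. (norm (fc L f k))\<^sup>2)) \<longlonglongrightarrow> sqT L f"
proof -
  have "(\<lambda>N. complex_of_real (L * (\<Sum>k\<in>{- int N..int N}. (norm (fc L f k))\<^sup>2))) \<longlonglongrightarrow> complex_of_real (sqT L f)"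
    using parseval_ip[OF L f f] by (simp add: complex_norm_square sqn_eq_ip del: of_real_power)
  then show ?thesis by (simp only: tendsto_of_real_iff)
qed

section \<open>The Sobolev inequality and the energy identity\<close>

text \<open>The symmetric range is covered by the numbers n and -n; the index 0 is counted twice,
  hence only an inequality.\<close>

lemma sum_symmetric_int_le:
  fixes h :: "int \<Rightarrow> real"
  assumes "\<And>k. 0 \<le> h k" "\<And>k. h (- k) = h k"
  shows "(\<Sum>k\<in>{- int N..int N}. h k) \<le> 2 * (\<Sum>n\<le>N. h (int n))"
proof -
  have "{- int N..int N} \<subseteq> int ` {..N} \<union> (\<lambda>n. - int n) ` {..N}"
  proof
    fix k assume "k \<in> {- int N..int N}"
    then have "k = int (nat k) \<and> nat k \<le> N \<or> k = - int (nat (- k)) \<and> nat (- k) \<le> N" by auto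
    then show "k \<in> int ` {..N} \<union> (\<lambda>n. - int n) ` {..N}" by blast
  qed
  then have "(\<Sum>k\<in>{- int N..int N}. h k) \<le> sum h (int ` {..N} \<union> (\<lambda>n. - int n) ` {..N})"
    by (intro sum_mono2) (auto simp: assms)
  also have "\<dots> \<le> sum h (int ` {..N}) + sum h ((\<lambda>n. - int n) ` {..N})"
    by (subst sum_Un) (auto intro!: sum_nonneg simp: assms)
  also have "sum h (int ` {..N}) = (\<Sum>n\<le>N. h (int n))"
    by (simp add: sum.reindex)
  also have "sum h ((\<lambda>n. - int n) ` {..N}) = (\<Sum>n\<le>N. h (int n))"
    by (subst sum.reindex) (auto simp: assms inj_on_def)
  finally show ?thesis by simp
qed

lemma freq_weights_bounded:
  assumes "L > 0"
  shows "\<exists>K\<ge>0. \<forall>N. (\<Sum>k\<in>{- int N..int N}. 1 / (1 + (freq L k)\<^sup>2)) \<le> K"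
proof -
  define c where "c = (2 * pi / L)\<^sup>2"
  have c: "c > 0" using assms by (simp add: c_def)
  have f2: "(freq L k)\<^sup>2 = c * (of_int k)\<^sup>2" for k
    by (simp add: freq_def c_def power_divide power_mult_distrib)
  let ?h = "\<lambda>n. 1 / (1 + (freq L (int n))\<^sup>2)"
  have "summable ?h"
  proof (rule summable_comparison_test)
    show "summable (\<lambda>n. 1 / c * (inverse (real n ^ 2)))"
      by (intro summable_mult inverse_power_summable) auto
    have "norm (?h n) \<le> 1 / c * inverse (real n ^ 2)" if "n \<ge> 1" for n
    proof -
      have "c * (real n)\<^sup>2 > 0" using c that by simp
      then have "?h n \<le> 1 / (c * (real n)\<^sup>2)"
        by (intro divide_left_mono) (auto simp: f2 intro!: mult_pos_pos add_pos_pos)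
      then show ?thesis by (simp add: field_simps)
    qed
    then show "\<exists>N. \<forall>n\<ge>N. norm (?h n) \<le> 1 / c * inverse (real n ^ 2)" by blast
  qed
  then have "(\<Sum>n\<le>N. ?h n) \<le> suminf ?h" for N
    using sum_le_suminf[of ?h "{..N}"] by simp
  then have "(\<Sum>k\<in>{- int N..int N}. 1 / (1 + (freq L k)\<^sup>2)) \<le> 2 * suminf ?h" for N
    using sum_symmetric_int_le[of "\<lambda>k. 1 / (1 + (freq L k)\<^sup>2)" N] by (fastforce intro: order_trans)
  moreover have "0 \<le> suminf ?h" using \<open>summable ?h\<close> by (intro suminf_nonneg) auto
  ultimately show ?thesis by (intro exI[of _ "2 * suminf ?h"]) auto
qed

text \<open>The derivative enters only through its Fourier coefficients, the form in which it is
  available for an abstract pair of functions. The constant is a parameter, because one and the same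
  value has to serve both solutions at all times.\<close>

definition sobolev_const :: "real \<Rightarrow> real \<Rightarrow> bool" where
  "sobolev_const L K \<longleftrightarrow> K \<ge> 0 \<and> (\<forall>f\<in>L2T L. \<forall>g\<in>L2T L.
     (\<forall>k. fc L g k = \<i> * freq L k * fc L f k) \<longrightarrow>
     (AE x in torus L. (norm (f x))\<^sup>2 \<le> K * (sqT L f + sqT L g)))"

lemma sobolev_constD:
  assumes "sobolev_const L K"
  shows "K \<ge> 0"
    "f \<in> L2T L \<Longrightarrow> g \<in> L2T L \<Longrightarrow>
     (\<And>k. fc L g k = \<i> * freq L k * fc L f k) \<Longrightarrow>
     AE x in torus L. (norm (f x))\<^sup>2 \<le> K * (sqT L f + sqT L g)"
  using assms unfolding sobolev_const_def by simp_all

text \<open>Cauchy-Schwarz with the weights 1 + freq^2, whose inverses are summable, bounds the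
  partial sums uniformly: the weighted sum of the coefficients of \<open>f\<close> is the plain one
  for \<open>f\<close> plus that for \<open>g\<close>.\<close>

lemma sobolev_embedding:
  assumes L: "L > 0"
  shows "\<exists>K. sobolev_const L K"
proof -
  obtain K0 where K0: "K0 \<ge> 0" "\<And>N. (\<Sum>k\<in>{- int N..int N}. 1 / (1 + (freq L k)\<^sup>2)) \<le> K0"
    using freq_weights_bounded[OF L] by blast
  have "AE x in torus L. (norm (f x))\<^sup>2 \<le> (K0 / L) * (sqT L f + sqT L g)"
    if f: "f \<in> L2T L" and g: "g \<in> L2T L"
      and fg: "\<And>k. fc L g k = \<i> * freq L k * fc L f k" for f g
  proof -
    define B where "B = (K0 / L) * (sqT L f + sqT L g)"
    have B0: "B \<ge> 0" using K0 L by (simp add: B_def)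
    have bound: "norm (fpart L N f x) \<le> sqrt B" for N x
    proof -
      let ?S = "{- int N..int N}"
      let ?w = "\<lambda>k. sqrt (1 + (freq L k)\<^sup>2)"
      have w: "?w k > 0" for k by (simp add: add_pos_nonneg)
      have "norm (fpart L N f x) \<le> (\<Sum>k\<in>?S. norm (fc L f k))"
        unfolding fpart_def by (rule order_trans[OF norm_sum]) (simp add: norm_mult)
      also have "\<dots> = (\<Sum>k\<in>?S. (1 / ?w k) * (?w k * norm (fc L f k)))"
        using w by (intro sum.cong) (simp_all add: less_imp_neq[THEN not_sym])
      finally have "(norm (fpart L N f x))\<^sup>2 \<le> (\<Sum>k\<in>?S. (1 / ?w k) * (?w k * norm (fc L f k)))\<^sup>2"
        by (intro power_mono) auto
      also have "\<dots> \<le> (\<Sum>k\<in>?S. (1 / ?w k)\<^sup>2) * (\<Sum>k\<in>?S. (?w k * norm (fc L f k))\<^sup>2)"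
        by (rule Cauchy_Schwarz_ineq_sum)
      also have "(\<Sum>k\<in>?S. (1 / ?w k)\<^sup>2) = (\<Sum>k\<in>?S. 1 / (1 + (freq L k)\<^sup>2))"
        by (simp add: power_divide)
      also have "(\<Sum>k\<in>?S. (?w k * norm (fc L f k))\<^sup>2)
          = (\<Sum>k\<in>?S. (norm (fc L f k))\<^sup>2) + (\<Sum>k\<in>?S. (norm (fc L g k))\<^sup>2)"
        by (simp add: power_mult_distrib fg norm_mult algebra_simps sum.distrib)
      also have "\<dots> = (sqT L (fpart L N f) + sqT L (fpart L N g)) / L"
        using L by (simp add: sqn_fpart field_simps)
      also have "(\<Sum>k\<in>?S. 1 / (1 + (freq L k)\<^sup>2)) * \<dots> \<le> K0 * ((sqT L f + sqT L g) / L)"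
        using L bessel[OF L f, of N] bessel[OF L g, of N] K0
        by (intro mult_mono divide_right_mono add_mono) auto
      also have "\<dots> = B" by (simp add: B_def)
      finally show ?thesis by (rule real_le_rsqrt)
    qed
    \<comment> \<open>The partial sums converge only in L2, so the pointwise bound does not pass to
      the limit directly. The excess of |f| over the bound is dominated by |f - fpart| for every N,
      so its L2 norm is zero.\<close>
    define h where "h x = complex_of_real (max 0 (norm (f x) - sqrt B))" for x
    have hm: "h \<in> borel_measurable (torus L)"
      using f unfolding h_def[abs_def] by (auto dest!: L2_fun_measurable)
    have "norm (h x) \<le> 1 * norm (f x)" for x using B0 by (auto simp: h_def)
    then have h: "h \<in> L2T L"
      by (intro sqn_bound(1)[OF hm f, of 1]) auto
    have "sqT L h \<le> sqT L (\<lambda>x. f x - fpart L N f x)" for N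
    proof -
      have "norm (h x) \<le> 1 * norm (f x - fpart L N f x)" for x
        using bound[of N x] norm_triangle_ineq2[of "f x" "fpart L N f x"] by (simp add: h_def)
      then show ?thesis
        using sqn_bound(2)[OF hm L2_fun_diff[OF f fpart_L2_fun[of L N f]], of 1] by simp
    qed
    then have "sqT L h \<le> 0"
      using fourier_convergence[OF L f] by (intro LIMSEQ_le_const[of _ 0 "sqT L h"]) auto
    then have "(LINT x|torus L. (norm (h x))\<^sup>2) = 0"
      using sqn_nonneg[of "torus L" h] unfolding sqn_def by (rule antisym)
    then have "AE x in torus L. (norm (h x))\<^sup>2 = 0"
      using integral_nonneg_eq_0_iff_AE[OF L2_fun_integrable_sq[OF h]] by simp
    then show ?thesis
    proof eventually_elim
      case (elim x)
      then have "norm (f x) \<le> sqrt B" by (simp add: h_def max_def split: if_splits)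
      then have "(norm (f x))\<^sup>2 \<le> (sqrt B)\<^sup>2" by (intro power_mono) auto
      then show ?case using B0 by (simp add: B_def)
    qed
  qed
  then show ?thesis
    unfolding sobolev_const_def using K0(1) L by (intro exI[of _ "K0 / L"]) auto
qed

section \<open>Scalar integral equations and the energy identity\<close>

lemma local_growth_chain:
  fixes \<Phi> H :: "real \<Rightarrow> real"
  assumes "d > 0" "s \<le> t"
    and step: "\<And>x y. s \<le> x \<Longrightarrow> x \<le> y \<Longrightarrow> y \<le> t \<Longrightarrow> y - x \<le> d \<Longrightarrow> \<Phi> y - \<Phi> x \<le> H y - H x"
  shows "\<Phi> t - \<Phi> s \<le> H t - H s"
proof -
  have *: "\<Phi> y - \<Phi> s \<le> H y - H s" if "s \<le> y" "y \<le> t" "y \<le> s + real n * d" for n y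
    using that
  proof (induction n arbitrary: y)
    case 0
    then show ?case by simp
  next
    case (Suc n)
    define x where "x = max s (y - d)"
    have x: "s \<le> x" "x \<le> y" "y - x \<le> d" "x \<le> t" "x \<le> s + real n * d"
      using Suc.prems \<open>d > 0\<close> by (auto simp: x_def algebra_simps)
    show ?case using Suc.IH[OF x(1,4,5)] step[OF x(1,2) Suc.prems(2) x(3)] by linarith
  qed
  obtain n where "(t - s) / d < real n" using reals_Archimedean2 by blast
  then have "t \<le> s + real n * d" using \<open>d > 0\<close> by (simp add: field_simps)
  then show ?thesis using *[of t n] \<open>s \<le> t\<close> by simp
qed

text \<open>The product rule for absolutely continuous functions: by uniform continuity of \<open>z\<close> the two sides differ
  by at most \<open>\<epsilon>\<close> times the integral of \<open>norm h\<close> on every short interval.\<close>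

lemma has_integral_norm_sq:
  fixes z h :: "real \<Rightarrow> complex"
  assumes st: "s \<le> t"
    and z: "\<And>x y. s \<le> x \<Longrightarrow> x \<le> y \<Longrightarrow> y \<le> t \<Longrightarrow> (h has_integral (z y - z x)) {x..y}"
    and h: "(\<lambda>r. norm (h r)) integrable_on {s..t}"
  shows "((\<lambda>r. 2 * Re (h r * cnj (z r))) has_integral ((norm (z t))\<^sup>2 - (norm (z s))\<^sup>2)) {s..t}"
proof -
  have hi: "h integrable_on {s..t}" using z[of s t] st by blast
  have zc: "continuous_on {s..t} z"
  proof -
    have "continuous_on {s..t} (\<lambda>x. z s + integral {s..x} h)"
      by (intro continuous_intros indefinite_integral_continuous_1 hi)
    moreover have "z s + integral {s..x} h = z x" if "x \<in> {s..t}" for x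
      using z[of s x] that by (simp add: integral_unique)
    ultimately show ?thesis by (rule continuous_on_eq)
  qed
  have ha: "h absolutely_integrable_on {s..t}" using hi h by (simp add: absolutely_integrable_on_def)
  have "(\<lambda>r. cnj (z r) * h r) absolutely_integrable_on {s..t}"
  proof (rule absolutely_integrable_bounded_measurable_product[OF bilinear_times _ _ _ ha])
    have "continuous_on {s..t} (\<lambda>r. cnj (z r))" by (intro continuous_intros zc)
    then show "(\<lambda>r. cnj (z r)) \<in> borel_measurable (lebesgue_on {s..t})" "bounded ((\<lambda>r. cnj (z r)) ` {s..t})"
      by (auto intro!: continuous_imp_measurable_on_sets_lebesgue compact_imp_bounded compact_continuous_image)
  qed auto
  then have "(\<lambda>r. cnj (z r) * h r) integrable_on {s..t}" by (rule set_lebesgue_integral_eq_integral(1))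
  from integrable_linear[OF this bounded_linear_Re]
  have "(\<lambda>r. Re (h r * cnj (z r))) integrable_on {s..t}" by (simp add: o_def mult.commute)
  then have ki: "(\<lambda>r. 2 * Re (h r * cnj (z r))) integrable_on {s..t}" by (rule integrable_on_mult_right)
  define k where "k r = 2 * Re (h r * cnj (z r))" for r
  have ki: "k integrable_on {s..t}" using ki by (simp add: k_def[abs_def])
  define \<Phi> where "\<Phi> x = (norm (z x))\<^sup>2 - integral {s..x} k" for x
  define H where "H x = integral {s..x} (\<lambda>r. norm (h r))" for x
  have comb: "integral {s..y} q - integral {s..x} q = integral {x..y} q"
    if "q integrable_on {s..t}" "s \<le> x" "x \<le> y" "y \<le> t" for q :: "real \<Rightarrow> real" and x y
    using Henstock_Kurzweil_Integration.integral_combine[of s x y q] that integrable_subinterval_real[OF that(1), of s y] by auto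
  have close: "\<bar>\<Phi> t - \<Phi> s\<bar> \<le> e * H t" if e: "e > 0" for e
  proof -
    obtain d where d: "d > 0" "\<And>x y. x \<in> {s..t} \<Longrightarrow> y \<in> {s..t} \<Longrightarrow> dist y x < d \<Longrightarrow> dist (z y) (z x) < e / 2"
      using compact_uniformly_continuous[OF zc compact_Icc] e
      unfolding uniformly_continuous_on_def by (meson half_gt_zero)
    have est: "\<bar>\<Phi> y - \<Phi> x\<bar> \<le> e * H y - e * H x" 
      if xy: "s \<le> x" "x \<le> y" "y \<le> t" "y - x \<le> d / 2" for x y
    proof -
      \<comment> \<open>Freezing the factor \<open>2 * z r\<close> at \<open>z y + z x\<close> makes
        the integral exact: the cross terms of \<open>(z y - z x) * cnj (z y + z x)\<close> are
        purely imaginary, and the real part is the difference of the squared moduli.\<close>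
      have int: "((\<lambda>r. Re (h r * cnj (z y + z x)) - k r) has_integral 
        (Re ((z y - z x) * cnj (z y + z x)) - integral {x..y} k)) {x..y}"
      proof (intro has_integral_diff)
        have "((\<lambda>r. h r * cnj (z y + z x)) has_integral (z y - z x) * cnj (z y + z x)) {x..y}"
          by (rule has_integral_mult_left[OF z]) (use xy in auto)
        from has_integral_linear[OF this bounded_linear_Re]
        show "((\<lambda>r. Re (h r * cnj (z y + z x))) has_integral Re ((z y - z x) * cnj (z y + z x))) {x..y}"
          by (simp add: o_def)
        show "(k has_integral integral {x..y} k) {x..y}"
          using integrable_subinterval_real[OF ki, of x y] xy by (auto intro: integrable_integral)
      qed
      have re: "Re ((z y - z x) * cnj (z y + z x)) = (norm (z y))\<^sup>2 - (norm (z x))\<^sup>2"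
        unfolding cmod_power2 by (simp add: algebra_simps power2_eq_square)
      have diff: "Re ((z y - z x) * cnj (z y + z x)) - integral {x..y} k = \<Phi> y - \<Phi> x"
        using comb[OF ki xy(1-3)] unfolding \<Phi>_def re by linarith
      have 1: "((\<lambda>r. Re (h r * cnj (z y + z x)) - k r) has_integral (\<Phi> y - \<Phi> x)) {x..y}"
        using int unfolding diff .
      have hxy: "(\<lambda>r. norm (h r)) integrable_on {x..y}"
        using integrable_subinterval_real[OF h, of x y] xy by auto
      have "norm (integral {x..y} (\<lambda>r. Re (h r * cnj (z y + z x)) - k r)) \<le> integral {x..y} (\<lambda>r. e * norm (h r))"
      proof (rule integral_norm_bound_integral)
        show "(\<lambda>r. Re (h r * cnj (z y + z x)) - k r) integrable_on {x..y}" using 1 by blast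
        show "(\<lambda>r. e * norm (h r)) integrable_on {x..y}" by (intro integrable_on_mult_right hxy)
        fix r assume r: "r \<in> {x..y}"
        have "dist (z y) (z r) < e / 2" "dist (z x) (z r) < e / 2"
          using r xy d(1) d(2)[of r y] d(2)[of r x] by (auto simp: dist_real_def)
        then have n: "norm ((z y - z r) + (z x - z r)) \<le> e"
          using norm_triangle_ineq[of "z y - z r" "z x - z r"] by (simp add: dist_norm)
        have "Re (h r * cnj (z y + z x)) - k r = Re (h r * cnj ((z y - z r) + (z x - z r)))"
          by (simp add: k_def algebra_simps)
        also have "\<bar>\<dots>\<bar> \<le> norm (h r * cnj ((z y - z r) + (z x - z r)))" by (rule abs_Re_le_cmod)
        also have "\<dots> = norm (h r) * norm ((z y - z r) + (z x - z r))" by (simp only: norm_mult complex_mod_cnj)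
        also have "\<dots> \<le> norm (h r) * e" using n by (intro mult_left_mono) auto
        finally show "norm (Re (h r * cnj (z y + z x)) - k r) \<le> e * norm (h r)" by (simp add: mult.commute)
      qed
      then have "\<bar>\<Phi> y - \<Phi> x\<bar> \<le> e * integral {x..y} (\<lambda>r. norm (h r))"
        using 1 by (simp add: integral_unique)
      then show ?thesis using comb[OF h xy(1-3)] by (simp add: H_def right_diff_distrib[symmetric])
    qed
    have d2: "d / 2 > 0" using d by simp
    have "\<Phi> t - \<Phi> s \<le> e * H t - e * H s"
      by (rule local_growth_chain[OF d2 st, of \<Phi> "\<lambda>x. e * H x"]) (use est in \<open>force simp: abs_le_iff\<close>)
    moreover have "(- \<Phi> t) - (- \<Phi> s) \<le> e * H t - e * H s"
      by (rule local_growth_chain[OF d2 st, of "\<lambda>x. - \<Phi> x" "\<lambda>x. e * H x"]) (use est in \<open>force simp: abs_le_iff\<close>)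
    ultimately show ?thesis by (simp add: H_def abs_le_iff)
  qed
  have H0: "H t \<ge> 0" unfolding H_def by (intro integral_nonneg h) auto
  have "\<bar>\<Phi> t - \<Phi> s\<bar> \<le> 0"
  proof (rule field_le_epsilon)
    fix e :: real assume e: "e > 0"
    have "\<bar>\<Phi> t - \<Phi> s\<bar> \<le> e / (H t + 1) * H t" using e H0 by (intro close) auto
    also have "\<dots> \<le> e" using e H0 by (simp add: field_simps)
    finally show "\<bar>\<Phi> t - \<Phi> s\<bar> \<le> 0 + e" by simp
  qed
  then have "integral {s..t} k = (norm (z t))\<^sup>2 - (norm (z s))\<^sup>2" by (simp add: \<Phi>_def)
  then show ?thesis using integrable_integral[OF ki] by (simp add: k_def[abs_def])
qed

lemma fc_bound:
  assumes "L > 0" "f \<in> L2T L"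
  shows "norm (fc L f k) \<le> sqrt (sqT L f) / sqrt L"
proof -
  have "sqT L (fexp L k) = L"
    using measure_torus[OF assms(1)] by (simp add: sqn_def)
  then have "L * norm (fc L f k) \<le> sqrt (sqT L f) * sqrt L"
    using ip_bound[OF assms(2) fexp_L2_fun[of L k]] assms(1) by (simp add: fc_ip norm_mult)
  then have "norm (fc L f k) \<le> sqrt (sqT L f) * sqrt L / L"
    using assms(1) by (simp add: field_simps)
  also have "\<dots> = sqrt (sqT L f) / sqrt L"
    using assms(1) by (simp add: field_simps)
  finally show ?thesis .
qed

lemma has_integral_minus_negligible:
  fixes f :: "real \<Rightarrow> 'a::euclidean_space"
  assumes "negligible Z"
  shows "(f has_integral y) (S - Z) \<longleftrightarrow> (f has_integral y) S"
proof (rule has_integral_spike_set_eq)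
  show "negligible {x \<in> S - Z - S. f x \<noteq> 0}" by (rule negligible_subset[OF assms]) auto
  show "negligible {x \<in> S - (S - Z). f x \<noteq> 0}" by (rule negligible_subset[OF assms]) auto
qed

lemma integrable_minus_negligible:
  fixes f :: "real \<Rightarrow> 'a::euclidean_space"
  assumes "negligible Z"
  shows "f integrable_on (S - Z) \<longleftrightarrow> f integrable_on S"
  using has_integral_minus_negligible[OF assms] unfolding integrable_on_def by blast

text \<open>By Bessel, the bounds for \<open>g r\<close> and \<open>N r\<close> hold for all
  truncated sums as well, so one majorant built from \<open>B\<close> serves for every n. The
  asymmetry of the two bounds is deliberate: \<open>B\<close> controls the square of the norm of
  \<open>g r\<close> but only the norm of \<open>N r\<close>, because the norm of the cubic term is
  of the order of the squared norm of the derivative, and its own square need not be integrable in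
  time.\<close>

lemma energy_equality:
  fixes f g N :: "real \<Rightarrow> real \<Rightarrow> complex" and B :: "real \<Rightarrow> real"
  assumes L: "L > 0" and st: "s \<le> t" and Z: "negligible Z"
    and f: "\<And>r. r \<in> {s..t} \<Longrightarrow> f r \<in> L2T L"
    and M: "\<And>r. r \<in> {s..t} \<Longrightarrow> sqT L (f r) \<le> M"
    and g: "\<And>r. r \<in> {s..t} - Z \<Longrightarrow> g r \<in> L2T L"
    and N: "\<And>r. r \<in> {s..t} - Z \<Longrightarrow> N r \<in> L2T L"
    and fg: "\<And>r k. r \<in> {s..t} - Z \<Longrightarrow> fc L (g r) k = \<i> * freq L k * fc L (f r) k"
    and B: "B integrable_on {s..t}"
    and gB: "\<And>r. r \<in> {s..t} - Z \<Longrightarrow> sqT L (g r) \<le> B r"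
    and NB: "\<And>r. r \<in> {s..t} - Z \<Longrightarrow> sqrt (sqT L (N r)) \<le> B r"
    and eq: "\<And>k x y. s \<le> x \<Longrightarrow> x \<le> y \<Longrightarrow> y \<le> t \<Longrightarrow>
      ((\<lambda>r. fc L (N r) k - Complex a b * (freq L k)\<^sup>2 * fc L (f r) k) has_integral
        (fc L (f y) k - fc L (f x) k)) {x..y}"
  shows "((\<lambda>r. 2 * Re (ipT L (N r) (f r)) - 2 * a * sqT L (g r)) has_integral
     (sqT L (f t) - sqT L (f s))) {s..t}"
proof -
  let ?S = "{s..t} - Z"
  define h where "h k r = fc L (N r) k - Complex a b * (freq L k)\<^sup>2 * fc L (f r) k" for k r
  have BS: "B integrable_on ?S"
    using B integrable_minus_negligible[OF Z] by blast
  have mode: "((\<lambda>r. 2 * Re (h k r * cnj (fc L (f r) k))) has_integral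
      ((norm (fc L (f t) k))\<^sup>2 - (norm (fc L (f s) k))\<^sup>2)) {s..t}" for k
  proof (rule has_integral_norm_sq[OF st])
    show "(h k has_integral (fc L (f y) k - fc L (f x) k)) {x..y}" if "s \<le> x" "x \<le> y" "y \<le> t" for x y
      using eq[OF that] by (simp add: h_def[abs_def])
    then have "(h k has_integral (fc L (f t) k - fc L (f s) k)) ?S"
      using st by (subst has_integral_minus_negligible[OF Z]) auto
    then have hS: "h k integrable_on ?S" by blast
    let ?C = "norm (Complex a b * (freq L k)\<^sup>2) * (sqrt M / sqrt L)"
    have "(\<lambda>r. B r / sqrt L + ?C) integrable_on {s..t}"
      by (intro integrable_add integrable_on_divide B) auto
    then have "(\<lambda>r. B r / sqrt L + ?C) integrable_on ?S"
      using integrable_minus_negligible[OF Z] by blast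
    moreover have "norm (h k r) \<le> B r / sqrt L + ?C" if r: "r \<in> ?S" for r
    proof -
      have rs: "r \<in> {s..t}" using r by simp
      have "norm (h k r) \<le> norm (fc L (N r) k) + norm (Complex a b * (freq L k)\<^sup>2 * fc L (f r) k)"
        unfolding h_def by (rule norm_triangle_ineq4)
      also have "norm (fc L (N r) k) \<le> B r / sqrt L"
        by (rule order_trans[OF fc_bound[OF L N[OF r]] divide_right_mono[OF NB[OF r]]]) (use L in auto)
      also have "norm (Complex a b * (freq L k)\<^sup>2 * fc L (f r) k) \<le> ?C"
        unfolding norm_mult[of _ "fc L (f r) k"] using L M[OF rs]
        by (intro mult_left_mono order_trans[OF fc_bound[OF L f[OF rs]] divide_right_mono]) auto
      finally show ?thesis by simp
    qed
    ultimately have "h k absolutely_integrable_on ?S"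
      by (intro absolutely_integrable_integrable_bound[OF _ hS])
    then have "(\<lambda>r. norm (h k r)) integrable_on ?S" by (simp add: absolutely_integrable_on_def)
    then show "(\<lambda>r. norm (h k r)) integrable_on {s..t}"
      using integrable_minus_negligible[OF Z] by blast
  qed
  define F where "F n r = (\<Sum>k\<in>{- int n..int n}. L * (2 * Re (h k r * cnj (fc L (f r) k))))" for n r
  define Y where "Y n = (\<Sum>k\<in>{- int n..int n}. L * ((norm (fc L (f t) k))\<^sup>2 - (norm (fc L (f s) k))\<^sup>2))" for n
  have F_eq: "F n r = 2 * Re (of_real L * (\<Sum>k\<in>{- int n..int n}. fc L (N r) k * cnj (fc L (f r) k)))
     - 2 * a * sqT L (fpart L n (g r))" if r: "r \<in> ?S" for n r
  proof -
    \<comment> \<open>In the diffusion term \<open>Complex a b\<close> is multiplied by a real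
      number, so \<open>b\<close> drops out of the real part, and the factor freq^2 turns the
      coefficient of \<open>f r\<close> into that of \<open>g r\<close>.\<close>
    have re: "Re (h k r * cnj (fc L (f r) k)) = 
       Re (fc L (N r) k * cnj (fc L (f r) k)) - a * (norm (fc L (g r) k))\<^sup>2" for k
    proof -
      have "h k r * cnj (fc L (f r) k) = fc L (N r) k * cnj (fc L (f r) k)
         - Complex a b * of_real ((freq L k)\<^sup>2 * (norm (fc L (f r) k))\<^sup>2)"
        unfolding h_def of_real_mult complex_norm_square by (simp add: algebra_simps)
      then show ?thesis by (simp add: fg[OF r] norm_mult power_mult_distrib)
    qed
    have "F n r = (\<Sum>k\<in>{- int n..int n}. 2 * (L * Re (fc L (N r) k * cnj (fc L (f r) k)))
        - 2 * a * (L * (norm (fc L (g r) k))\<^sup>2))"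
      unfolding F_def by (intro sum.cong refl) (simp only: re, simp only: algebra_simps)
    also have "\<dots> = 2 * (L * (\<Sum>k\<in>{- int n..int n}. Re (fc L (N r) k * cnj (fc L (f r) k))))
        - 2 * a * (L * (\<Sum>k\<in>{- int n..int n}. (norm (fc L (g r) k))\<^sup>2))"
      by (simp only: sum_subtractf sum_distrib_left)
    moreover have "Re (of_real L * S) = L * Re S" for S by simp
    ultimately show ?thesis unfolding sqn_fpart[OF L] by (simp only: Re_sum)
  qed
  have "((\<lambda>r. 2 * Re (ipT L (N r) (f r)) - 2 * a * sqT L (g r)) has_integral
     (sqT L (f t) - sqT L (f s))) ?S"
  proof (rule has_integral_dominated_convergence)
    show "(F n has_integral Y n) ?S" for n
      unfolding has_integral_minus_negligible[OF Z] F_def[abs_def] Y_def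
      by (intro has_integral_sum has_integral_mult_right mode) auto
    show "(\<lambda>r. 2 * (sqrt M * B r) + 2 * \<bar>a\<bar> * B r) integrable_on ?S"
      by (intro integrable_add integrable_on_mult_right BS)
    show "\<forall>r\<in>?S. norm (F n r) \<le> 2 * (sqrt M * B r) + 2 * \<bar>a\<bar> * B r" for n
    proof
      fix r assume r: "r \<in> ?S"
      then have rs: "r \<in> {s..t}" by simp
      have "norm (ipT L (fpart L n (N r)) (f r)) \<le> sqrt (sqT L (fpart L n (N r))) * sqrt (sqT L (f r))"
        by (rule ip_bound[OF fpart_L2_fun f[OF rs]])
      also have "\<dots> \<le> B r * sqrt M"
        using bessel[OF L N[OF r], of n] NB[OF r] M[OF rs] order_trans[OF _ NB[OF r], of 0]
        by (intro mult_mono) (auto intro: order_trans[OF real_sqrt_le_mono])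
      finally have 1: "\<bar>Re (ipT L (fpart L n (N r)) (f r))\<bar> \<le> sqrt M * B r"
        using abs_Re_le_cmod order_trans by (metis mult.commute)
      have "\<bar>a * sqT L (fpart L n (g r))\<bar> \<le> \<bar>a\<bar> * B r"
        unfolding abs_mult using bessel[OF L g[OF r], of n] gB[OF r] by (intro mult_left_mono) auto
      then show "norm (F n r) \<le> 2 * (sqrt M * B r) + 2 * \<bar>a\<bar> * B r"
        using 1 unfolding F_eq[OF r] fpart_ip[OF L f[OF rs]] real_norm_def by linarith
    qed
    show "\<forall>r\<in>?S. (\<lambda>n. F n r) \<longlonglongrightarrow> 2 * Re (ipT L (N r) (f r)) - 2 * a * sqT L (g r)"
    proof
      fix r assume r: "r \<in> ?S"
      then have rs: "r \<in> {s..t}" by simp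
      show "(\<lambda>n. F n r) \<longlonglongrightarrow> 2 * Re (ipT L (N r) (f r)) - 2 * a * sqT L (g r)"
        unfolding F_eq[OF r] sqn_fpart[OF L]
        by (intro tendsto_intros parseval_ip parseval_sqn L N r f rs g)
    qed
    have Y: "Y = (\<lambda>n. L * (\<Sum>k\<in>{- int n..int n}. (norm (fc L (f t) k))\<^sup>2) - L * (\<Sum>k\<in>{- int n..int n}. (norm (fc L (f s) k))\<^sup>2))"
      by (simp add: fun_eq_iff Y_def sum_subtractf right_diff_distrib flip: sum_distrib_left)
    show "Y \<longlonglongrightarrow> sqT L (f t) - sqT L (f s)"
      unfolding Y using st by (intro tendsto_diff parseval_sqn L f) auto
  qed
  then show ?thesis unfolding has_integral_minus_negligible[OF Z] .
qed

section \<open>Comparison of two solutions\<close>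

definition cubic :: "(real \<Rightarrow> complex) \<Rightarrow> real \<Rightarrow> complex" where
  "cubic f x = of_real ((norm (f x))\<^sup>2) * f x"

definition nonlin :: "real \<Rightarrow> real \<Rightarrow> real \<Rightarrow> (real \<Rightarrow> complex) \<Rightarrow> real \<Rightarrow> complex" where
  "nonlin \<delta> \<alpha> \<beta> f x = of_real \<delta> * f x - Complex \<alpha> \<beta> * cubic f x"

definition mode_rhs where
  "mode_rhs L a b \<delta> \<alpha> \<beta> f k =
     fc L (nonlin \<delta> \<alpha> \<beta> f) k - Complex a b * of_real ((freq L k)\<^sup>2) * fc L f k"

text \<open>Off the null set \<open>Z\<close> of times, \<open>g r\<close> is the space derivative of \<open>f r\<close>; the equation is kept only mode by mode.\<close>

definition cgl_modes :: "real \<Rightarrow> real \<Rightarrow> real \<Rightarrow> real \<Rightarrow> real \<Rightarrow> real \<Rightarrow> real \<Rightarrow> real \<Rightarrow>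
    (real \<Rightarrow> real \<Rightarrow> complex) \<Rightarrow> (real \<Rightarrow> real \<Rightarrow> complex) \<Rightarrow> real set \<Rightarrow> bool" where
  "cgl_modes L a b \<delta> \<alpha> \<beta> s t f g Z \<longleftrightarrow>
     negligible Z \<and>
     (\<forall>r\<in>{s..t}. f r \<in> L2T L) \<and>
     (\<exists>M. \<forall>r\<in>{s..t}. sqT L (f r) \<le> M) \<and>
     (\<forall>r\<in>{s..t} - Z. g r \<in> L2T L \<and> (\<forall>k. fc L (g r) k = \<i> * freq L k * fc L (f r) k)) \<and>
     (\<lambda>r. sqT L (g r)) integrable_on {s..t} \<and>
     (\<forall>k x y. s \<le> x \<longrightarrow> x \<le> y \<longrightarrow> y \<le> t \<longrightarrow>
       ((\<lambda>r. mode_rhs L a b \<delta> \<alpha> \<beta> (f r) k) has_integral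
        (fc L (f y) k - fc L (f x) k)) {x..y})"

lemma cgl_modesD:
  assumes "cgl_modes L a b \<delta> \<alpha> \<beta> s t f g Z"
  shows "negligible Z"
    "r \<in> {s..t} \<Longrightarrow> f r \<in> L2T L"
    "r \<in> {s..t} - Z \<Longrightarrow> g r \<in> L2T L"
    "r \<in> {s..t} - Z \<Longrightarrow> fc L (g r) k = \<i> * freq L k * fc L (f r) k"
    "(\<lambda>r. sqT L (g r)) integrable_on {s..t}"
    "s \<le> x \<Longrightarrow> x \<le> y \<Longrightarrow> y \<le> t \<Longrightarrow>
       ((\<lambda>r. mode_rhs L a b \<delta> \<alpha> \<beta> (f r) k) has_integral
        (fc L (f y) k - fc L (f x) k)) {x..y}"
  using assms unfolding cgl_modes_def by blast+

lemma cgl_modes_subinterval: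
  assumes "cgl_modes L a b \<delta> \<alpha> \<beta> s t f g Z" "s \<le> x" "y \<le> t"
  shows "cgl_modes L a b \<delta> \<alpha> \<beta> x y f g Z"
proof -
  have "{x..y} \<subseteq> {s..t}" using assms by auto
  moreover have "(\<lambda>r. sqT L (g r)) integrable_on {x..y}"
    using assms integrable_subinterval_real[of "\<lambda>r. sqT L (g r)" s t x y] by (auto simp: cgl_modes_def)
  moreover have "((\<lambda>r. mode_rhs L a b \<delta> \<alpha> \<beta> (f r) k) has_integral
        (fc L (f y') k - fc L (f x') k)) {x'..y'}" if "x \<le> x'" "x' \<le> y'" "y' \<le> y" for k x' y'
    using assms that unfolding cgl_modes_def by (meson order_trans)
  ultimately show ?thesis using assms(1) unfolding cgl_modes_def by blast
qed

section \<open>Lipschitz bounds for the cubic nonlinearity\<close>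

lemma norm_cubic_diff_le:
  fixes u v :: complex
  shows "norm (of_real ((norm u)\<^sup>2) * u - of_real ((norm v)\<^sup>2) * v)
    \<le> 3 * ((norm u)\<^sup>2 + (norm v)\<^sup>2) * norm (u - v)"
proof -
  let ?a = "norm u" and ?b = "norm v"
  have "of_real (?a\<^sup>2) * u - of_real (?b\<^sup>2) * v = of_real (?a\<^sup>2) * (u - v) + of_real (?a\<^sup>2 - ?b\<^sup>2) * v"
    by (simp add: algebra_simps)
  also have "norm \<dots> \<le> norm (complex_of_real (?a\<^sup>2) * (u - v)) + norm (complex_of_real (?a\<^sup>2 - ?b\<^sup>2) * v)"
    by (rule norm_triangle_ineq)
  also have "\<dots> = ?a\<^sup>2 * norm (u - v) + \<bar>?a\<^sup>2 - ?b\<^sup>2\<bar> * ?b"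
    by (simp only: norm_mult norm_of_real abs_power2)
  also have "\<bar>?a\<^sup>2 - ?b\<^sup>2\<bar> = (?a + ?b) * \<bar>?a - ?b\<bar>"
    by (simp add: abs_mult power2_eq_square square_diff_square_factored)
  also have "?a\<^sup>2 * norm (u - v) + (?a + ?b) * \<bar>?a - ?b\<bar> * ?b
      \<le> ?a\<^sup>2 * norm (u - v) + (?a + ?b) * norm (u - v) * ?b"
    by (intro add_mono mult_right_mono mult_left_mono norm_triangle_ineq3) auto
  also have "\<dots> = (?a\<^sup>2 + (?a + ?b) * ?b) * norm (u - v)" by (simp add: algebra_simps)
  also have "\<dots> \<le> (3 * (?a\<^sup>2 + ?b\<^sup>2)) * norm (u - v)"
  proof (intro mult_right_mono)
    have "2 * (?a * ?b) \<le> ?a\<^sup>2 + ?b\<^sup>2" using zero_le_power2[of "?a - ?b"] by (simp add: power2_diff)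
    moreover have "(?a + ?b) * ?b = ?a * ?b + ?b\<^sup>2" by (simp add: algebra_simps power2_eq_square)
    moreover have "0 \<le> ?a * ?b" "0 \<le> ?a\<^sup>2" "0 \<le> ?b\<^sup>2" by auto
    ultimately show "?a\<^sup>2 + (?a + ?b) * ?b \<le> 3 * (?a\<^sup>2 + ?b\<^sup>2)"
      unfolding distrib_left[of 3] by linarith
  qed simp
  finally show ?thesis .
qed

lemma cubic_measurable: "f \<in> L2_fun M \<Longrightarrow> (\<lambda>x. of_real ((norm (f x))\<^sup>2) * f x) \<in> borel_measurable M"
  by (auto dest!: L2_fun_measurable)

text \<open>Taking the second function to be zero also yields the membership and the size of a
  single cubic term.\<close>

lemma cubic_diff_L2:
  assumes f: "f \<in> L2T L" and f': "f' \<in> L2T L"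
    and R: "AE x in torus L. (norm (f x))\<^sup>2 \<le> R" and R': "AE x in torus L. (norm (f' x))\<^sup>2 \<le> R'"
    and R0: "R \<ge> 0" "R' \<ge> 0"
  shows "(\<lambda>x. cubic f x - cubic f' x) \<in> L2T L"
    "sqrt (sqT L (\<lambda>x. cubic f x - cubic f' x)) \<le> 3 * (R + R') * sqrt (sqT L (\<lambda>x. f x - f' x))"
proof -
  have m: "(\<lambda>x. cubic f x - cubic f' x) \<in> borel_measurable (torus L)"
    unfolding cubic_def using cubic_measurable[OF f] cubic_measurable[OF f'] by simp
  have ae: "AE x in torus L. norm (cubic f x - cubic f' x) \<le> (3 * (R + R')) * norm (f x - f' x)"
    using R R'
  proof eventually_elim
    case (elim x)
    have "norm (cubic f x - cubic f' x) \<le> 3 * ((norm (f x))\<^sup>2 + (norm (f' x))\<^sup>2) * norm (f x - f' x)"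
      unfolding cubic_def by (rule norm_cubic_diff_le)
    also have "\<dots> \<le> (3 * (R + R')) * norm (f x - f' x)"
      using elim by (intro mult_right_mono mult_left_mono add_mono) auto
    finally show ?case .
  qed
  note * = sqn_bound[OF m L2_fun_diff[OF f f'] ae]
  show "(\<lambda>x. cubic f x - cubic f' x) \<in> L2T L" by (rule *)
  have "sqrt (sqT L (\<lambda>x. cubic f x - cubic f' x)) 
     \<le> sqrt ((3 * (R + R'))\<^sup>2 * sqT L (\<lambda>x. f x - f' x))"
    using *(2) by simp
  also have "\<dots> = 3 * (R + R') * sqrt (sqT L (\<lambda>x. f x - f' x))"
    using R0 by (simp add: real_sqrt_mult)
  finally show "sqrt (sqT L (\<lambda>x. cubic f x - cubic f' x)) \<le> 3 * (R + R') * sqrt (sqT L (\<lambda>x. f x - f' x))" .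
qed

lemma cubic_L2:
  assumes "f \<in> L2T L" "AE x in torus L. (norm (f x))\<^sup>2 \<le> R" "R \<ge> 0"
  shows "cubic f \<in> L2T L"
  using cubic_diff_L2(1)[OF assms(1) L2_fun_zero assms(2), of 0] assms(3) by (simp add: cubic_def[abs_def])

lemma nonlin_L2:
  assumes "f \<in> L2T L" "cubic f \<in> L2T L"
  shows "nonlin \<delta> \<alpha> \<beta> f \<in> L2T L"
  unfolding nonlin_def[abs_def] by (intro L2_fun_diff L2_fun_scale assms)

lemma nonlin_bound:
  assumes f: "f \<in> L2T L" and ae: "AE x in torus L. (norm (f x))\<^sup>2 \<le> R" and R: "R \<ge> 0"
  shows "sqrt (sqT L (nonlin \<delta> \<alpha> \<beta> f)) \<le> (\<bar>\<delta>\<bar> + norm (Complex \<alpha> \<beta>) * (3 * R)) * sqrt (sqT L f)"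
proof -
  have cb: "sqrt (sqT L (cubic f)) \<le> 3 * R * sqrt (sqT L f)"
    using cubic_diff_L2(2)[OF f L2_fun_zero ae, of 0] R by (simp add: cubic_def[abs_def])
  have "sqrt (sqT L (nonlin \<delta> \<alpha> \<beta> f)) \<le> sqrt (sqT L (\<lambda>x. of_real \<delta> * f x)) + sqrt (sqT L (\<lambda>x. Complex \<alpha> \<beta> * cubic f x))"
    unfolding nonlin_def[abs_def] by (intro sqn_triangle_diff L2_fun_scale f cubic_L2[OF f ae R])
  also have "\<dots> = \<bar>\<delta>\<bar> * sqrt (sqT L f) + norm (Complex \<alpha> \<beta>) * sqrt (sqT L (cubic f))"
    unfolding sqn_scale by (simp add: real_sqrt_mult)
  also have "\<dots> \<le> \<bar>\<delta>\<bar> * sqrt (sqT L f) + norm (Complex \<alpha> \<beta>) * (3 * R * sqrt (sqT L f))"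
    by (intro add_left_mono mult_left_mono cb) auto
  finally show ?thesis by (simp add: distrib_right mult.assoc)
qed

lemma sqn_diff_le:
  assumes "f \<in> L2_fun M" "g \<in> L2_fun M"
  shows "sqn M (\<lambda>x. f x - g x) \<le> 2 * sqn M f + 2 * sqn M g"
proof -
  have "sqn M (\<lambda>x. f x - g x) \<le> (sqrt (sqn M f) + sqrt (sqn M g))\<^sup>2"
    using sqn_triangle_diff[OF assms] by (simp add: sqrt_le_D)
  also have "\<dots> \<le> 2 * (sqrt (sqn M f))\<^sup>2 + 2 * (sqrt (sqn M g))\<^sup>2"
    using zero_le_power2[of "sqrt (sqn M f) - sqrt (sqn M g)"]
    unfolding power2_sum power2_diff by linarith
  finally show ?thesis by simp
qed

lemma diff_diff_swap: "(p - q) - (p' - q') = (p - p') - (q - q')" for p q p' q' :: "'a::ab_group_add"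
  by simp

text \<open>The growth rate of the squared distance of two solutions of squared norm at most M,
  diffusion apart. It is twice |\<open>\<delta>\<close>| + 3
  |\<open>Complex \<alpha> \<beta>\<close>| (R + R'), where R and R' bound the squared moduli of the
  solutions and R + R' is at most K (2 M + P) by the Sobolev inequality. P stands for the sum of the
  squared norms of both space derivatives; the rate is affine in it and therefore integrable in
  time.\<close>

definition diff_coeff :: "real \<Rightarrow> real \<Rightarrow> real \<Rightarrow> real \<Rightarrow> real \<Rightarrow> real \<Rightarrow> real" where
  "diff_coeff \<delta> \<alpha> \<beta> K M P = 2 * \<bar>\<delta>\<bar> + 6 * norm (Complex \<alpha> \<beta>) * K * (2 * M + P)"

lemma diff_coeff_nonneg: "K \<ge> 0 \<Longrightarrow> M \<ge> 0 \<Longrightarrow> P \<ge> 0 \<Longrightarrow> 0 \<le> diff_coeff \<delta> \<alpha> \<beta> K M P"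
  by (simp add: diff_coeff_def)

text \<open>The difference satisfies the same mode equations with the difference of the nonlinear
  terms as forcing. The diffusion term is kept exactly, since uniqueness discards it while the
  backward comparison has to pay for it.\<close>

lemma cgl_difference_energy:
  assumes L: "L > 0" and SK: "sobolev_const L K" and M0: "M \<ge> 0" and st: "s \<le> t"
    and sol: "cgl_modes L a b \<delta> \<alpha> \<beta> s t f g Z" and sol': "cgl_modes L a b \<delta> \<alpha> \<beta> s t f' g' Z'"
    and M: "\<And>r. r \<in> {s..t} \<Longrightarrow> sqT L (f r) \<le> M \<and> sqT L (f' r) \<le> M"
  shows "((\<lambda>r. 2 * Re (ipT L (\<lambda>x. nonlin \<delta> \<alpha> \<beta> (f r) x - nonlin \<delta> \<alpha> \<beta> (f' r) x) (\<lambda>x. f r x - f' r x))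
        - 2 * a * sqT L (\<lambda>x. g r x - g' r x)) has_integral
      (sqT L (\<lambda>x. f t x - f' t x) - sqT L (\<lambda>x. f s x - f' s x))) {s..t}"
    "\<And>r. r \<in> {s..t} - (Z \<union> Z') \<Longrightarrow>
      \<bar>2 * Re (ipT L (\<lambda>x. nonlin \<delta> \<alpha> \<beta> (f r) x - nonlin \<delta> \<alpha> \<beta> (f' r) x) (\<lambda>x. f r x - f' r x))\<bar>
      \<le> diff_coeff \<delta> \<alpha> \<beta> K M (sqT L (g r) + sqT L (g' r)) * sqT L (\<lambda>x. f r x - f' r x)"
proof -
  note K = sobolev_constD(1)[OF SK] and sob = sobolev_constD(2)[OF SK]
  define c where "c = norm (Complex \<alpha> \<beta>)"
  have c0: "c \<ge> 0" by (simp add: c_def)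
  let ?S = "{s..t} - (Z \<union> Z')"
  define R where "R r = K * (sqT L (f r) + sqT L (g r))" for r
  define R' where "R' r = K * (sqT L (f' r) + sqT L (g' r))" for r
  define w where "w r = (\<lambda>x. f r x - f' r x)" for r
  define q where "q r = (\<lambda>x. g r x - g' r x)" for r
  define n where "n r = (\<lambda>x. nonlin \<delta> \<alpha> \<beta> (f r) x - nonlin \<delta> \<alpha> \<beta> (f' r) x)" for r
  define cd where "cd r = (\<lambda>x. cubic (f r) x - cubic (f' r) x)" for r
  define P where "P r = sqT L (g r) + sqT L (g' r)" for r
  have f: "f r \<in> L2T L" "f' r \<in> L2T L" if "r \<in> {s..t}" for r
    using cgl_modesD(2)[OF sol that] cgl_modesD(2)[OF sol' that] by auto
  have g: "g r \<in> L2T L" "g' r \<in> L2T L"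
     "fc L (g r) k = \<i> * freq L k * fc L (f r) k" "fc L (g' r) k = \<i> * freq L k * fc L (f' r) k"
    if "r \<in> ?S" for r k
    using cgl_modesD(3,4)[OF sol, of r] cgl_modesD(3,4)[OF sol', of r] that by auto
  have R0: "R r \<ge> 0" "R' r \<ge> 0" for r using K by (simp_all add: R_def R'_def)
  have RR: "R r + R' r \<le> K * (2 * M + P r)" if "r \<in> {s..t}" for r
    using M[OF that] K unfolding R_def R'_def P_def distrib_left[symmetric] by (intro mult_left_mono) auto
  have ae: "AE x in torus L. (norm (f r x))\<^sup>2 \<le> R r" "AE x in torus L. (norm (f' r x))\<^sup>2 \<le> R' r" if "r \<in> ?S" for r
    unfolding R_def R'_def using f[of r] g[OF that] that by (auto intro!: sob)
  have w: "w r \<in> L2T L" if "r \<in> {s..t}" for r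
    unfolding w_def by (intro L2_fun_diff f that)
  have cub: "cubic (f r) \<in> L2T L" "cubic (f' r) \<in> L2T L" if "r \<in> ?S" for r
    using f[of r] ae[OF that] R0 that by (auto intro!: cubic_L2)
  have cd: "cd r \<in> L2T L" if "r \<in> ?S" for r
    unfolding cd_def by (intro L2_fun_diff cub that)
  have cdb: "sqrt (sqT L (cd r)) \<le> 3 * (R r + R' r) * sqrt (sqT L (w r))" if r: "r \<in> ?S" for r
    unfolding cd_def w_def using r by (intro cubic_diff_L2 f ae[OF r] R0) auto
  have nl: "nonlin \<delta> \<alpha> \<beta> (f r) \<in> L2T L" "nonlin \<delta> \<alpha> \<beta> (f' r) \<in> L2T L" if "r \<in> ?S" for r
    using f[of r] cub[OF that] that by (auto intro!: nonlin_L2)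
  have n: "n r \<in> L2T L" if "r \<in> ?S" for r
    unfolding n_def by (intro L2_fun_diff nl that)
  have n_eq: "n r = (\<lambda>x. of_real \<delta> * w r x - Complex \<alpha> \<beta> * cd r x)" for r
    by (simp add: n_def w_def cd_def nonlin_def fun_eq_iff algebra_simps)
  have wM: "sqT L (w r) \<le> 4 * M" if r: "r \<in> {s..t}" for r
    using sqn_diff_le[OF f[OF r]] M[OF r] unfolding w_def by linarith
  \<comment> \<open>The first summand bounds the norm of the forcing, the second the squared norm of
    the derivative of the difference. Both are nonnegative, so their sum is the common majorant that
    \<open>energy_equality\<close> asks for; 4 M bounds the squared norm of the difference.\<close>
  define B where "B r = (\<bar>\<delta>\<bar> + c * (3 * (K * (2 * M + P r)))) * sqrt (4 * M) + 2 * P r" for r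
  have Pi: "P integrable_on {s..t}"
    unfolding P_def by (intro integrable_add cgl_modesD(5)[OF sol] cgl_modesD(5)[OF sol'])
  have ni: "sqrt (sqT L (n r)) \<le> (\<bar>\<delta>\<bar> + c * (3 * (K * (2 * M + P r)))) * sqrt (4 * M)" if r: "r \<in> ?S" for r
  proof -
    have rs: "r \<in> {s..t}" using r by simp
    have "sqrt (sqT L (n r)) \<le> sqrt (sqT L (\<lambda>x. of_real \<delta> * w r x)) + sqrt (sqT L (\<lambda>x. Complex \<alpha> \<beta> * cd r x))"
      unfolding n_eq by (intro sqn_triangle_diff L2_fun_scale w[OF rs] cd[OF r])
    also have "\<dots> = \<bar>\<delta>\<bar> * sqrt (sqT L (w r)) + c * sqrt (sqT L (cd r))"
      unfolding sqn_scale c_def by (simp add: real_sqrt_mult)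
    also have "\<dots> \<le> \<bar>\<delta>\<bar> * sqrt (sqT L (w r)) + c * (3 * (K * (2 * M + P r)) * sqrt (sqT L (w r)))"
      using RR[OF rs] c0
      by (intro add_mono mult_left_mono order_trans[OF cdb[OF r]] mult_right_mono) auto
    also have "\<dots> = (\<bar>\<delta>\<bar> + c * (3 * (K * (2 * M + P r)))) * sqrt (sqT L (w r))"
      by (simp add: algebra_simps)
    also have "\<dots> \<le> (\<bar>\<delta>\<bar> + c * (3 * (K * (2 * M + P r)))) * sqrt (4 * M)"
      using wM[OF rs] c0 K M0 by (intro mult_left_mono) (auto simp: P_def)
    finally show ?thesis .
  qed
  show "((\<lambda>r. 2 * Re (ipT L (\<lambda>x. nonlin \<delta> \<alpha> \<beta> (f r) x - nonlin \<delta> \<alpha> \<beta> (f' r) x) (\<lambda>x. f r x - f' r x))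
      - 2 * a * sqT L (\<lambda>x. g r x - g' r x)) has_integral
    (sqT L (\<lambda>x. f t x - f' t x) - sqT L (\<lambda>x. f s x - f' s x))) {s..t}"
    unfolding n_def[symmetric] w_def[symmetric] q_def[symmetric]
  proof (rule energy_equality[OF L st, where Z = "Z \<union> Z'" and B = B and M = "4 * M" and b = b])
    show "negligible (Z \<union> Z')" using cgl_modesD(1)[OF sol] cgl_modesD(1)[OF sol'] by simp
    show "B integrable_on {s..t}"
      unfolding B_def using Pi
      by (intro integrable_add integrable_on_mult_right integrable_on_mult_left integrable_const_ivl)
    show "q r \<in> L2T L" if "r \<in> ?S" for r
      unfolding q_def by (intro L2_fun_diff g that)
    show "fc L (q r) k = \<i> * freq L k * fc L (w r) k" if r: "r \<in> ?S" for r k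
      using g[OF r] f[of r] r L unfolding q_def w_def by (simp add: fc_diff right_diff_distrib)
    fix r assume r: "r \<in> ?S"
    then have rs: "r \<in> {s..t}" by simp
    have P0: "P r \<ge> 0" by (simp add: P_def)
    have "sqT L (q r) \<le> 2 * P r"
      using sqn_diff_le[OF g(1,2)[OF r]] by (simp add: q_def P_def)
    also have "\<dots> \<le> B r"
      unfolding B_def using c0 K M0 P0 by simp
    finally show "sqT L (q r) \<le> B r" .
    show "sqrt (sqT L (n r)) \<le> B r"
      using ni[OF r] P0 unfolding B_def by linarith
  next
    fix k x y assume xy: "s \<le> x" "x \<le> y" "y \<le> t"
    have "((\<lambda>r. (mode_rhs L a b \<delta> \<alpha> \<beta> (f r) k)
       - (mode_rhs L a b \<delta> \<alpha> \<beta> (f' r) k)) has_integral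
       ((fc L (f y) k - fc L (f x) k) - (fc L (f' y) k - fc L (f' x) k))) {x..y}"
      by (rule has_integral_diff[OF cgl_modesD(6)[OF sol xy] cgl_modesD(6)[OF sol' xy]])
    note hi = this
    have fcw: "fc L (w r) k = fc L (f r) k - fc L (f' r) k" if "r \<in> {s..t}" for r
      unfolding w_def by (rule fc_diff[OF L f[OF that]])
    have xs: "x \<in> {s..t}" and ys: "y \<in> {s..t}" using xy by auto
    have "(fc L (f y) k - fc L (f x) k) - (fc L (f' y) k - fc L (f' x) k) = fc L (w y) k - fc L (w x) k"
      unfolding fcw[OF xs] fcw[OF ys] by (rule diff_diff_swap)
    with hi have *: "((\<lambda>r. (mode_rhs L a b \<delta> \<alpha> \<beta> (f r) k)
       - (mode_rhs L a b \<delta> \<alpha> \<beta> (f' r) k)) has_integral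
       (fc L (w y) k - fc L (w x) k)) {x..y}"
      by (simp only:)
    show "((\<lambda>r. fc L (n r) k - Complex a b * (freq L k)\<^sup>2 * fc L (w r) k) has_integral
       (fc L (w y) k - fc L (w x) k)) {x..y}"
    proof (rule has_integral_spike[OF _ _ *])
      show "negligible (Z \<union> Z')" using cgl_modesD(1)[OF sol] cgl_modesD(1)[OF sol'] by simp
      fix r assume "r \<in> {x..y} - (Z \<union> Z')"
      then have r: "r \<in> ?S" "r \<in> {s..t}" using xy by auto
      show "fc L (n r) k - Complex a b * (freq L k)\<^sup>2 * fc L (w r) k =
        (mode_rhs L a b \<delta> \<alpha> \<beta> (f r) k)
       - (mode_rhs L a b \<delta> \<alpha> \<beta> (f' r) k)"
        using nl[OF r(1)] f[OF r(2)] L by (simp add: mode_rhs_def n_def w_def fc_diff algebra_simps)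
    qed
  qed (use w wM n in auto)
  show "\<bar>2 * Re (ipT L (\<lambda>x. nonlin \<delta> \<alpha> \<beta> (f r) x - nonlin \<delta> \<alpha> \<beta> (f' r) x) (\<lambda>x. f r x - f' r x))\<bar>
    \<le> diff_coeff \<delta> \<alpha> \<beta> K M (sqT L (g r) + sqT L (g' r)) * sqT L (\<lambda>x. f r x - f' r x)" if r: "r \<in> ?S" for r
  proof -
    have rs: "r \<in> {s..t}" using r by simp
    have "ipT L (n r) (w r) = of_real \<delta> * ipT L (w r) (w r) - Complex \<alpha> \<beta> * ipT L (cd r) (w r)"
      unfolding n_eq using w[OF rs] cd[OF r] by (simp add: ip_diff_left L2_fun_scale ip_scale_left)
    also have "norm \<dots> \<le> norm (of_real \<delta> * ipT L (w r) (w r)) + norm (Complex \<alpha> \<beta> * ipT L (cd r) (w r))"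
      by (rule norm_triangle_ineq4)
    also have "\<dots> = \<bar>\<delta>\<bar> * sqT L (w r) + c * norm (ipT L (cd r) (w r))"
      by (simp add: norm_mult c_def flip: sqn_eq_ip)
    also have "\<dots> \<le> \<bar>\<delta>\<bar> * sqT L (w r) + c * ((3 * (K * (2 * M + P r)) * sqrt (sqT L (w r))) * sqrt (sqT L (w r)))"
      using c0 RR[OF rs]
      by (intro add_mono mult_left_mono order_trans[OF ip_bound[OF cd[OF r] w[OF rs]]]
          mult_right_mono order_trans[OF cdb[OF r]]) auto
    also have "\<dots> = (\<bar>\<delta>\<bar> + c * (3 * (K * (2 * M + P r)))) * sqT L (w r)"
      by (simp add: algebra_simps)
    finally have "\<bar>Re (ipT L (n r) (w r))\<bar> \<le> (\<bar>\<delta>\<bar> + c * (3 * (K * (2 * M + P r)))) * sqT L (w r)"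
      using abs_Re_le_cmod order_trans by blast
    then show ?thesis unfolding n_def[symmetric] w_def[symmetric] P_def[symmetric]
      by (simp add: diff_coeff_def c_def algebra_simps)
  qed
qed

lemma nonlin_zero: "nonlin \<delta> \<alpha> \<beta> (\<lambda>x. 0) = (\<lambda>x. 0)"
  by (simp add: nonlin_def cubic_def fun_eq_iff)

text \<open>Compared with this solution, the difference identity becomes the energy identity of a
  single solution.\<close>

lemma cgl_modes_zero: "cgl_modes L a b \<delta> \<alpha> \<beta> s t (\<lambda>r x. 0) (\<lambda>r x. 0) {}"
  unfolding cgl_modes_def mode_rhs_def nonlin_zero by (auto simp: L2_fun_zero fc_def sqn_def)

text \<open>The pairing of the cubic term with \<open>f r\<close> is the real number given by the
  integral of |f|^4, so \<open>\<beta>\<close> disappears from the real part. This integral is at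
  least the square of the integral of |f|^2 divided by L.\<close>

lemma cgl_energy_inequality:
  assumes L: "L > 0" and \<alpha>: "\<alpha> > 0" and st: "s \<le> t"
    and sol: "cgl_modes L a b \<delta> \<alpha> \<beta> s t f g Z"
  shows "\<exists>E. (E has_integral (sqT L (f t) - sqT L (f s))) {s..t} \<and>
    (\<forall>r\<in>{s..t} - Z. E r + 2 * a * sqT L (g r) \<le>
       2 * \<delta> * sqT L (f r) - (2 * \<alpha> / L) * (sqT L (f r))\<^sup>2)"
proof -
  let ?S = "{s..t} - Z"
  obtain K where SK: "sobolev_const L K" using sobolev_embedding[OF L] by (elim exE)
  note K = sobolev_constD(1)[OF SK] and sob = sobolev_constD(2)[OF SK]
  obtain M where M: "\<And>r. r \<in> {s..t} \<Longrightarrow> sqT L (f r) \<le> M"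
    using sol unfolding cgl_modes_def by blast
  have M0: "M \<ge> 0" using M[of s] st order_trans[OF sqn_nonneg[of "torus L" "f s"]] by simp
  define R where "R r = K * (sqT L (f r) + sqT L (g r))" for r
  have R0: "R r \<ge> 0" for r using K by (simp add: R_def)
  have f: "f r \<in> L2T L" if "r \<in> {s..t}" for r
    using cgl_modesD(2)[OF sol that] .
  have g: "g r \<in> L2T L" "fc L (g r) k = \<i> * freq L k * fc L (f r) k" if "r \<in> ?S" for r k
    using cgl_modesD(3,4)[OF sol that] by auto
  have ae: "AE x in torus L. (norm (f r x))\<^sup>2 \<le> R r" if "r \<in> ?S" for r
    unfolding R_def using f[of r] g[OF that] that by (auto intro!: sob)
  have cub: "cubic (f r) \<in> L2T L" if "r \<in> ?S" for r
    using f[of r] ae[OF that] R0 that by (auto intro!: cubic_L2)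
  have M': "sqT L (f r) \<le> M \<and> sqT L (\<lambda>x. 0) \<le> M" if "r \<in> {s..t}" for r
    using M[OF that] M0 by (simp add: sqn_def)
  have "((\<lambda>r. 2 * Re (ipT L (nonlin \<delta> \<alpha> \<beta> (f r)) (f r)) - 2 * a * sqT L (g r)) has_integral
       (sqT L (f t) - sqT L (f s))) {s..t}"
    using cgl_difference_energy(1)[OF L SK M0 st sol cgl_modes_zero M'] by (simp add: nonlin_zero)
  moreover have "2 * Re (ipT L (nonlin \<delta> \<alpha> \<beta> (f r)) (f r)) \<le>
       2 * \<delta> * sqT L (f r) - (2 * \<alpha> / L) * (sqT L (f r))\<^sup>2" if r: "r \<in> ?S" for r
  proof -
    have rs: "r \<in> {s..t}" using r by simp
    define h where "h x = complex_of_real ((norm (f r x))\<^sup>2)" for x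
    have nh: "norm (h x) = (norm (f r x))\<^sup>2" for x unfolding h_def norm_of_real by simp
    have h4: "cubic (f r) x * cnj (f r x) = of_real ((norm (h x))\<^sup>2)" for x
        unfolding cubic_def mult.assoc complex_norm_square[symmetric] nh by (simp add: power2_eq_square)
    \<comment> \<open>That \<open>h\<close> is in L2 means that \<open>f r\<close> is in L4; this
      holds because |f|^4 is the product of the cubic term and the conjugate of \<open>f r\<close>,
      both square-integrable.\<close>
    have "integrable (torus L) (\<lambda>x. complex_of_real ((norm (h x))\<^sup>2))"
      using ip_integrable[OF cub[OF r] f[OF rs]] by (simp only: h4)
    then have "integrable (torus L) (\<lambda>x. (norm (h x))\<^sup>2)"
      by (simp only: complex_of_real_integrable_eq)
    then have h: "h \<in> L2T L"
      using f[OF rs] by (auto simp: L2_fun_def h_def[abs_def])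
    have ipc: "ipT L (cubic (f r)) (f r) = of_real (sqT L h)"
      unfolding ip_def sqn_def h4 by (rule integral_complex_of_real)
    have "sqT L (f r) \<le> sqrt L * sqrt (sqT L h)"
      using L2_fun_L1_bound(2)[OF L h] by (simp only: nh sqn_def)
    then have "(sqT L (f r))\<^sup>2 \<le> (sqrt L * sqrt (sqT L h))\<^sup>2"
      by (intro power_mono) auto
    then have "(sqT L (f r))\<^sup>2 \<le> L * sqT L h"
      using L by (simp add: power_mult_distrib)
    then have "(sqT L (f r))\<^sup>2 / L \<le> sqT L h"
      using L by (simp add: field_simps)
    then have le: "2 * \<alpha> * ((sqT L (f r))\<^sup>2 / L) \<le> 2 * \<alpha> * sqT L h"
      using \<alpha> by (intro mult_left_mono) auto
    have "ipT L (nonlin \<delta> \<alpha> \<beta> (f r)) (f r) = of_real \<delta> * ipT L (f r) (f r) - Complex \<alpha> \<beta> * ipT L (cubic (f r)) (f r)"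
      unfolding nonlin_def[abs_def] using f[OF rs] cub[OF r] by (simp add: ip_diff_left L2_fun_scale ip_scale_left)
    then have "Re (ipT L (nonlin \<delta> \<alpha> \<beta> (f r)) (f r)) = \<delta> * sqT L (f r) - \<alpha> * sqT L h"
      by (simp add: ipc flip: sqn_eq_ip)
    then show ?thesis using le by (simp add: algebra_simps)
  qed
  ultimately show ?thesis
    by (intro exI[of _ "\<lambda>r. 2 * Re (ipT L (nonlin \<delta> \<alpha> \<beta> (f r)) (f r)) - 2 * a * sqT L (g r)"] conjI ballI) simp_all
qed

text \<open>The hypothesis \<open>le\<close> replaces w by a constant bound on each subinterval, so
  no integral of a product of w and C is ever formed. On intervals where C has integral below 1/2,
  the maximum of w is at most half of itself and vanishes; uniform continuity of the indefinite
  integral makes the length of these intervals uniform.\<close>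

lemma gronwall_zero:
  fixes w C :: "real \<Rightarrow> real"
  assumes st: "s \<le> t" and w: "continuous_on {s..t} w" "\<And>r. r \<in> {s..t} \<Longrightarrow> w r \<ge> 0" and ws: "w s = 0"
    and C: "C integrable_on {s..t}" "\<And>r. C r \<ge> 0"
    and le: "\<And>x y W. s \<le> x \<Longrightarrow> x \<le> y \<Longrightarrow> y \<le> t \<Longrightarrow> (\<And>r. r \<in> {x..y} \<Longrightarrow> w r \<le> W) \<Longrightarrow>
       w y - w x \<le> W * integral {x..y} C"
  shows "w t = 0"
proof -
  have comb: "integral {s..y} C - integral {s..x} C = integral {x..y} C"
    if "s \<le> x" "x \<le> y" "y \<le> t" for x y
    using Henstock_Kurzweil_Integration.integral_combine[of s x y C] that integrable_subinterval_real[OF C(1), of s y] by auto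
  have "uniformly_continuous_on {s..t} (\<lambda>x. integral {s..x} C)"
    by (intro compact_uniformly_continuous indefinite_integral_continuous_1 C) auto
  then obtain d where d: "d > 0" "\<And>x y. x \<in> {s..t} \<Longrightarrow> y \<in> {s..t} \<Longrightarrow> dist y x < d \<Longrightarrow>
      dist (integral {s..y} C) (integral {s..x} C) < 1 / 2"
    unfolding uniformly_continuous_on_def by (meson half_gt_zero zero_less_one)
  have *: "w y = 0" if "s \<le> y" "y \<le> t" "y \<le> s + real n * (d / 2)" for n y
    using that
  proof (induction n arbitrary: y)
    case 0
    then show ?case using ws by simp
  next
    case (Suc n)
    define x where "x = max s (y - d / 2)"
    have x: "s \<le> x" "x \<le> y" "y - x < d" "x \<le> t" "x \<le> s + real n * (d / 2)"
      using Suc.prems d(1) by (auto simp: x_def algebra_simps add_divide_distrib)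
    have wx: "w x = 0" by (rule Suc.IH[OF x(1,4,5)])
    have "continuous_on {x..y} w" using w(1) x Suc.prems by (elim continuous_on_subset) auto
    then obtain m where m: "m \<in> {x..y}" "\<And>r. r \<in> {x..y} \<Longrightarrow> w r \<le> w m"
      using continuous_attains_sup[of "{x..y}" w] x(2) by auto
    \<comment> \<open>The estimate is applied up to the point of maximum, not up to y, so that the
      same value stands on both sides.\<close>
    have "w m - w x \<le> w m * integral {x..m} C"
      using m x Suc.prems by (intro le) auto
    also have "\<dots> \<le> w m * (1 / 2)"
    proof (rule mult_left_mono)
      have "dist (integral {s..m} C) (integral {s..x} C) < 1 / 2"
        using m x Suc.prems by (intro d(2)) (auto simp: dist_real_def)
      then show "integral {x..m} C \<le> 1 / 2"
        using comb[of x m] m x Suc.prems by (simp add: dist_real_def)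
      show "0 \<le> w m" using m x Suc.prems by (intro w(2)) auto
    qed
    finally have "w m \<le> 0" using wx by simp
    then have "w y \<le> 0" using m(2)[of y] x(2) by simp
    then show ?case using w(2)[of y] Suc.prems by simp
  qed
  obtain n where "(t - s) / (d / 2) < real n" using reals_Archimedean2 by blast
  then have "t \<le> s + real n * (d / 2)" using d(1) by (simp add: field_simps)
  then show ?thesis using *[of t n] st by simp
qed

lemma has_integral_le_ae:
  fixes f g :: "real \<Rightarrow> real"
  assumes "(f has_integral i) S" "(g has_integral j) S" "negligible Z" "\<And>x. x \<in> S - Z \<Longrightarrow> f x \<le> g x"
  shows "i \<le> j"
  using has_integral_le[of f i "S - Z" g j] assms has_integral_minus_negligible[OF assms(3)] by blast

text \<open>Forward in time diffusion decreases the distance and is discarded; what remains has a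
  coefficient that is integrable in time.\<close>

lemma cgl_modes_unique:
  assumes L: "L > 0" and a: "a > 0" and st: "s \<le> t"
    and sol: "cgl_modes L a b \<delta> \<alpha> \<beta> s t f g Z" and sol': "cgl_modes L a b \<delta> \<alpha> \<beta> s t f' g' Z'"
    and cont: "continuous_on {s..t} (\<lambda>r. sqT L (\<lambda>x. f r x - f' r x))"
    and init: "sqT L (\<lambda>x. f s x - f' s x) = 0"
  shows "sqT L (\<lambda>x. f t x - f' t x) = 0"
proof -
  obtain M1 M2 where M: "\<And>r. r \<in> {s..t} \<Longrightarrow> sqT L (f r) \<le> M1" "\<And>r. r \<in> {s..t} \<Longrightarrow> sqT L (f' r) \<le> M2"
    using sol sol' unfolding cgl_modes_def by metis
  define M where "M = max 0 (max M1 M2)"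
  have M: "M \<ge> 0" "\<And>r. r \<in> {s..t} \<Longrightarrow> sqT L (f r) \<le> M \<and> sqT L (f' r) \<le> M"
    using M by (auto simp: M_def le_max_iff_disj)
  define w where "w r = sqT L (\<lambda>x. f r x - f' r x)" for r
  define q where "q r = sqT L (\<lambda>x. g r x - g' r x)" for r
  obtain K where SK: "sobolev_const L K" using sobolev_embedding[OF L] by (elim exE)
  define C where "C r = diff_coeff \<delta> \<alpha> \<beta> K M (sqT L (g r) + sqT L (g' r))" for r
  have C0: "C r \<ge> 0" for r
    unfolding C_def by (intro diff_coeff_nonneg sobolev_constD(1)[OF SK] M(1)) simp
  have Ci: "C integrable_on {s..t}"
    unfolding C_def diff_coeff_def
    by (intro integrable_add integrable_on_mult_right integrable_const_ivl cgl_modesD(5)[OF sol] cgl_modesD(5)[OF sol'])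
  have Z: "negligible (Z \<union> Z')" using cgl_modesD(1)[OF sol] cgl_modesD(1)[OF sol'] by simp
  have "w t = 0"
  proof (rule gronwall_zero[OF st _ _ _ Ci C0])
    show "continuous_on {s..t} w" "w s = 0" using cont init by (simp_all add: w_def)
    show "w r \<ge> 0" for r by (simp add: w_def)
    fix x y W assume xy: "s \<le> x" "x \<le> y" "y \<le> t" and W: "\<And>r. r \<in> {x..y} \<Longrightarrow> w r \<le> W"
    have Mxy: "sqT L (f r) \<le> M \<and> sqT L (f' r) \<le> M" if "r \<in> {x..y}" for r
      using M(2) xy that by auto
    define E where "E r = 2 * Re (ipT L (\<lambda>x. nonlin \<delta> \<alpha> \<beta> (f r) x - nonlin \<delta> \<alpha> \<beta> (f' r) x) (\<lambda>x. f r x - f' r x))" for r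
    have E: "((\<lambda>r. E r - 2 * a * q r) has_integral (w y - w x)) {x..y}"
      and Eb: "\<And>r. r \<in> {x..y} - (Z \<union> Z') \<Longrightarrow> \<bar>E r\<bar> \<le> C r * w r"
      unfolding w_def q_def C_def E_def
      by (rule cgl_difference_energy[OF L SK M(1) xy(2) cgl_modes_subinterval[OF sol xy(1,3)]
            cgl_modes_subinterval[OF sol' xy(1,3)] Mxy], assumption)+
    have "C integrable_on {x..y}" using integrable_subinterval_real[OF Ci, of x y] xy by auto
    then have "((\<lambda>r. W * C r) has_integral (W * integral {x..y} C)) {x..y}"
      by (intro has_integral_mult_right integrable_integral)
    then show "w y - w x \<le> W * integral {x..y} C"
    proof (rule has_integral_le_ae[OF E _ Z])
      fix r assume r: "r \<in> {x..y} - (Z \<union> Z')"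
      have "C r * w r \<le> W * C r" using r W C0 by (simp add: mult.commute[of W] mult_left_mono)
      moreover have "0 \<le> 2 * a * q r" using a by (simp add: q_def)
      ultimately show "E r - 2 * a * q r \<le> W * C r" using Eb[OF r] by linarith
    qed
  qed
  then show ?thesis by (simp add: w_def)
qed

section \<open>Weak solutions and their Fourier modes\<close>

lemma AE_lebesgue_on_iff:
  assumes "S \<in> sets lebesgue"
  shows "(AE r in lebesgue_on S. Q r) \<longleftrightarrow> negligible {r \<in> S. \<not> Q r}"
proof -
  have "(AE r in lebesgue_on S. Q r) \<longleftrightarrow> (AE r in lebesgue. r \<in> S \<longrightarrow> Q r)"
    using assms by (subst AE_restrict_space_iff) auto
  also have "\<dots> \<longleftrightarrow> {r \<in> space lebesgue. \<not> (r \<in> S \<longrightarrow> Q r)} \<in> null_sets lebesgue"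
    by (rule completion.AE_iff_null_sets)
  also have "{r \<in> space lebesgue. \<not> (r \<in> S \<longrightarrow> Q r)} = {r \<in> S. \<not> Q r}" by auto
  finally show ?thesis by (simp add: negligible_iff_null_sets)
qed

lemma has_integral_of_bochner:
  fixes f :: "real \<Rightarrow> 'a::euclidean_space"
  assumes "has_bochner_integral (lebesgue_on {s..t}) f i"
  shows "(f has_integral i) {s..t}"
  using has_integral_integral_lebesgue_on[of "{s..t}" f] assms by (auto simp: has_bochner_integral_iff)

lemma absolutely_integrable_iff_lebesgue_on:
  fixes f :: "real \<Rightarrow> 'a::euclidean_space"
  shows "f absolutely_integrable_on {s..t} \<longleftrightarrow> integrable (lebesgue_on {s..t}) f"
  by (simp add: set_integrable_def integrable_restrict_space)

lemma has_bochner_of_integral: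
  fixes f :: "real \<Rightarrow> 'a::euclidean_space"
  assumes "f absolutely_integrable_on {s..t}" "(f has_integral i) {s..t}"
  shows "has_bochner_integral (lebesgue_on {s..t}) f i"
  using assms has_integral_integral_lebesgue_on[of "{s..t}" f] 
  by (auto simp: absolutely_integrable_iff_lebesgue_on has_bochner_integral_iff dest: has_integral_unique)

lemma has_bochner_integral_shift:
  fixes f :: "real \<Rightarrow> 'a::euclidean_space"
  assumes "has_bochner_integral (lebesgue_on {s + c..t + c}) f i"
  shows "has_bochner_integral (lebesgue_on {s..t}) (\<lambda>r. f (r + c)) i"
proof -
  have "has_bochner_integral lebesgue (\<lambda>x. indicator {s + c..t + c} x *\<^sub>R f x) i"
    using assms by (simp add: has_bochner_integral_restrict_space)
  then have "has_bochner_integral lebesgue (\<lambda>x. indicator {s + c..t + c} (c + 1 * x) *\<^sub>R f (c + 1 * x)) i"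
    by (subst (asm) has_bochner_integral_lebesgue_real_affine_iff[of 1 _ _ c]) auto
  moreover have "indicat_real {s + c..t + c} (c + 1 * x) = indicat_real {s..t} x" for x
    by (auto simp: indicator_def)
  ultimately show ?thesis
    by (simp add: has_bochner_integral_restrict_space add.commute)
qed

lemma integrable_shift:
  fixes f :: "real \<Rightarrow> 'a::euclidean_space"
  assumes "integrable (lebesgue_on {s + c..t + c}) f"
  shows "integrable (lebesgue_on {s..t}) (\<lambda>r. f (r + c))"
  using has_bochner_integral_shift[of s c t f] assms
  by (auto simp: has_bochner_integral_iff)

lemma AE_shift:
  fixes s t c :: real
  assumes "AE r in lebesgue_on {s + c..t + c}. Q r"
  shows "AE r in lebesgue_on {s..t}. Q (r + c)"
proof -
  have "negligible {r \<in> {s + c..t + c}. \<not> Q r}"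
    by (rule AE_lebesgue_on_iff[THEN iffD1, OF _ assms]) simp
  then have "negligible ((+) (- c) ` {r \<in> {s + c..t + c}. \<not> Q r})" by (rule negligible_translation)
  moreover have "{r \<in> {s..t}. \<not> Q (r + c)} \<subseteq> (+) (- c) ` {r \<in> {s + c..t + c}. \<not> Q r}"
  proof
    fix r assume "r \<in> {r \<in> {s..t}. \<not> Q (r + c)}"
    then have "r + c \<in> {r \<in> {s + c..t + c}. \<not> Q r}" "r = - c + (r + c)" by auto
    then show "r \<in> (+) (- c) ` {r \<in> {s + c..t + c}. \<not> Q r}" by blast
  qed
  ultimately show ?thesis by (subst AE_lebesgue_on_iff) (auto intro: negligible_subset)
qed

section \<open>Continuous curves in L2 in metric form\<close>

lemma L2_dist_triangle:
  "F \<in> L2 M \<Longrightarrow> G \<in> L2 M \<Longrightarrow> H \<in> L2 M \<Longrightarrow> L2_dist M F H \<le> L2_dist M F G + L2_dist M G H"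
  by (rule Metric_space.triangle[OF Metric_space_L2])

lemma L2_dist_commute: "L2_dist M F G = L2_dist M G F"
  by (rule Metric_space.commute[OF Metric_space_L2])

lemma L2_dist_eq_0: "F \<in> L2 M \<Longrightarrow> G \<in> L2 M \<Longrightarrow> L2_dist M F G = 0 \<longleftrightarrow> F = G"
  by (rule Metric_space.zero[OF Metric_space_L2])

lemma L2_dist_nonneg [simp]: "0 \<le> L2_dist M F G"
  by (simp add: L2_dist_sqn)

lemma continuous_map_L2:
  "continuous_map (top_of_set J) (L2_topology M) u \<longleftrightarrow>
     (\<forall>t\<in>J. u t \<in> L2 M) \<and> (\<forall>t\<in>J. \<forall>e>0. \<exists>d>0. \<forall>s\<in>J. dist s t < d \<longrightarrow> L2_dist M (u t) (u s) < e)"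
  (is "?l \<longleftrightarrow> ?r") for J :: "real set"
proof
  assume l: ?l
  have mem: "u t \<in> L2 M" if "t \<in> J" for t
    using l that by (auto simp: continuous_map_def Metric_space.topspace_mtopology[OF Metric_space_L2])
  have "\<exists>d>0. \<forall>s\<in>J. dist s t < d \<longrightarrow> L2_dist M (u t) (u s) < e" if t: "t \<in> J" and e: "e > 0" for t e
  proof -
    obtain U where U: "openin (top_of_set J) U" "t \<in> U" "\<forall>y\<in>U. u y \<in> Metric_space.mball (L2 M) (L2_dist M) (u t) e"
      using l[unfolded Metric_space.continuous_map_to_metric[OF Metric_space_L2], rule_format, of t e] t e
      by auto
    have nb: "\<forall>x\<in>U. \<exists>d>0. \<forall>s\<in>J. dist s x < d \<longrightarrow> s \<in> U"
      using U(1) unfolding openin_euclidean_subtopology_iff by (rule conjunct2)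
    obtain d where "d > 0" "\<forall>s\<in>J. dist s t < d \<longrightarrow> s \<in> U"
      using bspec[OF nb U(2)] by (elim exE conjE)
    then show ?thesis
      using U(3) by (auto simp: Metric_space.in_mball[OF Metric_space_L2])
  qed
  then show ?r using mem by blast
next
  assume r: ?r
  show ?l
    unfolding Metric_space.continuous_map_to_metric[OF Metric_space_L2]
  proof (intro ballI allI impI)
    fix t and e :: real assume "t \<in> topspace (top_of_set J)" and e: "e > 0"
    then have t: "t \<in> J" by simp
    obtain d where d: "d > 0" "\<forall>s\<in>J. dist s t < d \<longrightarrow> L2_dist M (u t) (u s) < e" using r t e by blast
    have "openin (top_of_set J) (J \<inter> ball t d)" by (rule openin_open_Int) simp
    then show "\<exists>U. openin (top_of_set J) U \<and> t \<in> U \<and> (\<forall>y\<in>U. u y \<in> Metric_space.mball (L2 M) (L2_dist M) (u t) e)"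
      using t d r by (intro exI[of _ "J \<inter> ball t d"])
        (auto simp: Metric_space.in_mball[OF Metric_space_L2] dist_commute)
  qed
qed

lemma continuous_map_L2_mem:
  fixes J :: "real set"
  assumes "continuous_map (top_of_set J) (L2_topology M) u" "t \<in> J"
  shows "u t \<in> L2 M"
  using assms by (simp add: continuous_map_L2)

lemma continuous_map_L2_dist:
  fixes J :: "real set"
  assumes "continuous_map (top_of_set J) (L2_topology M) u" "t \<in> J" "e > 0"
  shows "\<exists>d>0. \<forall>s\<in>J. dist s t < d \<longrightarrow> L2_dist M (u t) (u s) < e"
proof -
  have "\<forall>t\<in>J. \<forall>e>0. \<exists>d>0. \<forall>s\<in>J. dist s t < d \<longrightarrow> L2_dist M (u t) (u s) < e"
    using assms(1) unfolding continuous_map_L2 by (rule conjunct2)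
  from this[rule_format, OF assms(2,3)] show ?thesis .
qed

lemma continuous_on_L2_dist:
  fixes J :: "real set"
  assumes u: "continuous_map (top_of_set J) (L2_topology M) u" and v: "continuous_map (top_of_set J) (L2_topology M) v"
  shows "continuous_on J (\<lambda>r. L2_dist M (u r) (v r))"
  unfolding continuous_on_iff
proof (intro ballI allI impI)
  fix t e :: real assume t: "t \<in> J" and e: "e > 0"
  have mem: "u r \<in> L2 M" "v r \<in> L2 M" if "r \<in> J" for r
    using continuous_map_L2_mem[OF u that] continuous_map_L2_mem[OF v that] by auto
  obtain d1 where d1: "d1 > 0" "\<forall>s\<in>J. dist s t < d1 \<longrightarrow> L2_dist M (u t) (u s) < e / 2"
    using continuous_map_L2_dist[OF u t half_gt_zero[OF e]] by (elim exE conjE)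
  obtain d2 where d2: "d2 > 0" "\<forall>s\<in>J. dist s t < d2 \<longrightarrow> L2_dist M (v t) (v s) < e / 2"
    using continuous_map_L2_dist[OF v t half_gt_zero[OF e]] by (elim exE conjE)
  have "dist (L2_dist M (u s) (v s)) (L2_dist M (u t) (v t)) < e" if s: "s \<in> J" "dist s t < min d1 d2" for s
  proof -
    have "L2_dist M (u t) (u s) < e / 2" "L2_dist M (v t) (v s) < e / 2" using d1 d2 s by auto
    moreover have "L2_dist M (u s) (v s) \<le> L2_dist M (u s) (u t) + (L2_dist M (u t) (v t) + L2_dist M (v t) (v s))"
      using mem s t by (intro order_trans[OF L2_dist_triangle add_left_mono[OF L2_dist_triangle]]) auto
    moreover have "L2_dist M (u t) (v t) \<le> L2_dist M (u t) (u s) + (L2_dist M (u s) (v s) + L2_dist M (v s) (v t))"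
      using mem s t by (intro order_trans[OF L2_dist_triangle add_left_mono[OF L2_dist_triangle]]) auto
    ultimately show ?thesis
      using L2_dist_commute[of M "u s" "u t"] L2_dist_commute[of M "v s" "v t"]
      unfolding dist_real_def by linarith
  qed
  then show "\<exists>d>0. \<forall>s\<in>J. dist s t < d \<longrightarrow> dist (L2_dist M (u s) (v s)) (L2_dist M (u t) (v t)) < e"
    using d1(1) d2(1) by (intro exI[of _ "min d1 d2"]) auto
qed

lemma sqn_eq_L2_dist: "sqn M (\<lambda>x. rep F x - rep G x) = (L2_dist M F G)\<^sup>2"
  by (simp add: L2_dist_sqn)

lemma sqn_eq_L2_norm: "sqn M (rep F) = (L2_norm M F)\<^sup>2"
  by (simp add: L2_norm_sqn)

lemma sqn_zero [simp]: "sqn M (\<lambda>x. 0) = 0"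
  by (simp add: sqn_def)

lemma L2_norm_nonneg [simp]: "0 \<le> L2_norm M F"
  by (simp add: L2_norm_sqn)

lemma L2_norm_diff_le:
  assumes "F \<in> L2 M" "G \<in> L2 M"
  shows "\<bar>L2_norm M F - L2_norm M G\<bar> \<le> L2_dist M F G"
proof -
  have *: "L2_norm M F \<le> L2_dist M F G + L2_norm M G" if "F \<in> L2 M" "G \<in> L2 M" for F G
    using sqn_triangle[OF L2_fun_diff[OF rep_L2_fun[OF that(1)] rep_L2_fun[OF that(2)]] rep_L2_fun[OF that(2)]]
    by (simp add: L2_norm_sqn L2_dist_sqn)
  show ?thesis using *[OF assms] *[OF assms(2,1)] L2_dist_commute[of M F G] by linarith
qed

lemma continuous_on_L2_norm:
  fixes J :: "real set"
  assumes u: "continuous_map (top_of_set J) (L2_topology M) u"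
  shows "continuous_on J (\<lambda>r. L2_norm M (u r))"
  unfolding continuous_on_iff
proof (intro ballI allI impI)
  fix t e :: real assume t: "t \<in> J" and e: "e > 0"
  obtain d where d: "d > 0" "\<forall>s\<in>J. dist s t < d \<longrightarrow> L2_dist M (u t) (u s) < e"
    using continuous_map_L2_dist[OF u t e] by (elim exE conjE)
  have "dist (L2_norm M (u s)) (L2_norm M (u t)) < e" if s: "s \<in> J" "dist s t < d" for s
    using d(2)[rule_format, OF s] L2_norm_diff_le[OF continuous_map_L2_mem[OF u t] continuous_map_L2_mem[OF u s(1)]]
    by (simp add: dist_real_def abs_minus_commute)
  then show "\<exists>d>0. \<forall>s\<in>J. dist s t < d \<longrightarrow> dist (L2_norm M (u s)) (L2_norm M (u t)) < e"
    using d(1) by blast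
qed

lemma continuous_on_sqn_rep:
  fixes J :: "real set"
  assumes "continuous_map (top_of_set J) (L2_topology M) u"
  shows "continuous_on J (\<lambda>r. sqn M (rep (u r)))"
  unfolding sqn_eq_L2_norm by (intro continuous_intros continuous_on_L2_norm assms)

section \<open>From the weak formulation to Fourier modes\<close>

lemma fc_torus_deriv:
  assumes L: "L > 0" and d: "has_torus_deriv L F G"
  shows "fc L (rep G) k = \<i> * freq L k * fc L (rep F) k"
proof -
  have D1: "D (fexp L (- k)) x = (- (\<i> * freq L k)) * fexp L (- k) x" for x
    using fun_cong[OF D_fexp[of 1 L "- k"], of x] by simp
  have "(- (\<i> * freq L k)) * (LINT x|torus L. rep F x * fexp L (- k) x)
      = (LINT x|torus L. (- (\<i> * freq L k)) * (rep F x * fexp L (- k) x))"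
    by (rule integral_mult_right_zero[symmetric])
  also have "\<dots> = (LINT x|torus L. rep F x * D (fexp L (- k)) x)"
    unfolding D1 by (intro Bochner_Integration.integral_cong refl) (rule mult.left_commute)
  also have "\<dots> = - (LINT x|torus L. rep G x * fexp L (- k) x)"
    using d fexp_smooth[OF L] unfolding has_torus_deriv_def by blast
  finally show ?thesis by (simp add: fc_def mult.assoc)
qed

text \<open>A function with a square-integrable derivative is essentially bounded by the Sobolev
  inequality, hence its cube is square-integrable.\<close>

lemma torus_deriv_nonlin_L2:
  assumes L: "L > 0" and d: "has_torus_deriv L F G"
  shows "cubic (rep F) \<in> L2T L" "nonlin \<delta> \<alpha> \<beta> (rep F) \<in> L2T L"
proof -
  have FG: "rep F \<in> L2T L" "rep G \<in> L2T L"
    using d by (auto simp: has_torus_deriv_def rep_L2_fun)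
  obtain K where SK: "sobolev_const L K" using sobolev_embedding[OF L] by (elim exE)
  note K = sobolev_constD(1)[OF SK] and sob = sobolev_constD(2)[OF SK]
  have "AE x in torus L. (norm (rep F x))\<^sup>2 \<le> K * (sqT L (rep F) + sqT L (rep G))"
    by (rule sob[OF FG fc_torus_deriv[OF L d]])
  then show c: "cubic (rep F) \<in> L2T L"
    by (rule cubic_L2[OF FG(1)]) (use K in auto)
  show "nonlin \<delta> \<alpha> \<beta> (rep F) \<in> L2T L" by (rule nonlin_L2[OF FG(1) c])
qed

definition weak_integrand :: "real \<Rightarrow> real \<Rightarrow> real \<Rightarrow> real \<Rightarrow> real \<Rightarrow> real \<Rightarrow> (real \<Rightarrow> complex) \<Rightarrow> (real \<Rightarrow> complex) set \<Rightarrow> complex" where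
  "weak_integrand L a b \<delta> \<alpha> \<beta> \<phi> F = (LINT x|torus L.
                 Complex a b * rep F x * D (D \<phi>) x
                 + of_real \<delta> * rep F x * \<phi> x
                 - Complex \<alpha> \<beta> * (of_real ((norm (rep F x))\<^sup>2) * rep F x) * \<phi> x)"

text \<open>The second derivative of the test exponential contributes the factor -freq^2. The
  derivative of the solution is needed only to split the integral, through integrability of the
  cubic term.\<close>

lemma weak_integrand_fexp:
  assumes L: "L > 0" and d: "has_torus_deriv L F G"
  shows "weak_integrand L a b \<delta> \<alpha> \<beta> (fexp L (- k)) F / of_real L =
    mode_rhs L a b \<delta> \<alpha> \<beta> (rep F) k"
proof -
  have F: "rep F \<in> L2T L"
    using d by (auto simp: has_torus_deriv_def rep_L2_fun)
  have D1: "D (fexp L (- k)) = (\<lambda>x. (- (\<i> * freq L k)) * fexp L (- k) x)"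
    using D_fexp[of 1 L "- k"] by simp
  have DD: "D (D (fexp L (- k))) x = - (of_real ((freq L k)\<^sup>2)) * fexp L (- k) x" for x
    unfolding D1 fun_cong[OF D_fexp] by (simp add: power2_eq_square algebra_simps)
  have "weak_integrand L a b \<delta> \<alpha> \<beta> (fexp L (- k)) F = (LINT x|torus L.
     nonlin \<delta> \<alpha> \<beta> (rep F) x * fexp L (- k) x - (Complex a b * (freq L k)\<^sup>2) * (rep F x * fexp L (- k) x))"
    unfolding weak_integrand_def DD nonlin_def cubic_def
    by (intro Bochner_Integration.integral_cong refl) (simp add: algebra_simps)
  also have "\<dots> = (LINT x|torus L. nonlin \<delta> \<alpha> \<beta> (rep F) x * fexp L (- k) x)
      - (Complex a b * (freq L k)\<^sup>2) * (LINT x|torus L. rep F x * fexp L (- k) x)"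
    unfolding integral_mult_right_zero[symmetric]
    by (rule Bochner_Integration.integral_diff[OF L2_fun_prod_integrable[OF torus_deriv_nonlin_L2(2)[OF L d] fexp_L2_fun]
          integrable_mult_right[OF L2_fun_prod_integrable[OF F fexp_L2_fun]]])
  finally show ?thesis by (simp add: mode_rhs_def fc_def diff_divide_distrib)
qed

text \<open>The existentially bound space derivative of \<open>cgl_solution\<close> becomes an
  argument, so that shifts, restrictions and the extension to a starting time can name the
  derivative they inherit.\<close>

definition cgl_data :: "real \<Rightarrow> real \<Rightarrow> real \<Rightarrow> real \<Rightarrow> real \<Rightarrow> real \<Rightarrow>
    real set \<Rightarrow> (real \<Rightarrow> (real \<Rightarrow> complex) set) \<Rightarrow> (real \<Rightarrow> (real \<Rightarrow> complex) set) \<Rightarrow> bool" where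
  "cgl_data L a b \<delta> \<alpha> \<beta> J u p \<longleftrightarrow>
     continuous_map (top_of_set J) (L2_topology (torus L)) u \<and>
     (\<forall>s\<in>J. \<forall>t\<in>J. s \<le> t \<longrightarrow>
        (AE r in lebesgue_on {s..t}. has_torus_deriv L (u r) (p r)) \<and>
        integrable (lebesgue_on {s..t}) (\<lambda>r. (L2_norm (torus L) (p r))\<^sup>2)) \<and>
     (\<forall>\<phi>\<in>smooth_periodic L. \<forall>s\<in>J. \<forall>t\<in>J. s \<le> t \<longrightarrow>
        has_bochner_integral (lebesgue_on {s..t}) (\<lambda>r. weak_integrand L a b \<delta> \<alpha> \<beta> \<phi> (u r))
          ((LINT x|torus L. rep (u t) x * \<phi> x) - (LINT x|torus L. rep (u s) x * \<phi> x)))"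

lemma cgl_solution_iff_data: "cgl_solution L a b \<delta> \<alpha> \<beta> J u \<longleftrightarrow> (\<exists>p. cgl_data L a b \<delta> \<alpha> \<beta> J u p)"
  unfolding cgl_solution_def cgl_data_def weak_integrand_def by simp

lemma cgl_dataD:
  assumes "cgl_data L a b \<delta> \<alpha> \<beta> J u p"
  shows "continuous_map (top_of_set J) (L2_topology (torus L)) u"
    "s \<in> J \<Longrightarrow> t \<in> J \<Longrightarrow> s \<le> t \<Longrightarrow> AE r in lebesgue_on {s..t}. has_torus_deriv L (u r) (p r)"
    "s \<in> J \<Longrightarrow> t \<in> J \<Longrightarrow> s \<le> t \<Longrightarrow> integrable (lebesgue_on {s..t}) (\<lambda>r. (L2_norm (torus L) (p r))\<^sup>2)"
    "\<phi> \<in> smooth_periodic L \<Longrightarrow> s \<in> J \<Longrightarrow> t \<in> J \<Longrightarrow> s \<le> t \<Longrightarrow>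
       has_bochner_integral (lebesgue_on {s..t}) (\<lambda>r. weak_integrand L a b \<delta> \<alpha> \<beta> \<phi> (u r))
         ((LINT x|torus L. rep (u t) x * \<phi> x) - (LINT x|torus L. rep (u s) x * \<phi> x))"
  using assms unfolding cgl_data_def by simp_all

lemma cgl_solution_data:
  assumes "cgl_solution L a b \<delta> \<alpha> \<beta> J u"
  obtains p where "cgl_data L a b \<delta> \<alpha> \<beta> J u p"
  using assms unfolding cgl_solution_iff_data by (elim exE)

lemma is_interval_Icc_subset:
  fixes J :: "real set"
  assumes "is_interval J" "s \<in> J" "t \<in> J"
  shows "{s..t} \<subseteq> J"
proof
  fix r assume "r \<in> {s..t}"
  then show "r \<in> J" using mem_is_interval_1_I[OF assms] by simp
qed

text \<open>The uniform bound comes from continuity on a compact interval, the mode equations from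
  testing with exponentials. The latter hold off the null set of times without a derivative, which
  the integral does not see.\<close>

lemma cgl_data_modes:
  assumes L: "L > 0" and dat: "cgl_data L a b \<delta> \<alpha> \<beta> J u p" and J: "is_interval J"
    and sJ: "s \<in> J" and tJ: "t \<in> J" and st: "s \<le> t"
  shows "cgl_modes L a b \<delta> \<alpha> \<beta> s t (\<lambda>r. rep (u r)) (\<lambda>r. rep (p r)) {r \<in> {s..t}. \<not> has_torus_deriv L (u r) (p r)}"
proof -
  let ?Z = "{r \<in> {s..t}. \<not> has_torus_deriv L (u r) (p r)}"
  note c = cgl_dataD(1)[OF dat] and ae = cgl_dataD(2)[OF dat sJ tJ st] and int = cgl_dataD(3)[OF dat sJ tJ st]
  note J = is_interval_Icc_subset[OF J sJ tJ]
  have Z: "negligible ?Z" using ae by (subst (asm) AE_lebesgue_on_iff) auto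
  have good: "has_torus_deriv L (u r) (p r)" if "r \<in> {s..t} - ?Z" for r using that by auto
  have f: "\<forall>r\<in>{s..t}. rep (u r) \<in> L2T L"
    using continuous_map_L2_mem[OF c] J by (auto intro!: rep_L2_fun)
  have M: "\<exists>M. \<forall>r\<in>{s..t}. sqT L (rep (u r)) \<le> M"
  proof -
    have "continuous_on {s..t} (\<lambda>r. sqT L (rep (u r)))"
      using continuous_on_subset[OF continuous_on_sqn_rep[OF c] J] .
    then have "bounded ((\<lambda>r. sqT L (rep (u r))) ` {s..t})"
      by (intro compact_imp_bounded compact_continuous_image) auto
    then obtain M where M: "\<forall>y\<in>(\<lambda>r. sqT L (rep (u r))) ` {s..t}. norm y \<le> M"
      unfolding bounded_iff by (elim exE)
    show ?thesis
    proof (intro exI[of _ M] ballI)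
      fix r assume "r \<in> {s..t}"
      from bspec[OF M imageI[OF this]] show "sqT L (rep (u r)) \<le> M" by simp
    qed
  qed
  have g: "\<forall>r\<in>{s..t} - ?Z. rep (p r) \<in> L2T L \<and> (\<forall>k. fc L (rep (p r)) k = \<i> * freq L k * fc L (rep (u r)) k)"
  proof (intro ballI conjI allI)
    fix r k assume "r \<in> {s..t} - ?Z"
    from good[OF this] show "rep (p r) \<in> L2T L" "fc L (rep (p r)) k = \<i> * freq L k * fc L (rep (u r)) k"
      by (simp_all add: has_torus_deriv_def rep_L2_fun fc_torus_deriv[OF L])
  qed
  have i: "(\<lambda>r. sqT L (rep (p r))) integrable_on {s..t}"
    using integrable_on_lebesgue_on[OF int] by (simp add: sqn_eq_L2_norm)
  have eqs: "((\<lambda>r. mode_rhs L a b \<delta> \<alpha> \<beta> (rep (u r)) k) has_integral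
        (fc L (rep (u y)) k - fc L (rep (u x)) k)) {x..y}" if xy: "s \<le> x" "x \<le> y" "y \<le> t" for k x y
  proof -
    have "((\<lambda>r. weak_integrand L a b \<delta> \<alpha> \<beta> (fexp L (- k)) (u r)) has_integral
      ((LINT z|torus L. rep (u y) z * fexp L (- k) z) - (LINT z|torus L. rep (u x) z * fexp L (- k) z))) {x..y}"
      using xy J by (intro has_integral_of_bochner cgl_dataD(4)[OF dat] fexp_smooth[OF L]) auto
    then have "((\<lambda>r. weak_integrand L a b \<delta> \<alpha> \<beta> (fexp L (- k)) (u r) / of_real L) has_integral
      ((LINT z|torus L. rep (u y) z * fexp L (- k) z) - (LINT z|torus L. rep (u x) z * fexp L (- k) z)) / of_real L) {x..y}"
      by (rule has_integral_divide)
    then have *: "((\<lambda>r. weak_integrand L a b \<delta> \<alpha> \<beta> (fexp L (- k)) (u r) / of_real L) has_integral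
      (fc L (rep (u y)) k - fc L (rep (u x)) k)) {x..y}"
      by (simp only: fc_def diff_divide_distrib)
    show ?thesis
    proof (rule has_integral_spike[OF Z _ *])
      fix r assume "r \<in> {x..y} - ?Z"
      then have "has_torus_deriv L (u r) (p r)" using xy by auto
      then show "mode_rhs L a b \<delta> \<alpha> \<beta> (rep (u r)) k =
         weak_integrand L a b \<delta> \<alpha> \<beta> (fexp L (- k)) (u r) / of_real L"
        by (rule weak_integrand_fexp[OF L, symmetric])
    qed
  qed
  show ?thesis unfolding cgl_modes_def
    by (intro conjI Z f M g i allI impI) (rule eqs)
qed

text \<open>The equation is autonomous. Shifts occur twice: in following the semigroup along a
  solution on the line, and in comparing a solution with its translate.\<close>

lemma cgl_data_shift:
  assumes dat: "cgl_data L a b \<delta> \<alpha> \<beta> J v p"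
  shows "cgl_data L a b \<delta> \<alpha> \<beta> {r. r + c \<in> J} (\<lambda>r. v (r + c)) (\<lambda>r. p (r + c))"
  unfolding cgl_data_def
proof (intro conjI ballI impI)
  have "continuous_map (top_of_set {r. r + c \<in> J}) (top_of_set J) (\<lambda>r. r + c)"
    by (auto intro!: continuous_intros)
  from continuous_map_compose[OF this cgl_dataD(1)[OF dat]]
  show "continuous_map (top_of_set {r. r + c \<in> J}) (L2_topology (torus L)) (\<lambda>r. v (r + c))"
    by (simp add: o_def)
qed (auto intro!: AE_shift integrable_shift has_bochner_integral_shift cgl_dataD(2-4)[OF dat])

lemma cgl_data_subset:
  assumes dat: "cgl_data L a b \<delta> \<alpha> \<beta> J v p" and I: "I \<subseteq> J"
  shows "cgl_data L a b \<delta> \<alpha> \<beta> I v p"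
  unfolding cgl_data_def
proof (intro conjI ballI impI)
  show "continuous_map (top_of_set I) (L2_topology (torus L)) v"
    using cgl_dataD(1)[OF dat] I by (rule continuous_map_from_subtopology_mono)
qed (auto intro!: cgl_dataD(2-4)[OF dat] subsetD[OF I])

section \<open>Uniqueness and the semigroup\<close>

lemma cgl_solution_unique:
  assumes L: "L > 0" and a: "a > 0"
    and u: "cgl_solution L a b \<delta> \<alpha> \<beta> {0..} u" and v: "cgl_solution L a b \<delta> \<alpha> \<beta> {0..} v"
    and init: "u 0 = v 0" and t: "t \<ge> 0"
  shows "u t = v t"
proof -
  obtain p where pd: "cgl_data L a b \<delta> \<alpha> \<beta> {0..} u p" by (rule cgl_solution_data[OF u])
  obtain q where qd: "cgl_data L a b \<delta> \<alpha> \<beta> {0..} v q" by (rule cgl_solution_data[OF v])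
  have t0: "0 \<in> {0::real..}" "t \<in> {0..}" using t by auto
  note p = cgl_dataD(1)[OF pd] cgl_data_modes[OF L pd is_interval_ci t0 t]
  note q = cgl_dataD(1)[OF qd] cgl_data_modes[OF L qd is_interval_ci t0 t]
  have mem: "u r \<in> L2 (torus L)" "v r \<in> L2 (torus L)" if "r \<ge> 0" for r
    using continuous_map_L2_mem[OF p(1)] continuous_map_L2_mem[OF q(1)] that by auto
  have "continuous_on {0..t} (\<lambda>r. (distT L (u r) (v r))\<^sup>2)"
    by (intro continuous_intros continuous_on_subset[OF continuous_on_L2_dist[OF p(1) q(1)]]) auto
  then have "sqT L (\<lambda>x. rep (u t) x - rep (v t) x) = 0"
    using init mem[of 0] L2_dist_eq_0[of "u 0" "torus L" "v 0"]
    by (intro cgl_modes_unique[OF L a t p(2) q(2)]) (auto simp: sqn_eq_L2_dist)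
  then show ?thesis using mem[OF t] by (simp add: sqn_eq_L2_dist L2_dist_eq_0)
qed

text \<open>The semigroup is a definite description, so uniqueness is what gives access to its
  value. Existence comes for free here: the required forward solution is the shifted
  \<open>v\<close>.\<close>

lemma cgl_semigroup_global:
  assumes L: "L > 0" and a: "a > 0" and v: "cgl_solution L a b \<delta> \<alpha> \<beta> UNIV v" and t: "t \<ge> 0"
  shows "cgl_semigroup L a b \<delta> \<alpha> \<beta> t (v r) = v (r + t)"
  unfolding cgl_semigroup_def
proof (rule the_equality)
  obtain p where "cgl_data L a b \<delta> \<alpha> \<beta> UNIV v p" by (rule cgl_solution_data[OF v])
  from cgl_data_shift[OF this, of r]
  have "cgl_data L a b \<delta> \<alpha> \<beta> {0..} (\<lambda>s. v (s + r)) (\<lambda>s. p (s + r))" by (rule cgl_data_subset) auto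
  then have sh: "cgl_solution L a b \<delta> \<alpha> \<beta> {0..} (\<lambda>s. v (s + r))"
    unfolding cgl_solution_iff_data by (rule exI[of _ "\<lambda>s. p (s + r)"])
  show "\<exists>u. cgl_solution L a b \<delta> \<alpha> \<beta> {0..} u \<and> u 0 = v r \<and> u t = v (r + t)"
    using sh by (intro exI[of _ "\<lambda>s. v (s + r)"]) (auto simp: add.commute)
  fix G assume "\<exists>u. cgl_solution L a b \<delta> \<alpha> \<beta> {0..} u \<and> u 0 = v r \<and> u t = G"
  then obtain u where u: "cgl_solution L a b \<delta> \<alpha> \<beta> {0..} u" "u 0 = v r" "u t = G" by blast
  have "u t = v (t + r)"
    by (rule cgl_solution_unique[OF L a u(1) sh _ t]) (simp add: u(2))
  then show "G = v (r + t)" using u(3) by (simp add: add.commute)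
qed

section \<open>Backward blow-up and the attractor\<close>

text \<open>Suppose the value at t exceeds m. Backward in time the function grows at least like a
  solution of y' = -k y^2, and passing from a level Y to 2 Y takes time at most 1/(k Y). These
  doubling times form a convergent geometric series, so the function would exceed every bound at one
  fixed earlier time.\<close>

lemma backward_blowup_bound:
  fixes y :: "real \<Rightarrow> real"
  assumes cont: "continuous_on UNIV y" and c: "c > 0" and m: "m \<ge> 0"
    and le: "\<And>s t. s \<le> t \<Longrightarrow> y t - y s \<le> integral {s..t} (\<lambda>r. - c * y r * (y r - m))"
  shows "y t \<le> m"
proof (rule ccontr)
  assume "\<not> y t \<le> m"
  \<comment> \<open>A level strictly between m and \<open>y t\<close>: the strict gap to m makes the
    rate \<open>k\<close> below positive.\<close>
  define y1 where "y1 = (m + y t) / 2"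
  have y1: "m < y1" "y1 < y t" using \<open>\<not> y t \<le> m\<close> by (auto simp: y1_def)
  have ci: "continuous_on {s..t} (\<lambda>r. - c * y r * (y r - m))" for s t
    by (intro continuous_intros continuous_on_subset[OF cont]) auto
  have above: "y s > y1" if s: "s \<le> t" for s
  proof (rule ccontr)
    assume "\<not> y s > y1"
    \<comment> \<open>The last time before t at which the function is at most \<open>y1\<close>.
      After it the integrand is nonpositive, so \<open>y\<close> could not have risen to
      \<open>y t\<close>.\<close>
    define S where "S = {r \<in> {s..t}. y r \<le> y1}"
    have "S = {s..t} \<inter> {r. y r \<le> y1}" by (auto simp: S_def)
    then have "compact S"
      using closed_Collect_le[OF cont continuous_on_const] by (simp add: compact_Int_closed)
    moreover have "s \<in> S" using s \<open>\<not> y s > y1\<close> by (auto simp: S_def)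
    ultimately obtain s1 where s1: "s1 \<in> S" "\<And>r. r \<in> S \<Longrightarrow> r \<le> s1"
      using compact_attains_sup[of S] by blast
    then have s1t: "s1 \<le> t" "y s1 \<le> y1" by (auto simp: S_def)
    have "y t - y s1 \<le> integral {s1..t} (\<lambda>r. - c * y r * (y r - m))" by (rule le[OF s1t(1)])
    also have "\<dots> \<le> 0"
    proof (rule has_integral_le_ae[where Z = "{s1}"])
      show "((\<lambda>r. - c * y r * (y r - m)) has_integral integral {s1..t} (\<lambda>r. - c * y r * (y r - m))) {s1..t}"
        by (intro integrable_integral integrable_continuous_real ci)
      show "((\<lambda>r. 0) has_integral 0) {s1..t}" by simp
      fix r assume r: "r \<in> {s1..t} - {s1}"
      have "r \<notin> S" using s1(2)[of r] r by auto
      then have "y r > y1" using r s1(1) by (auto simp: S_def)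
      then have "0 \<le> c * (y r * (y r - m))" using c m y1 by (intro mult_nonneg_nonneg) auto
      then show "- c * y r * (y r - m) \<le> 0" by (simp add: mult.assoc)
    qed simp
    finally show False using s1t y1 by simp
  qed
  \<comment> \<open>Above the level \<open>y1\<close> one has y - m >= (1 - m / y1) y, so the
    damping c y (y - m) is at least k y^2.\<close>
  define k where "k = c * (1 - m / y1)"
  have y1p: "y1 > 0" using m y1 by simp
  have k: "k > 0" using c y1 y1p by (simp add: k_def)
  define A where "A = 1 / (k * y1)"
  have A: "A > 0" using k y1p by (simp add: A_def)
  have step: "2 * Y \<le> y s" if Y: "Y > 0" "\<And>r. r \<le> \<tau> \<Longrightarrow> Y \<le> y r" and \<tau>: "\<tau> \<le> t" and s: "s \<le> \<tau> - 1 / (k * Y)" for Y \<tau> s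
  proof -
    have "0 < 1 / (k * Y)" using k Y(1) by simp
    then have s\<tau>: "s \<le> \<tau>" using s by linarith
    have "y \<tau> - y s \<le> integral {s..\<tau>} (\<lambda>r. - c * y r * (y r - m))" by (rule le[OF s\<tau>])
    also have "\<dots> \<le> - k * Y\<^sup>2 * (\<tau> - s)"
    proof (rule has_integral_le)
      show "((\<lambda>r. - c * y r * (y r - m)) has_integral integral {s..\<tau>} (\<lambda>r. - c * y r * (y r - m))) {s..\<tau>}"
        by (intro integrable_integral integrable_continuous_real ci)
      show "((\<lambda>r. - k * Y\<^sup>2) has_integral - k * Y\<^sup>2 * (\<tau> - s)) {s..\<tau>}"
        using has_integral_const_real[of "- k * Y\<^sup>2" s \<tau>] s\<tau> by (simp add: mult.commute)
      fix r assume r: "r \<in> {s..\<tau>}"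
      have yr: "y r > y1" "y r \<ge> Y" using above[of r] Y(2)[of r] r \<tau> by auto
      have "m / y1 * y r \<ge> m" using yr(1) y1p m mult_left_mono[of y1 "y r" m] by (simp add: field_simps)
      then have "(1 - m / y1) * y r \<le> y r - m" by (simp add: left_diff_distrib)
      then have "c * y r * ((1 - m / y1) * y r) \<le> c * y r * (y r - m)"
        using c yr y1p by (intro mult_left_mono) auto
      moreover have "k * Y\<^sup>2 \<le> k * (y r)\<^sup>2"
        using yr Y(1) k by (intro mult_left_mono power_mono) auto
      moreover have "c * y r * ((1 - m / y1) * y r) = k * (y r)\<^sup>2"
        by (simp add: k_def power2_eq_square)
      ultimately show "- c * y r * (y r - m) \<le> - k * Y\<^sup>2" by simp
    qed
    finally have "y s \<ge> y \<tau> + k * Y\<^sup>2 * (\<tau> - s)" by simp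
    moreover have "k * Y\<^sup>2 * (\<tau> - s) \<ge> k * Y\<^sup>2 * (1 / (k * Y))"
      using s k by (intro mult_left_mono) auto
    moreover have "k * Y\<^sup>2 * (1 / (k * Y)) = Y" using k Y(1) by (simp add: power2_eq_square)
    ultimately show ?thesis using Y(2)[of \<tau>] by simp
  qed
  \<comment> \<open>\<open>A\<close> is the time for the first doubling, starting from
    \<open>y1\<close>; the first n doublings take A (1 + 1/2 + ... + 1/2^(n-1)) = A (2 - 2 /
    2^n).\<close>
  have iter: "2 ^ n * y1 \<le> y s" if "s \<le> t - A * (2 - 2 / 2 ^ n)" for n s
    using that
  proof (induction n arbitrary: s)
    case 0
    then show ?case using above[of s] by simp
  next
    case (Suc n)
    have "2 * (2 ^ n * y1) \<le> y s"
    proof (rule step[where \<tau> = "t - A * (2 - 2 / 2 ^ n)"])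
      have "(2::real) / 2 ^ n \<le> 2" by (simp add: field_simps)
      then show "t - A * (2 - 2 / 2 ^ n) \<le> t" using A by simp
      have "1 / (k * (2 ^ n * y1)) = A / 2 ^ n" by (simp add: A_def field_simps)
      then show "s \<le> t - A * (2 - 2 / 2 ^ n) - 1 / (k * (2 ^ n * y1))"
        using Suc.prems by (simp add: algebra_simps)
    qed (use y1p Suc.IH in auto)
    then show ?case by simp
  qed
  have "2 ^ n * y1 \<le> y (t - A * 2)" for n
    by (rule iter) (use A in simp)
  moreover obtain n where "y (t - A * 2) / y1 < 2 ^ n"
    using real_arch_pow[of 2] by auto
  ultimately show False using y1p by (simp add: pos_divide_less_eq) (meson not_le)
qed

lemma cgl_energy_integral:
  assumes L: "L > 0" and a: "a > 0" and \<alpha>: "\<alpha> > 0" and st: "s \<le> t"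
    and sol: "cgl_modes L a b \<delta> \<alpha> \<beta> s t f g Z"
    and cont: "continuous_on {s..t} (\<lambda>r. sqT L (f r))"
  shows "sqT L (f t) - sqT L (f s) + 2 * a * integral {s..t} (\<lambda>r. sqT L (g r)) \<le>
     integral {s..t} (\<lambda>r. 2 * \<delta> * sqT L (f r) - (2 * \<alpha> / L) * (sqT L (f r))\<^sup>2)"
proof -
  obtain E where E: "(E has_integral (sqT L (f t) - sqT L (f s))) {s..t}"
    and Eb: "\<And>r. r \<in> {s..t} - Z \<Longrightarrow> E r + 2 * a * sqT L (g r) \<le>
       2 * \<delta> * sqT L (f r) - (2 * \<alpha> / L) * (sqT L (f r))\<^sup>2"
    using cgl_energy_inequality[OF L \<alpha> st sol] by (elim exE conjE) simp
  show ?thesis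
  proof (rule has_integral_le_ae[OF _ _ cgl_modesD(1)[OF sol] Eb])
    show "((\<lambda>r. E r + 2 * a * sqT L (g r)) has_integral
      (sqT L (f t) - sqT L (f s) + 2 * a * integral {s..t} (\<lambda>r. sqT L (g r)))) {s..t}"
      by (intro has_integral_add E has_integral_mult_right integrable_integral cgl_modesD(5)[OF sol])
    show "((\<lambda>r. 2 * \<delta> * sqT L (f r) - (2 * \<alpha> / L) * (sqT L (f r))\<^sup>2) has_integral
       integral {s..t} (\<lambda>r. 2 * \<delta> * sqT L (f r) - (2 * \<alpha> / L) * (sqT L (f r))\<^sup>2)) {s..t}"
      by (intro integrable_integral integrable_continuous_real continuous_intros cont)
  qed
qed

text \<open>With c = 2 \<open>\<alpha>\<close> / L the right-hand side of the energy inequality is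
  -c y (y - \<open>\<delta>\<close> L / \<open>\<alpha>\<close>), which locates the threshold. The
  maximum with 0 covers negative \<open>\<delta>\<close> and supplies the sign that the blow-up
  argument asks for.\<close>

lemma cgl_global_bounded:
  assumes L: "L > 0" and a: "a > 0" and \<alpha>: "\<alpha> > 0"
    and v: "cgl_solution L a b \<delta> \<alpha> \<beta> UNIV v"
  shows "sqT L (rep (v t)) \<le> max 0 (\<delta> * L / \<alpha>)"
proof -
  obtain p where dat: "cgl_data L a b \<delta> \<alpha> \<beta> UNIV v p" by (rule cgl_solution_data[OF v])
  note c = cgl_dataD(1)[OF dat] and p = cgl_data_modes[OF L dat is_interval_univ UNIV_I UNIV_I]
  define y where "y r = sqT L (rep (v r))" for r
  have yc: "continuous_on UNIV y" unfolding y_def by (rule continuous_on_sqn_rep[OF c])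
  have y0: "y r \<ge> 0" for r by (simp add: y_def)
  define m where "m = max 0 (\<delta> * L / \<alpha>)"
  define c where "c = 2 * \<alpha> / L"
  have "y t \<le> m"
  proof (rule backward_blowup_bound[OF yc])
    show "c > 0" using L \<alpha> by (simp add: c_def)
    fix s t :: real assume st: "s \<le> t"
    have ys: "continuous_on {s..t} y" using yc continuous_on_subset by blast
    have "y t - y s + 2 * a * integral {s..t} (\<lambda>r. sqT L (rep (p r))) \<le>
      integral {s..t} (\<lambda>r. 2 * \<delta> * y r - c * (y r)\<^sup>2)"
      using cgl_energy_integral[OF L a \<alpha> st p[OF st] ys[unfolded y_def]] unfolding y_def c_def .
    moreover have "0 \<le> 2 * a * integral {s..t} (\<lambda>r. sqT L (rep (p r)))"
      using a by (intro mult_nonneg_nonneg integral_nonneg cgl_modesD(5)[OF p[OF st]]) auto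
    moreover have "integral {s..t} (\<lambda>r. 2 * \<delta> * y r - c * (y r)\<^sup>2) \<le> integral {s..t} (\<lambda>r. - c * y r * (y r - m))"
    proof (rule integral_le)
      show "(\<lambda>r. 2 * \<delta> * y r - c * (y r)\<^sup>2) integrable_on {s..t}"
        by (intro integrable_continuous_real continuous_intros ys)
      show "(\<lambda>r. - c * y r * (y r - m)) integrable_on {s..t}"
        by (intro integrable_continuous_real continuous_intros ys)
      fix r
      have "2 * \<delta> = c * (\<delta> * L / \<alpha>)" using L \<alpha> by (simp add: c_def)
      also have "\<dots> \<le> c * m" using L \<alpha> by (intro mult_left_mono) (auto simp: c_def m_def)
      finally have "2 * \<delta> * y r \<le> c * m * y r" using y0 by (intro mult_right_mono) auto
      then show "2 * \<delta> * y r - c * (y r)\<^sup>2 \<le> - c * y r * (y r - m)"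
        by (simp add: algebra_simps power2_eq_square)
    qed
    ultimately show "y t - y s \<le> integral {s..t} (\<lambda>r. - c * y r * (y r - m))" by linarith
  qed (simp add: m_def)
  then show ?thesis by (simp add: y_def m_def)
qed

text \<open>The point \<open>v t\<close> is the image of \<open>v (t - \<tau>)\<close> under the
  semigroup for every \<open>\<tau>\<close>, and all these starting points lie in one bounded set.
  Uniform attraction at a single large time therefore already contradicts a positive distance to the
  closed set \<open>A\<close>.\<close>

lemma cgl_global_in_attractor:
  assumes L: "L > 0" and a: "a > 0" and \<alpha>: "\<alpha> > 0"
    and v: "cgl_solution L a b \<delta> \<alpha> \<beta> UNIV v"
    and A: "cgl_global_attractor L a b \<delta> \<alpha> \<beta> A"
  shows "v t \<in> A"
proof (rule ccontr)
  assume t: "v t \<notin> A"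
  have mem: "v r \<in> L2 (torus L)" for r
    using continuous_map_L2_mem[of UNIV "torus L" v r] v unfolding cgl_solution_def by blast
  interpret Metric_space "L2 (torus L)" "distT L" by (rule Metric_space_L2)
  have cA: "compactin mtopology A"
    using A unfolding cgl_global_attractor_def by (elim conjE)
  have "closedin mtopology A"
    by (rule compactin_imp_closedin[OF Hausdorff_space_mtopology cA])
  then have "openin mtopology (L2 (torus L) - A)" by (simp add: closedin_def)
  then obtain e where e: "e > 0" "mball (v t) e \<subseteq> L2 (torus L) - A"
    using mem[of t] t unfolding openin_mtopology by blast
  have bd: "L2_norm (torus L) (v r) \<le> sqrt (max 0 (\<delta> * L / \<alpha>))" for r
    using cgl_global_bounded[OF L a \<alpha> v, of r] unfolding L2_norm_sqn by simp
  have "distT L (v r) (v s) \<le> 2 * sqrt (max 0 (\<delta> * L / \<alpha>))" for r s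
    using sqn_triangle_diff[OF rep_L2_fun[OF mem[of r]] rep_L2_fun[OF mem[of s]]] bd[of r] bd[of s]
    unfolding L2_norm_sqn L2_dist_sqn by linarith
  then have bounded: "mbounded (range v)"
    unfolding mbounded_alt using mem
    by (intro conjI exI[of _ "2 * sqrt (max 0 (\<delta> * L / \<alpha>))"]) auto
  have "\<forall>B. mbounded B \<longrightarrow> (\<forall>\<epsilon>>0. \<forall>\<^sub>F t in at_top. \<forall>F\<in>B. \<exists>G\<in>A.
      distT L (cgl_semigroup L a b \<delta> \<alpha> \<beta> t F) G < \<epsilon>)"
    using A unfolding cgl_global_attractor_def by (elim conjE)
  from this[THEN spec, THEN mp, OF bounded, THEN spec, THEN mp, OF e(1)]
  have "\<forall>\<^sub>F \<tau> in at_top. \<forall>F\<in>range v. \<exists>G\<in>A. distT L (cgl_semigroup L a b \<delta> \<alpha> \<beta> \<tau> F) G < e" .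
  then obtain N where N: "\<forall>\<tau>\<ge>N. \<forall>F\<in>range v. \<exists>G\<in>A. distT L (cgl_semigroup L a b \<delta> \<alpha> \<beta> \<tau> F) G < e"
    unfolding eventually_at_top_linorder by (elim exE)
  \<comment> \<open>The attraction time N may be negative, while the semigroup identity concerns
    nonnegative times.\<close>
  define \<tau> where "\<tau> = max N 0"
  have \<tau>: "\<tau> \<ge> 0" "\<tau> \<ge> N" by (simp_all add: \<tau>_def)
  obtain G where G: "G \<in> A" "distT L (cgl_semigroup L a b \<delta> \<alpha> \<beta> \<tau> (v (t - \<tau>))) G < e"
    using N[rule_format, OF \<tau>(2) rangeI[of v "t - \<tau>"]] by (elim bexE)
  have "cgl_semigroup L a b \<delta> \<alpha> \<beta> \<tau> (v (t - \<tau>)) = v t"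
    using cgl_semigroup_global[OF L a v \<tau>(1), of "t - \<tau>"] by simp
  then have "distT L (v t) G < e" using G(2) by simp
  moreover have "G \<in> L2 (torus L)"
    using compactin_subset_topspace[OF cA] G(1) by (simp add: subset_iff)
  ultimately have "G \<in> mball (v t) e" using mem by simp
  then show False using e(2) G(1) by auto
qed

section \<open>Solutions on an open half-line\<close>

text \<open>Riesz-Fischer: on a space of finite mass a Cauchy sequence in L2 is Cauchy in L1, so a
  subsequence converges almost everywhere. Fatou's lemma along this subsequence bounds the L2
  distance of every late term to the pointwise limit.\<close>

lemma L2_complete:
  assumes L: "L > 0" and F: "\<And>n. F n \<in> L2 (torus L)"
    and Cauchy: "\<And>e. e > 0 \<Longrightarrow> \<exists>N. \<forall>m\<ge>N. \<forall>n\<ge>N. distT L (F m) (F n) < e"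
  shows "\<exists>G\<in>L2 (torus L). (\<lambda>n. distT L (F n) G) \<longlonglongrightarrow> 0"
proof -
  let ?M = "torus L"
  define f where "f n = rep (F n)" for n :: nat
  have f: "f n \<in> L2_fun ?M" for n unfolding f_def by (rule rep_L2_fun[OF F])
  have fm[measurable]: "f n \<in> borel_measurable ?M" for n by (rule L2_fun_measurable[OF f])
  have dist: "L2_dist ?M (F m) (F n) = sqrt (sqn ?M (\<lambda>x. f m x - f n x))" for m n
    by (simp add: L2_dist_sqn f_def)
  obtain r where r: "strict_mono r" "AE x in ?M. Cauchy (\<lambda>i. f (r i) x)"
  proof (rule cauchy_L1_AE_cauchy_subseq[of ?M f])
    show "integrable ?M (f n)" for n by (rule L2_fun_L1_bound(1)[OF L f])
    fix e :: real assume e: "e > 0"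
    then have eL: "e / sqrt L > 0" using L by simp
    obtain N where N: "\<forall>m\<ge>N. \<forall>n\<ge>N. L2_dist ?M (F m) (F n) < e / sqrt L"
      using Cauchy[OF eL] by (elim exE)
    have "(LINT x|?M. norm (f i x - f j x)) < e" if ij: "i \<ge> N" "j \<ge> N" for i j
    proof -
      have "(LINT x|?M. norm (f i x - f j x)) \<le> sqrt L * L2_dist ?M (F i) (F j)"
        unfolding dist by (rule L2_fun_L1_bound(2)[OF L L2_fun_diff[OF f f]])
      also have "\<dots> < sqrt L * (e / sqrt L)"
        using N[rule_format, OF ij] L by (intro mult_strict_left_mono) auto
      finally show ?thesis using L by simp
    qed
    then show "\<exists>N. \<forall>i\<ge>N. \<forall>j\<ge>N. (LINT x|?M. norm (f i x - f j x)) < e"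
      by (intro exI[of _ N] allI impI)
  qed
  define g where "g x = lim (\<lambda>i. f (r i) x)" for x
  have gm[measurable]: "g \<in> borel_measurable ?M"
    unfolding g_def by measurable
  have lim: "AE x in ?M. (\<lambda>i. f (r i) x) \<longlonglongrightarrow> g x"
    using r(2) by eventually_elim (simp add: g_def Cauchy_convergent convergent_LIMSEQ_iff[symmetric])
  have close: "(\<lambda>x. f n x - g x) \<in> L2_fun ?M \<and> sqn ?M (\<lambda>x. f n x - g x) \<le> e\<^sup>2"
    if N: "\<forall>m\<ge>N. \<forall>n\<ge>N. L2_dist ?M (F m) (F n) < e" and n: "n \<ge> N" for e n N
  proof -
    have "(\<integral>\<^sup>+x. ennreal ((norm (f n x - g x))\<^sup>2) \<partial>?M) 
        \<le> (\<integral>\<^sup>+x. liminf (\<lambda>i. ennreal ((norm (f n x - f (r i) x))\<^sup>2)) \<partial>?M)"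
    proof (rule nn_integral_mono_AE)
      show "AE x in ?M. ennreal ((norm (f n x - g x))\<^sup>2) \<le> liminf (\<lambda>i. ennreal ((norm (f n x - f (r i) x))\<^sup>2))"
        using lim
      proof eventually_elim
        case (elim x)
        have "(\<lambda>i. ennreal ((norm (f n x - f (r i) x))\<^sup>2)) \<longlonglongrightarrow> ennreal ((norm (f n x - g x))\<^sup>2)"
          by (intro tendsto_ennrealI tendsto_intros elim)
        from lim_imp_Liminf[OF _ this] show ?case by simp
      qed
    qed
    also have "\<dots> \<le> liminf (\<lambda>i. \<integral>\<^sup>+x. ennreal ((norm (f n x - f (r i) x))\<^sup>2) \<partial>?M)"
      by (rule nn_integral_liminf) measurable
    also have "\<dots> \<le> liminf (\<lambda>i::nat. ennreal (e\<^sup>2))"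
    proof (rule Liminf_mono)
      have "(\<integral>\<^sup>+x. ennreal ((norm (f n x - f (r i) x))\<^sup>2) \<partial>?M) \<le> ennreal (e\<^sup>2)" if i: "i \<ge> N" for i
      proof -
        have ri: "r i \<ge> N" using i seq_suble[OF r(1), of i] by simp
        have "(\<integral>\<^sup>+x. ennreal ((norm (f n x - f (r i) x))\<^sup>2) \<partial>?M) = ennreal (sqn ?M (\<lambda>x. f n x - f (r i) x))"
          unfolding sqn_def by (rule nn_integral_eq_integral[OF L2_fun_integrable_sq[OF L2_fun_diff[OF f f]]]) simp
        moreover have "sqn ?M (\<lambda>x. f n x - f (r i) x) \<le> e\<^sup>2"
          using N[rule_format, OF n ri] unfolding dist by (intro sqrt_le_D less_imp_le)
        ultimately show ?thesis by (simp add: ennreal_leI)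
      qed
      then show "\<forall>\<^sub>F i in sequentially. (\<integral>\<^sup>+x. ennreal ((norm (f n x - f (r i) x))\<^sup>2) \<partial>?M) \<le> ennreal (e\<^sup>2)"
        unfolding eventually_sequentially by (intro exI[of _ N] allI impI)
    qed
    also have "\<dots> = ennreal (e\<^sup>2)" by (simp add: Liminf_const)
    finally have le: "(\<integral>\<^sup>+x. ennreal ((norm (f n x - g x))\<^sup>2) \<partial>?M) \<le> ennreal (e\<^sup>2)" .
    have int: "integrable ?M (\<lambda>x. (norm (f n x - g x))\<^sup>2)"
    proof (rule integrableI_bounded)
      show "(\<integral>\<^sup>+x. ennreal (norm ((norm (f n x - g x))\<^sup>2)) \<partial>?M) < \<infinity>"
        using le by (simp add: order_le_less_trans)
    qed measurable
    have "ennreal (sqn ?M (\<lambda>x. f n x - g x)) \<le> ennreal (e\<^sup>2)"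
      using le nn_integral_eq_integral[OF int] by (simp add: sqn_def)
    then have "sqn ?M (\<lambda>x. f n x - g x) \<le> e\<^sup>2" by simp
    then show ?thesis using int by (simp add: L2_fun_def)
  qed
  \<comment> \<open>So far \<open>g\<close> is only a pointwise limit; it belongs to L2 because it
    differs from one term of the sequence by an L2 function.\<close>
  obtain N1 where "\<forall>m\<ge>N1. \<forall>n\<ge>N1. L2_dist ?M (F m) (F n) < 1"
    using Cauchy[OF zero_less_one] by (elim exE)
  from close[OF this order_refl] have "(\<lambda>x. f N1 x - g x) \<in> L2_fun ?M" by simp
  from L2_fun_diff[OF f[of N1] this] have g: "g \<in> L2_fun ?M" by simp
  define G where "G = L2_rel ?M `` {g}"
  have G: "G \<in> L2 ?M" unfolding G_def L2_def by (rule quotientI[OF g])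
  have "(g, rep G) \<in> L2_rel ?M" using rep_in[OF G] by (simp add: G_def)
  then have gG: "AE x in ?M. g x = rep G x" by (simp add: L2_rel_def)
  have dG: "L2_dist ?M (F n) G = sqrt (sqn ?M (\<lambda>x. f n x - g x))" for n
  proof -
    have "AE x in ?M. rep (F n) x - rep G x = f n x - g x"
      using gG by eventually_elim (simp add: f_def)
    from sqn_cong_AE[OF L2_fun_diff[OF rep_L2_fun[OF F] rep_L2_fun[OF G]] L2_fun_diff[OF f g] this]
    show ?thesis by (simp add: L2_dist_sqn)
  qed
  have "(\<lambda>n. L2_dist ?M (F n) G) \<longlonglongrightarrow> 0"
  proof (rule LIMSEQ_I)
    fix e :: real assume e: "e > 0"
    obtain N where N: "\<forall>m\<ge>N. \<forall>n\<ge>N. L2_dist ?M (F m) (F n) < e / 2"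
      using Cauchy[OF half_gt_zero[OF e]] by (elim exE)
    have "norm (L2_dist ?M (F n) G - 0) < e" if "n \<ge> N" for n
    proof -
      have "L2_dist ?M (F n) G \<le> sqrt ((e / 2)\<^sup>2)"
        unfolding dG using close[OF N that] by (intro real_sqrt_le_mono) simp
      then show ?thesis using e by simp
    qed
    then show "\<exists>N. \<forall>n\<ge>N. norm (L2_dist ?M (F n) G - 0) < e"
      by (intro exI[of _ N] allI impI)
  qed
  then show ?thesis using G by (intro bexI[of _ G])
qed

text \<open>The situation in which norm blow-up at T fails. \<open>recur\<close> is the negation of
  divergence to infinity in usable form: there are states of norm below a fixed \<open>K0\<close>
  arbitrarily close to T.\<close>

locale cgl_open_start =
  fixes L a b \<delta> \<alpha> \<beta> T :: real and v p :: "real \<Rightarrow> (real \<Rightarrow> complex) set" and K0 :: real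
  assumes L: "L > 0" and a: "a > 0" and \<alpha>: "\<alpha> > 0"
    and dat: "cgl_data L a b \<delta> \<alpha> \<beta> {T<..} v p"
    and recur: "\<And>r. T < r \<Longrightarrow> \<exists>s. T < s \<and> s < r \<and> L2_norm (torus L) (v s) < K0"
begin

lemmas cont = cgl_dataD(1)[OF dat]

definition y where "y r = sqT L (rep (v r))"

definition P where "P r = sqT L (rep (p r))"

lemma y_nonneg: "0 \<le> y r" by (simp add: y_def)

lemma P_nonneg: "0 \<le> P r" by (simp add: P_def)

lemma mem: "T < r \<Longrightarrow> v r \<in> L2 (torus L)"
  using continuous_map_L2_mem[OF cont] by simp

lemma modes:
  assumes "T < s" "s \<le> t"
  shows "cgl_modes L a b \<delta> \<alpha> \<beta> s t (\<lambda>r. rep (v r)) (\<lambda>r. rep (p r)) {r \<in> {s..t}. \<not> has_torus_deriv L (v r) (p r)}"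
  using assms by (intro cgl_data_modes[OF L dat is_interval_oi]) auto

lemma modes_shift:
  assumes "T < s" "s \<le> t" "0 \<le> h"
  shows "cgl_modes L a b \<delta> \<alpha> \<beta> s t (\<lambda>r. rep (v (r + h))) (\<lambda>r. rep (p (r + h)))
     {r \<in> {s..t}. \<not> has_torus_deriv L (v (r + h)) (p (r + h))}"
proof (rule cgl_data_modes[OF L _ is_interval_oi[of T]])
  have "{T<..} \<subseteq> {r. r + h \<in> {T<..}}" using assms(3) by auto
  from cgl_data_subset[OF cgl_data_shift[OF dat] this]
  show "cgl_data L a b \<delta> \<alpha> \<beta> {T<..} (\<lambda>r. v (r + h)) (\<lambda>r. p (r + h))" .
qed (use assms in auto)

lemma P_integrable: "T < s \<Longrightarrow> s \<le> t \<Longrightarrow> P integrable_on {s..t}"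
  using cgl_modesD(5)[OF modes[of s t]] by (simp add: P_def[abs_def])

text \<open>The maximum over y of 2 \<open>\<delta>\<close> y - (2 \<open>\<alpha>\<close> / L) y^2,
  found by completing the square; it bounds the forward growth of the energy whatever its
  size.\<close>

definition \<kappa> where "\<kappa> = \<delta>\<^sup>2 / (2 * \<alpha> / L)"

lemma \<kappa>_nonneg: "0 \<le> \<kappa>" using L \<alpha> by (simp add: \<kappa>_def)

lemma energy_step:
  assumes "T < s" "s \<le> t"
  shows "y t - y s + 2 * a * integral {s..t} P \<le> \<kappa> * (t - s)"
proof -
  let ?c = "2 * \<alpha> / L"
  have c: "?c > 0" using L \<alpha> by simp
  have yc: "continuous_on {s..t} y"
    using continuous_on_subset[OF continuous_on_sqn_rep[OF cont], of "{s..t}"] assms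
    by (simp add: y_def[abs_def] subset_iff)
  have "y t - y s + 2 * a * integral {s..t} P \<le> integral {s..t} (\<lambda>r. 2 * \<delta> * y r - ?c * (y r)\<^sup>2)"
    using cgl_energy_integral[OF L a \<alpha> assms(2) modes[OF assms] yc[unfolded y_def]]
    unfolding y_def P_def .
  also have "\<dots> \<le> integral {s..t} (\<lambda>r. \<kappa>)"
  proof (rule integral_le)
    show "(\<lambda>r. 2 * \<delta> * y r - ?c * (y r)\<^sup>2) integrable_on {s..t}"
      by (intro integrable_continuous_real continuous_intros yc)
    fix r
    have sq: "c * (z - \<delta> / c)\<^sup>2 = c * z\<^sup>2 - 2 * \<delta> * z + \<delta>\<^sup>2 / c" if "c > 0" for c z :: real
      using that by (simp add: power2_eq_square field_simps)
    have "0 \<le> ?c * (y r - \<delta> / ?c)\<^sup>2"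
      by (rule mult_nonneg_nonneg[OF less_imp_le[OF c] zero_le_power2])
    also have "\<dots> = ?c * (y r)\<^sup>2 - 2 * \<delta> * y r + \<kappa>"
      unfolding \<kappa>_def by (rule sq[OF c])
    finally show "2 * \<delta> * y r - ?c * (y r)\<^sup>2 \<le> \<kappa>" by simp
  qed auto
  also have "\<dots> = \<kappa> * (t - s)" using assms by (simp add: mult.commute)
  finally show ?thesis .
qed

text \<open>Before any time r lies a time with norm below \<open>K0\<close>, and from there the
  energy grows at most at rate \<open>\<kappa>\<close> until r.\<close>

lemma y_bounded: "\<exists>M\<ge>0. \<forall>r. T < r \<longrightarrow> r \<le> \<tau> \<longrightarrow> y r \<le> M"
proof (intro exI[of _ "K0\<^sup>2 + \<kappa> * \<bar>\<tau> - T\<bar>"] conjI allI impI)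
  show "0 \<le> K0\<^sup>2 + \<kappa> * \<bar>\<tau> - T\<bar>" using \<kappa>_nonneg by simp
  fix r assume r: "T < r" "r \<le> \<tau>"
  obtain s where s: "T < s" "s < r" "L2_norm (torus L) (v s) < K0"
    using recur[OF r(1)] by (elim exE conjE)
  have "y s \<le> K0\<^sup>2"
    unfolding y_def sqn_eq_L2_norm using s(3) by (intro power_mono) auto
  moreover have "y r - y s + 2 * a * integral {s..r} P \<le> \<kappa> * (r - s)"
    using s by (intro energy_step) auto
  moreover have "0 \<le> 2 * a * integral {s..r} P"
    using a P_nonneg s by (intro mult_nonneg_nonneg integral_nonneg P_integrable) auto
  moreover have "\<kappa> * (r - s) \<le> \<kappa> * \<bar>\<tau> - T\<bar>"
    using \<kappa>_nonneg r s by (intro mult_left_mono) auto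
  ultimately show "y r \<le> K0\<^sup>2 + \<kappa> * \<bar>\<tau> - T\<bar>" by linarith
qed

text \<open>The energy inequality bounds the integrals of \<open>P\<close> over intervals
  approaching T uniformly, because the energy at their left ends is bounded; \<open>P\<close> is
  nonnegative, so monotone convergence applies.\<close>

lemma P_integrable_start: "P integrable_on {T..\<tau>}"
proof (cases "T < \<tau>")
  case False
  then have "{T..\<tau>} \<subseteq> {T}" by auto
  then have "negligible {T..\<tau>}" by (rule negligible_subset[OF negligible_sing])
  then show ?thesis using absolutely_integrable_negligible set_lebesgue_integral_eq_integral(1) by metis
next
  case True
  obtain M where M: "M \<ge> 0" "\<forall>r. T < r \<longrightarrow> r \<le> \<tau> \<longrightarrow> y r \<le> M"
    using y_bounded[of \<tau>] by (elim exE conjE)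
  define s where "s n = T + (\<tau> - T) / real (Suc n)" for n
  have s: "T < s n" "s n \<le> \<tau>" for n
  proof -
    have "(\<tau> - T) / real (Suc n) \<le> (\<tau> - T) / 1" using True by (intro divide_left_mono) auto
    then show "s n \<le> \<tau>" by (simp add: s_def)
    show "T < s n" using True by (simp add: s_def)
  qed
  have s_dec: "s (Suc n) \<le> s n" for n
    using True by (auto simp: s_def intro!: divide_left_mono)
  have "(\<lambda>n. T + (\<tau> - T) / real (Suc n)) \<longlonglongrightarrow> T + 0"
    by (rule tendsto_add[OF tendsto_const LIMSEQ_Suc[OF lim_const_over_n]])
  then have s_lim: "s \<longlonglongrightarrow> T" by (simp add: s_def[abs_def])
  define f where "f n r = (if r \<in> {s n..\<tau>} then P r else 0)" for n r
  have int_eq: "{s n..\<tau>} \<inter> {T..\<tau>} = {s n..\<tau>}" for n using s[of n] by auto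
  have fi: "f n integrable_on {T..\<tau>}" for n
    unfolding f_def[abs_def] integrable_restrict_Int int_eq by (rule P_integrable[OF s])
  have fI: "integral {T..\<tau>} (f n) = integral {s n..\<tau>} P" for n
    unfolding f_def[abs_def] Henstock_Kurzweil_Integration.integral_restrict_Int int_eq ..
  \<comment> \<open>The truncations all vanish at T, since every left end is beyond T, so their
    limit there is 0 whatever \<open>P T\<close> may be. The single point is exchanged at the
    end.\<close>
  have "(\<lambda>r. if r = T then 0 else P r) integrable_on {T..\<tau>} \<and>
    (\<lambda>n. integral {T..\<tau>} (f n)) \<longlonglongrightarrow> integral {T..\<tau>} (\<lambda>r. if r = T then 0 else P r)"
  proof (rule monotone_convergence_increasing[OF fi])
    show "f n r \<le> f (Suc n) r" for n r
      using s_dec[of n] P_nonneg[of r] by (auto simp: f_def)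
    show "(\<lambda>n. f n r) \<longlonglongrightarrow> (if r = T then 0 else P r)" if r: "r \<in> {T..\<tau>}" for r
    proof (cases "r = T")
      case True
      then show ?thesis using s by (simp add: f_def not_le[symmetric])
    next
      case False
      then have "T < r" using r by simp
      then have "\<forall>\<^sub>F n in sequentially. s n < r" by (rule order_tendstoD[OF s_lim])
      then have "\<forall>\<^sub>F n in sequentially. f n r = P r"
        by eventually_elim (use r in \<open>simp add: f_def\<close>)
      then show ?thesis using False by (simp add: tendsto_eventually)
    qed
    have "norm (integral {T..\<tau>} (f n)) \<le> (M + \<kappa> * (\<tau> - T)) / (2 * a)" for n
    proof -
      have "2 * a * integral {s n..\<tau>} P \<le> y (s n) + \<kappa> * (\<tau> - s n)"
        using energy_step[OF s(1,2)[of n]] y_nonneg[of \<tau>] by linarith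
      also have "\<dots> \<le> M + \<kappa> * (\<tau> - T)"
        using M(2)[rule_format, OF s] s(1)[of n] \<kappa>_nonneg by (intro add_mono mult_left_mono) auto
      finally have "integral {s n..\<tau>} P \<le> (M + \<kappa> * (\<tau> - T)) / (2 * a)"
        using a by (simp add: pos_le_divide_eq mult.commute)
      moreover have "0 \<le> integral {s n..\<tau>} P"
        using P_nonneg by (intro integral_nonneg P_integrable s)
      ultimately show ?thesis by (simp add: fI)
    qed
    then show "bounded (range (\<lambda>n. integral {T..\<tau>} (f n)))"
      by (intro boundedI[where B = "(M + \<kappa> * (\<tau> - T)) / (2 * a)"]) auto
  qed
  then have "(\<lambda>r. if r = T then 0 else P r) integrable_on {T..\<tau>}" by (rule conjunct1)
  then show ?thesis
    by (rule integrable_spike[where S = "{T}"]) auto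
qed

lemma P_integral_le:
  assumes "T \<le> s" "s \<le> t" "t \<le> \<tau>"
  shows "integral {s..t} P \<le> integral {T..\<tau>} P"
proof -
  have "P integrable_on {s..t}" "P integrable_on {T..\<tau>}"
    using assms integrable_subinterval_real[OF P_integrable_start[of \<tau>], of s t] P_integrable_start by auto
  then show ?thesis using assms P_nonneg by (intro integral_subset_le) auto
qed

text \<open>The right-hand side is small for \<open>t\<close> near \<open>T\<close> and small \<open>h\<close>, uniformly in \<open>s\<close>; this gives the limit at \<open>T\<close>.\<close>

lemma shift_distance_estimate:
  "\<exists>A\<ge>0. \<exists>B\<ge>0. \<forall>s t h. T < s \<longrightarrow> s \<le> t \<longrightarrow> 0 \<le> h \<longrightarrow> t + h \<le> \<tau> \<longrightarrow>
     (distT L (v (s + h)) (v s))\<^sup>2 \<le> (distT L (v (t + h)) (v t))\<^sup>2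
        + A * (t - s) + B * integral {T..t + h} P"
proof -
  obtain M where M: "M \<ge> 0" "\<forall>r. T < r \<longrightarrow> r \<le> \<tau> \<longrightarrow> y r \<le> M"
    using y_bounded[of \<tau>] by (elim exE conjE)
  obtain K where SK: "sobolev_const L K" using sobolev_embedding[OF L] by (elim exE)
  note K = sobolev_constD(1)[OF SK]
  \<comment> \<open>The integrand to be estimated is affine in the sum of the two values of
    \<open>P\<close>: \<open>A\<close> is its constant part and \<open>B\<close> its slope. The 4 a
    in \<open>B\<close> is the diffusion of the difference, and 4 M bounds the squared distance of
    the two solutions.\<close>
  define A where "A = diff_coeff \<delta> \<alpha> \<beta> K M 0 * (4 * M)"
  define B where "B = 4 * a + 6 * norm (Complex \<alpha> \<beta>) * K * (4 * M)"
  have AB: "A \<ge> 0" "B \<ge> 0" using K M(1) a by (simp_all add: A_def B_def diff_coeff_nonneg)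
  have "(distT L (v (s + h)) (v s))\<^sup>2 \<le> (distT L (v (t + h)) (v t))\<^sup>2
        + A * (t - s) + (2 * B) * integral {T..t + h} P"
    if sth: "T < s" "s \<le> t" "0 \<le> h" "t + h \<le> \<tau>" for s t h
  proof -
    let ?Z = "{r \<in> {s..t}. \<not> has_torus_deriv L (v (r + h)) (p (r + h))}"
    let ?Z' = "{r \<in> {s..t}. \<not> has_torus_deriv L (v r) (p r)}"
    note m = modes_shift[OF sth(1-3)] and m' = modes[OF sth(1,2)]
    have yM: "\<forall>r\<in>{s..t}. sqT L (rep (v (r + h))) \<le> M \<and> sqT L (rep (v r)) \<le> M"
      using M(2)[unfolded y_def] sth by auto
    define w where "w r = (distT L (v (r + h)) (v r))\<^sup>2" for r
    define q where "q r = sqT L (\<lambda>x. rep (p (r + h)) x - rep (p r) x)" for r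
    define E where "E r = 2 * Re (ipT L (\<lambda>x. nonlin \<delta> \<alpha> \<beta> (rep (v (r + h))) x - nonlin \<delta> \<alpha> \<beta> (rep (v r)) x)
        (\<lambda>x. rep (v (r + h)) x - rep (v r) x))" for r
    have E: "((\<lambda>r. E r - 2 * a * q r) has_integral (w t - w s)) {s..t}"
      and Eb: "\<And>r. r \<in> {s..t} - (?Z \<union> ?Z') \<Longrightarrow> \<bar>E r\<bar> \<le> diff_coeff \<delta> \<alpha> \<beta> K M (P (r + h) + P r) * w r"
      unfolding w_def q_def P_def E_def sqn_eq_L2_dist[symmetric]
      by (rule cgl_difference_energy[OF L SK M(1) sth(2) m m' bspec[OF yM]], assumption)+
    have Z: "negligible (?Z \<union> ?Z')" using cgl_modesD(1)[OF m] cgl_modesD(1)[OF m'] by simp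
    have Ph: "((\<lambda>r. P (r + h)) has_integral integral {s + h..t + h} P) {s..t}"
    proof -
      have "(P has_integral integral {s + h..t + h} P) {s + h..t + h}"
        using sth by (intro integrable_integral P_integrable) auto
      from has_integral_shift_real_ivl[OF this, of h] show ?thesis by simp
    qed
    have Pi: "(P has_integral integral {s..t} P) {s..t}"
      using sth by (intro integrable_integral P_integrable) auto
    have "((\<lambda>r. A + B * (P (r + h) + P r)) has_integral
       (A * (t - s) + B * (integral {s + h..t + h} P + integral {s..t} P))) {s..t}"
      using has_integral_const_real[of A s t] sth(2)
      by (intro has_integral_add has_integral_mult_right Ph Pi) (simp add: mult.commute)
    \<comment> \<open>Backward in time the energy identity is negated and diffusion enters with a
      plus sign. It is paid for by \<open>P\<close> directly.\<close>
    then have "- (w t - w s) \<le> A * (t - s) + B * (integral {s + h..t + h} P + integral {s..t} P)"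
    proof (rule has_integral_le_ae[OF has_integral_neg[OF E] _ Z])
      fix r assume r: "r \<in> {s..t} - (?Z \<union> ?Z')"
      then have rs: "r \<in> {s..t}" by simp
      have PP: "0 \<le> P (r + h) + P r" using P_nonneg[of r] P_nonneg[of "r + h"] by simp
      have g: "rep (p (r + h)) \<in> L2T L" "rep (p r) \<in> L2T L"
        using cgl_modesD(3)[OF m, of r] cgl_modesD(3)[OF m', of r] r by auto
      have f: "rep (v (r + h)) \<in> L2T L" "rep (v r) \<in> L2T L"
        using cgl_modesD(2)[OF m rs] cgl_modesD(2)[OF m' rs] by auto
      have "q r \<le> 2 * (P (r + h) + P r)"
        using sqn_diff_le[OF g] by (simp add: q_def P_def)
      then have "2 * a * q r \<le> 2 * a * (2 * (P (r + h) + P r))" using a by (intro mult_left_mono) auto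
      moreover have "w r \<le> 4 * M"
        using sqn_diff_le[OF f] yM[rule_format, OF rs] by (simp add: w_def sqn_eq_L2_dist)
      then have "diff_coeff \<delta> \<alpha> \<beta> K M (P (r + h) + P r) * w r \<le> diff_coeff \<delta> \<alpha> \<beta> K M (P (r + h) + P r) * (4 * M)"
        using K M(1) PP by (intro mult_left_mono diff_coeff_nonneg) auto
      moreover have "2 * a * (2 * (P (r + h) + P r)) + diff_coeff \<delta> \<alpha> \<beta> K M (P (r + h) + P r) * (4 * M)
         = A + B * (P (r + h) + P r)"
        by (simp add: A_def B_def diff_coeff_def algebra_simps)
      ultimately show "- (E r - 2 * a * q r) \<le> A + B * (P (r + h) + P r)"
        using Eb[OF r] by linarith
    qed
    also have "\<dots> \<le> A * (t - s) + B * (integral {T..t + h} P + integral {T..t + h} P)"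
      using sth AB by (intro add_left_mono mult_left_mono add_mono P_integral_le) auto
    finally show ?thesis by (simp add: w_def)
  qed
  then show ?thesis using AB by (intro exI[of _ A] exI[of _ "2 * B"] conjI allI impI) auto
qed

text \<open>Two times near T are compared by carrying their distance back from a fixed later
  reference time, around which \<open>v\<close> is known to be continuous. The errors made on the
  way are small if the reference time itself is close to T.\<close>

lemma Cauchy_at_start:
  assumes e: "e > 0"
  shows "\<exists>d>0. \<forall>s t. T < s \<longrightarrow> s < T + d \<longrightarrow> T < t \<longrightarrow> t < T + d \<longrightarrow> distT L (v s) (v t) < e"
proof -
  obtain A B where AB: "A \<ge> 0" "B \<ge> 0" and est: "\<forall>s t h. T < s \<longrightarrow> s \<le> t \<longrightarrow> 0 \<le> h \<longrightarrow> t + h \<le> T + 1 \<longrightarrow>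
     (distT L (v (s + h)) (v s))\<^sup>2 \<le> (distT L (v (t + h)) (v t))\<^sup>2
        + A * (t - s) + B * integral {T..t + h} P"
    using shift_distance_estimate[of "T + 1"] by (elim exE conjE)
  \<comment> \<open>The estimate has three terms on the right, each made at most this large, and
    their sum must stay below e^2.\<close>
  define \<epsilon> where "\<epsilon> = e\<^sup>2 / 4"
  have \<epsilon>: "\<epsilon> > 0" and e4: "e\<^sup>2 = 4 * \<epsilon>" using e by (simp_all add: \<epsilon>_def)
  have "continuous_on {T..T + 1} (\<lambda>x. B * integral {T..x} P)"
    by (intro continuous_intros indefinite_integral_continuous_1 P_integrable_start)
  note ci = this[unfolded continuous_on_iff]
  have "T \<in> {T..T + 1}" by simp
  from ci[THEN bspec, OF this, THEN spec, THEN mp, OF \<epsilon>]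
  obtain d1 where d1: "d1 > 0" "\<forall>x\<in>{T..T + 1}. dist x T < d1 \<longrightarrow> dist (B * integral {T..x} P) (B * integral {T..T} P) < \<epsilon>"
    by (elim exE conjE)
  \<comment> \<open>The reference time is T + \<open>\<eta>\<close>, and the shifts h are smaller
    than \<open>\<eta>\<close>. Half a unit keeps both times within the range of the estimate,
    \<open>d1 / 3\<close> makes the integral of \<open>P\<close> up to the shifted reference time
    small, and the last entry handles the term with \<open>A\<close>, which may be 0.\<close>
  define \<eta> where "\<eta> = min (min (1 / 2) (d1 / 3)) (\<epsilon> / (A + 1))"
  have \<eta>: "\<eta> > 0" "2 * \<eta> \<le> 1" "2 * \<eta> < d1" "A * \<eta> \<le> \<epsilon>"
  proof -
    show "\<eta> > 0" using d1(1) \<epsilon> AB by (simp add: \<eta>_def)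
    show "2 * \<eta> \<le> 1" "2 * \<eta> < d1" using d1(1) by (auto simp: \<eta>_def)
    have "A * \<eta> \<le> A * (\<epsilon> / (A + 1))" using AB by (intro mult_left_mono) (auto simp: \<eta>_def)
    also have "\<dots> \<le> \<epsilon>" using AB \<epsilon> by (simp add: field_simps)
    finally show "A * \<eta> \<le> \<epsilon>" .
  qed
  have "T + \<eta> \<in> {T<..}" using \<eta> by simp
  from continuous_map_L2_dist[OF cont this, of "sqrt \<epsilon>"] \<epsilon>
  have "\<exists>d>0. \<forall>s\<in>{T<..}. dist s (T + \<eta>) < d \<longrightarrow> distT L (v (T + \<eta>)) (v s) < sqrt \<epsilon>" by simp
  then obtain d2 where d2: "d2 > 0" "\<forall>s\<in>{T<..}. dist s (T + \<eta>) < d2 \<longrightarrow> distT L (v (T + \<eta>)) (v s) < sqrt \<epsilon>"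
    by (elim exE conjE)
  define d where "d = min \<eta> d2"
  have d: "d > 0" "d \<le> \<eta>" "d \<le> d2" using \<eta>(1) d2(1) by (auto simp: d_def)
  have step: "distT L (v (s + h)) (v s) < e" if s: "T < s" "s < T + d" and h: "0 \<le> h" "h < d" for s h
  proof -
    have "(distT L (v (s + h)) (v s))\<^sup>2 \<le> (distT L (v (T + \<eta> + h)) (v (T + \<eta>)))\<^sup>2
        + A * (T + \<eta> - s) + B * integral {T..T + \<eta> + h} P"
      using s h d \<eta> by (intro est[rule_format]) auto
    moreover have "(distT L (v (T + \<eta> + h)) (v (T + \<eta>)))\<^sup>2 \<le> \<epsilon>"
    proof -
      have "distT L (v (T + \<eta>)) (v (T + \<eta> + h)) < sqrt \<epsilon>"
        using h d \<eta> by (intro d2(2)[rule_format]) (auto simp: dist_real_def)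
      then have "(distT L (v (T + \<eta>)) (v (T + \<eta> + h)))\<^sup>2 \<le> (sqrt \<epsilon>)\<^sup>2"
        by (intro power_mono) auto
      then show ?thesis using \<epsilon> by (simp add: L2_dist_commute)
    qed
    moreover have "A * (T + \<eta> - s) \<le> \<epsilon>"
      using s AB by (intro order_trans[OF mult_left_mono \<eta>(4)]) auto
    moreover have "B * integral {T..T + \<eta> + h} P < \<epsilon>"
    proof -
      have "dist (B * integral {T..T + \<eta> + h} P) (B * integral {T..T} P) < \<epsilon>"
        using h d \<eta> by (intro d1(2)[rule_format]) (auto simp: dist_real_def)
      then show ?thesis by (simp add: dist_real_def)
    qed
    ultimately have "(distT L (v (s + h)) (v s))\<^sup>2 < e\<^sup>2"
      using \<epsilon> e4 by linarith
    then show ?thesis using e by (simp add: power2_less_imp_less)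
  qed
  have "distT L (v s) (v t) < e" if st: "T < s" "s < T + d" "T < t" "t < T + d" for s t
  proof (cases "s \<le> t")
    case True
    then show ?thesis using step[of s "t - s"] st by (simp add: L2_dist_commute)
  next
    case False
    then show ?thesis using step[of t "s - t"] st by simp
  qed
  then show ?thesis using d(1) by (intro exI[of _ d] conjI allI impI)
qed

lemma start_limit:
  "\<exists>G\<in>L2 (torus L). \<forall>e>0. \<exists>d>0. \<forall>s. T < s \<longrightarrow> s < T + d \<longrightarrow> distT L G (v s) < e"
proof -
  define F where "F n = v (T + 1 / real (Suc n))" for n
  have F: "F n \<in> L2 (torus L)" for n unfolding F_def by (rule mem) simp
  have near: "\<exists>N. \<forall>n\<ge>N. 1 / real (Suc n) < d" if d: "d > 0" for d :: real
  proof -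
    obtain N where N: "1 / real (Suc N) < d" by (rule nat_approx_posE[OF d])
    have "1 / real (Suc n) < d" if "n \<ge> N" for n
      using N that by (intro order_le_less_trans[OF _ N] divide_left_mono) auto
    then show ?thesis by (intro exI[of _ N] allI impI)
  qed
  have "\<exists>N. \<forall>m\<ge>N. \<forall>n\<ge>N. distT L (F m) (F n) < e" if e: "e > 0" for e
  proof -
    obtain d where d: "d > 0" "\<forall>s t. T < s \<longrightarrow> s < T + d \<longrightarrow> T < t \<longrightarrow> t < T + d \<longrightarrow> distT L (v s) (v t) < e"
      using Cauchy_at_start[OF e] by (elim exE conjE)
    obtain N where N: "\<forall>n\<ge>N. 1 / real (Suc n) < d" using near[OF d(1)] by (elim exE)
    have "distT L (F m) (F n) < e" if "m \<ge> N" "n \<ge> N" for m n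
      unfolding F_def using N[rule_format, OF that(1)] N[rule_format, OF that(2)]
      by (intro d(2)[rule_format]) auto
    then show ?thesis by (intro exI[of _ N] allI impI)
  qed
  then have "\<exists>G\<in>L2 (torus L). (\<lambda>n. distT L (F n) G) \<longlonglongrightarrow> 0"
    by (rule L2_complete[OF L F])
  then obtain G where G: "G \<in> L2 (torus L)" "(\<lambda>n. distT L (F n) G) \<longlonglongrightarrow> 0"
    by (elim bexE)
  have "\<exists>d>0. \<forall>s. T < s \<longrightarrow> s < T + d \<longrightarrow> distT L G (v s) < e" if e: "e > 0" for e
  proof -
    obtain d where d: "d > 0" "\<forall>s t. T < s \<longrightarrow> s < T + d \<longrightarrow> T < t \<longrightarrow> t < T + d \<longrightarrow> distT L (v s) (v t) < e / 2"
      using Cauchy_at_start[OF half_gt_zero[OF e]] by (elim exE conjE)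
    obtain N where N: "\<forall>n\<ge>N. 1 / real (Suc n) < d" using near[OF d(1)] by (elim exE)
    have "\<forall>\<^sub>F n in sequentially. distT L (F n) G < e / 2"
      by (rule order_tendstoD(2)[OF G(2) half_gt_zero[OF e]])
    then obtain N' where N': "\<forall>n\<ge>N'. distT L (F n) G < e / 2"
      unfolding eventually_sequentially by (elim exE)
    define n where "n = max N N'"
    have n: "1 / real (Suc n) < d" "distT L (F n) G < e / 2"
      using N N' by (simp_all add: n_def)
    have "distT L G (v s) < e" if s: "T < s" "s < T + d" for s
    proof -
      have "distT L (F n) (v s) < e / 2"
        unfolding F_def using s n by (intro d(2)[rule_format]) auto
      then show ?thesis
        using L2_dist_triangle[OF G(1) F mem[OF s(1)], of n] n(2) by (simp add: L2_dist_commute)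
    qed
    then show ?thesis using d(1) by (intro exI[of _ d] conjI allI impI)
  qed
  then show ?thesis using G(1) by (intro bexI[of _ G] allI impI)
qed

end

section \<open>The weak formulation up to the starting time\<close>

lemma pairing_bound:
  assumes "f \<in> L2_fun M" "g \<in> L2_fun M"
  shows "norm (LINT x|M. f x * g x) \<le> sqrt (sqn M f) * sqrt (sqn M g)"
  using ip_bound[OF assms(1) L2_fun_cnj[OF assms(2)]] by (simp add: ip_def sqn_def)

lemma smooth_periodic_L2:
  assumes "\<phi> \<in> smooth_periodic L"
  shows "\<phi> \<in> L2T L" "D (D \<phi>) \<in> L2T L"
proof -
  have d: "(D ^^ n) \<phi> differentiable at x" for n x
    using assms by (simp add: smooth_periodic_def)
  have c: "continuous_on UNIV ((D ^^ n) \<phi>)" for n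
    using d[of n] by (simp add: continuous_on_eq_continuous_at differentiable_imp_continuous_within)
  show "\<phi> \<in> L2T L" using c[of 0] by (intro continuous_L2_fun) simp
  show "D (D \<phi>) \<in> L2T L" using c[of 2] by (intro continuous_L2_fun) (simp add: numeral_2_eq_2)
qed

text \<open>Both space derivatives of the diffusion term rest on the test function, so the
  derivative of the solution appears only through the sup bound for the cubic term. The result is
  affine in its squared norm and hence integrable up to the starting time.\<close>

lemma weak_integrand_bound:
  assumes L: "L > 0" and SK: "sobolev_const L K" and \<phi>: "\<phi> \<in> smooth_periodic L" and d: "has_torus_deriv L F G"
  shows "norm (weak_integrand L a b \<delta> \<alpha> \<beta> \<phi> F) \<le>
      norm (Complex a b) * (sqrt (sqT L (rep F)) * sqrt (sqT L (D (D \<phi>))))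
      + (\<bar>\<delta>\<bar> + norm (Complex \<alpha> \<beta>) * (3 * (K * (sqT L (rep F) + sqT L (rep G)))))
        * sqrt (sqT L (rep F)) * sqrt (sqT L \<phi>)"
proof -
  note K = sobolev_constD(1)[OF SK] and sob = sobolev_constD(2)[OF SK]
  have FG: "rep F \<in> L2T L" "rep G \<in> L2T L"
    using d by (auto simp: has_torus_deriv_def rep_L2_fun)
  note \<phi>2 = smooth_periodic_L2[OF \<phi>]
  note nl = torus_deriv_nonlin_L2(2)[OF L d]
  have ae: "AE x in torus L. (norm (rep F x))\<^sup>2 \<le> K * (sqT L (rep F) + sqT L (rep G))"
    by (rule sob[OF FG fc_torus_deriv[OF L d]])
  have "weak_integrand L a b \<delta> \<alpha> \<beta> \<phi> F = (LINT x|torus L.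
     Complex a b * (rep F x * D (D \<phi>) x) + nonlin \<delta> \<alpha> \<beta> (rep F) x * \<phi> x)"
    unfolding weak_integrand_def nonlin_def cubic_def
    by (intro Bochner_Integration.integral_cong refl) (simp add: algebra_simps)
  also have "\<dots> = Complex a b * (LINT x|torus L. rep F x * D (D \<phi>) x) + (LINT x|torus L. nonlin \<delta> \<alpha> \<beta> (rep F) x * \<phi> x)"
    unfolding integral_mult_right_zero[symmetric]
    by (rule Bochner_Integration.integral_add[OF integrable_mult_right[OF L2_fun_prod_integrable[OF FG(1) \<phi>2(2)]]
          L2_fun_prod_integrable[OF nl \<phi>2(1)]])
  also have "norm \<dots> \<le> norm (Complex a b) * norm (LINT x|torus L. rep F x * D (D \<phi>) x)
      + norm (LINT x|torus L. nonlin \<delta> \<alpha> \<beta> (rep F) x * \<phi> x)"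
    by (rule order_trans[OF norm_triangle_ineq]) (simp add: norm_mult)
  also have "\<dots> \<le> norm (Complex a b) * (sqrt (sqT L (rep F)) * sqrt (sqT L (D (D \<phi>))))
      + sqrt (sqT L (nonlin \<delta> \<alpha> \<beta> (rep F))) * sqrt (sqT L \<phi>)"
    by (intro add_mono mult_left_mono pairing_bound FG \<phi>2 nl norm_ge_zero)
  also have "sqrt (sqT L (nonlin \<delta> \<alpha> \<beta> (rep F))) * sqrt (sqT L \<phi>) \<le>
    (\<bar>\<delta>\<bar> + norm (Complex \<alpha> \<beta>) * (3 * (K * (sqT L (rep F) + sqT L (rep G)))))
      * sqrt (sqT L (rep F)) * sqrt (sqT L \<phi>)"
    by (intro mult_right_mono nonlin_bound[OF FG(1) ae]) (use K in auto)
  finally show ?thesis by simp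
qed

text \<open>An improper integral at T becomes a proper one by dominated convergence of the
  truncations. The majorant also gives absolute integrability, which the Bochner integral in the
  definition of a solution demands.\<close>

lemma has_integral_left_limit:
  fixes h :: "real \<Rightarrow> complex" and Bd :: "real \<Rightarrow> real"
  assumes T: "T < t" and Z: "negligible Z"
    and h: "\<And>s. T < s \<Longrightarrow> s \<le> t \<Longrightarrow> (h has_integral I s) {s..t}"
    and Bd: "Bd integrable_on {T..t}"
    and le: "\<And>r. r \<in> {T<..t} - Z \<Longrightarrow> norm (h r) \<le> Bd r"
    and lim: "\<And>s. (\<And>n. T < s n \<and> s n \<le> t) \<Longrightarrow> s \<longlonglongrightarrow> T \<Longrightarrow> (\<lambda>n. I (s n)) \<longlonglongrightarrow> i"
  shows "h absolutely_integrable_on {T..t}" "(h has_integral i) {T..t}"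
proof -
  let ?Z = "insert T Z"
  let ?S = "{T..t} - ?Z"
  have Z': "negligible ?Z" using Z by simp
  define s where "s n = T + (t - T) / real (Suc n)" for n
  have s: "T < s n" "s n \<le> t" for n
  proof -
    have "(t - T) / real (Suc n) \<le> (t - T) / 1" using T by (intro divide_left_mono) auto
    then show "s n \<le> t" by (simp add: s_def)
    show "T < s n" using T by (simp add: s_def)
  qed
  have "(\<lambda>n. T + (t - T) / real (Suc n)) \<longlonglongrightarrow> T + 0"
    by (rule tendsto_add[OF tendsto_const LIMSEQ_Suc[OF lim_const_over_n]])
  then have s_lim: "s \<longlonglongrightarrow> T" by (simp add: s_def[abs_def])
  have BS: "Bd integrable_on ?S"
    using Bd integrable_minus_negligible[OF Z'] by blast
  have "(h has_integral i) ?S"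
  proof (rule has_integral_dominated_convergence[OF _ BS])
    show "((\<lambda>r. if r \<in> {s n..t} then h r else 0) has_integral I (s n)) ?S" for n
    proof -
      have "{s n..t} \<inter> {T..t} = {s n..t}" using s[of n] by auto
      then have "((\<lambda>r. if r \<in> {s n..t} then h r else 0) has_integral I (s n)) {T..t}"
        unfolding has_integral_restrict_Int using h[OF s] by (simp only:)
      then show ?thesis by (simp only: has_integral_minus_negligible[OF Z'])
    qed
    show "\<forall>r\<in>?S. norm (if r \<in> {s n..t} then h r else 0) \<le> Bd r" for n
    proof
      fix r assume "r \<in> ?S"
      then have "norm (h r) \<le> Bd r" by (intro le) auto
      moreover have "0 \<le> Bd r" using norm_ge_zero calculation by (rule order_trans)
      ultimately show "norm (if r \<in> {s n..t} then h r else 0) \<le> Bd r" by simp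
    qed
    show "\<forall>r\<in>?S. (\<lambda>n. if r \<in> {s n..t} then h r else 0) \<longlonglongrightarrow> h r"
    proof
      fix r assume r: "r \<in> ?S"
      then have "T < r" by auto
      then have "\<forall>\<^sub>F n in sequentially. s n < r" by (rule order_tendstoD(2)[OF s_lim])
      then have "\<forall>\<^sub>F n in sequentially. (if r \<in> {s n..t} then h r else 0) = h r"
        by eventually_elim (use r in simp)
      then show "(\<lambda>n. if r \<in> {s n..t} then h r else 0) \<longlonglongrightarrow> h r" by (rule tendsto_eventually)
    qed
    show "(\<lambda>n. I (s n)) \<longlonglongrightarrow> i" by (rule lim[OF conjI[OF s] s_lim])
  qed
  then show hi: "(h has_integral i) {T..t}" unfolding has_integral_minus_negligible[OF Z'] .
  have "h absolutely_integrable_on ?S"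
    using \<open>(h has_integral i) ?S\<close> BS
    by (intro absolutely_integrable_integrable_bound[where g = Bd] le) auto
  then have "(\<lambda>r. norm (h r)) integrable_on ?S" by (simp add: absolutely_integrable_on_def)
  then have "(\<lambda>r. norm (h r)) integrable_on {T..t}"
    using integrable_minus_negligible[OF Z'] by blast
  then show "h absolutely_integrable_on {T..t}"
    using hi by (auto simp: absolutely_integrable_on_def)
qed

context cgl_open_start
begin

text \<open>The value at T is filled in with the limit state. Away from T nothing changes; the new
  content is the equation on intervals that begin exactly at T.\<close>

lemma extension_to_start: 
  "\<exists>w. cgl_solution L a b \<delta> \<alpha> \<beta> {T..} w \<and> (\<forall>t\<in>{T<..}. w t = v t)"
proof -
  obtain G where G: "G \<in> L2 (torus L)"
    and Glim': "\<forall>e>0. \<exists>d>0. \<forall>s. T < s \<longrightarrow> s < T + d \<longrightarrow> distT L G (v s) < e"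
    using start_limit by (elim bexE)
  note Glim = Glim'[THEN spec, THEN mp]
  define w where "w t = (if t = T then G else v t)" for t
  have wT: "w T = G" and wv: "t \<noteq> T \<Longrightarrow> w t = v t" for t by (simp_all add: w_def)
  \<comment> \<open>Existence of the space derivative is known almost everywhere only on compact
    intervals beyond T; countably many of them exhaust the half-open one.\<close>
  define Z where "Z t = insert T (\<Union>n. {r \<in> {T + 1 / real (Suc n)..t}. \<not> has_torus_deriv L (v r) (p r)})" for t
  have Z: "negligible (Z t)" for t
  proof -
    have "negligible {r \<in> {T + 1 / real (Suc n)..t}. \<not> has_torus_deriv L (v r) (p r)}" for n
    proof (cases "T + 1 / real (Suc n) \<le> t")
      case True
      have "AE r in lebesgue_on {T + 1 / real (Suc n)..t}. has_torus_deriv L (v r) (p r)"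
      proof (rule cgl_dataD(2)[OF dat _ _ True])
        show T1: "T + 1 / real (Suc n) \<in> {T<..}" by simp
        show "t \<in> {T<..}" using T1 True unfolding greaterThan_iff by (rule less_le_trans)
      qed
      from AE_lebesgue_on_iff[THEN iffD1, OF _ this] show ?thesis by simp
    next
      case False
      then have "{r \<in> {T + 1 / real (Suc n)..t}. \<not> has_torus_deriv L (v r) (p r)} = {}" by auto
      then show ?thesis by (simp only: negligible_empty)
    qed
    then show ?thesis unfolding Z_def by (simp add: negligible_Union_nat)
  qed
  have good: "has_torus_deriv L (v r) (p r)" if r: "T < r" "r \<le> t" "r \<notin> Z t" for r t
  proof (rule ccontr)
    assume n: "\<not> has_torus_deriv L (v r) (p r)"
    have "0 < r - T" using r by simp
    then obtain N where N: "1 / real (Suc N) < r - T" by (rule nat_approx_posE)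
    then have "r \<in> {r \<in> {T + 1 / real (Suc N)..t}. \<not> has_torus_deriv L (v r) (p r)}" using r n by simp
    then show False using r(3) unfolding Z_def by blast
  qed
  show ?thesis
  proof (intro exI[of _ w] conjI ballI)
    show "w t = v t" if "t \<in> {T<..}" for t using that by (simp add: w_def)
    show "cgl_solution L a b \<delta> \<alpha> \<beta> {T..} w"
      unfolding cgl_solution_iff_data cgl_data_def
    proof (intro exI[of _ p] conjI ballI impI)
      show "continuous_map (top_of_set {T..}) (L2_topology (torus L)) w"
        unfolding continuous_map_L2
      proof (intro conjI ballI allI impI)
        show "w t \<in> L2 (torus L)" if "t \<in> {T..}" for t
          using that mem[of t] G by (auto simp: w_def)
        fix t e :: real assume t: "t \<in> {T..}" and e: "e > 0"
        show "\<exists>d>0. \<forall>s\<in>{T..}. dist s t < d \<longrightarrow> distT L (w t) (w s) < e"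
        proof (cases "t = T")
          case True
          obtain d where d: "d > 0" "\<forall>s. T < s \<longrightarrow> s < T + d \<longrightarrow> distT L G (v s) < e"
            using Glim[OF e] by (elim exE conjE)
          show ?thesis
          proof (intro exI[of _ d] conjI d(1) ballI impI)
            fix s assume s: "s \<in> {T..}" "dist s t < d"
            show "distT L (w t) (w s) < e"
            proof (cases "s = T")
              case True
              then show ?thesis using \<open>t = T\<close> L2_dist_eq_0[OF G G] e by (simp add: wT)
            next
              case False
              then show ?thesis using \<open>t = T\<close> s d(2) by (simp add: wT wv dist_real_def)
            qed
          qed
        next
          case False
          then have tT: "t \<in> {T<..}" using t by auto
          obtain d where d: "d > 0" "\<forall>s\<in>{T<..}. dist s t < d \<longrightarrow> distT L (v t) (v s) < e"
            using continuous_map_L2_dist[OF cont tT e] by (elim exE conjE)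
          show ?thesis
          proof (intro exI[of _ "min d (t - T)"] conjI ballI impI)
            show "0 < min d (t - T)" using d tT by simp
            fix s assume "s \<in> {T..}" "dist s t < min d (t - T)"
            then have s: "s \<in> {T<..}" "dist s t < d" using tT by (auto simp: dist_real_def)
            then show "distT L (w t) (w s) < e"
              using d(2)[rule_format, OF s] tT by (simp add: wv)
          qed
        qed
      qed
    next
      fix s t assume st: "s \<in> {T..}" "t \<in> {T..}" "s \<le> t"
      have "{r \<in> {s..t}. \<not> has_torus_deriv L (w r) (p r)} \<subseteq> Z t"
      proof
        fix r assume "r \<in> {r \<in> {s..t}. \<not> has_torus_deriv L (w r) (p r)}"
        then have r: "T \<le> r" "r \<le> t" "\<not> has_torus_deriv L (w r) (p r)" using st by auto
        show "r \<in> Z t"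
        proof (cases "r = T")
          case True
          then show ?thesis by (simp add: Z_def)
        next
          case False
          then show ?thesis using r good[of r t] by (cases "r \<in> Z t") (auto simp: wv)
        qed
      qed
      then have "negligible {r \<in> {s..t}. \<not> has_torus_deriv L (w r) (p r)}"
        by (rule negligible_subset[OF Z])
      from AE_lebesgue_on_iff[THEN iffD2, OF _ this]
      show "AE r in lebesgue_on {s..t}. has_torus_deriv L (w r) (p r)" by simp
      have "P integrable_on {s..t}"
        using integrable_subinterval_real[OF P_integrable_start[of t], of s t] st by auto
      then have "P absolutely_integrable_on {s..t}"
        by (rule nonnegative_absolutely_integrable_1) (rule P_nonneg)
      then show "integrable (lebesgue_on {s..t}) (\<lambda>r. (L2_norm (torus L) (p r))\<^sup>2)"
        unfolding absolutely_integrable_iff_lebesgue_on P_def[abs_def] sqn_eq_L2_norm .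
    next
      fix \<phi> s t assume \<phi>: "\<phi> \<in> smooth_periodic L" and st: "s \<in> {T..}" "t \<in> {T..}" "s \<le> t"
      let ?pair = "\<lambda>r. LINT x|torus L. rep (w r) x * \<phi> x"
      let ?h = "\<lambda>r. weak_integrand L a b \<delta> \<alpha> \<beta> \<phi> (w r)"
      have away: "has_bochner_integral (lebesgue_on {s..t}) ?h (?pair t - ?pair s)" if s: "T < s" "s \<le> t" for s
      proof -
        have "has_bochner_integral (lebesgue_on {s..t}) (\<lambda>r. weak_integrand L a b \<delta> \<alpha> \<beta> \<phi> (v r)) (?pair t - ?pair s)"
          using cgl_dataD(4)[OF dat \<phi>, of s t] s by (simp add: wv)
        then show ?thesis
          by (rule has_bochner_integral_cong[THEN iffD1, rotated -1]) (use s in \<open>auto simp: wv\<close>)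
      qed
      show "has_bochner_integral (lebesgue_on {s..t}) ?h (?pair t - ?pair s)"
      proof (cases "T < s")
        case True
        then show ?thesis using st by (intro away)
      next
        case False
        then have sT: "s = T" using st by simp
        show ?thesis
        proof (cases "t = T")
          case True
          have "negligible {T..T}" by simp
          then show ?thesis unfolding sT True
            by (intro has_bochner_of_integral absolutely_integrable_negligible) auto
        next
          case False
          then have Tt: "T < t" using st by simp
          obtain M where M: "M \<ge> 0" "\<forall>r. T < r \<longrightarrow> r \<le> t \<longrightarrow> y r \<le> M"
            using y_bounded[of t] by (elim exE conjE)
          obtain K where SK: "sobolev_const L K" using sobolev_embedding[OF L] by (elim exE)
          note K = sobolev_constD(1)[OF SK]
          define q1 where "q1 = sqrt (sqT L (D (D \<phi>)))"
          define q2 where "q2 = sqrt (sqT L \<phi>)"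
          have q: "q1 \<ge> 0" "q2 \<ge> 0" by (simp_all add: q1_def q2_def)
          define Bd where "Bd r = norm (Complex a b) * (sqrt M * q1)
              + (\<bar>\<delta>\<bar> + norm (Complex \<alpha> \<beta>) * (3 * (K * (M + P r)))) * sqrt M * q2" for r
          have Bi: "Bd integrable_on {T..t}"
            unfolding Bd_def
            by (intro integrable_add integrable_on_mult_right integrable_on_mult_left integrable_const_ivl P_integrable_start)
          have bound: "norm (?h r) \<le> Bd r" if "r \<in> {T<..t} - Z t" for r
          proof -
            have r: "T < r" "r \<le> t" "r \<notin> Z t" using that by auto
            have yr: "y r \<le> M" using M(2) r by simp
            have sy: "sqrt (y r) \<le> sqrt M" using yr by simp
            have "norm (?h r) \<le> norm (Complex a b) * (sqrt (y r) * q1)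
              + (\<bar>\<delta>\<bar> + norm (Complex \<alpha> \<beta>) * (3 * (K * (y r + P r)))) * sqrt (y r) * q2"
              using weak_integrand_bound[OF L SK \<phi> good[OF r], of a b \<delta> \<alpha> \<beta>] r(1) unfolding y_def P_def q1_def q2_def
              by (simp add: wv)
            also have "\<dots> \<le> Bd r"
              unfolding Bd_def using sy yr q K y_nonneg[of r] P_nonneg[of r] M(1)
              by (intro add_mono mult_mono mult_left_mono order_refl mult_nonneg_nonneg add_nonneg_nonneg) auto
            finally show ?thesis .
          qed
          \<comment> \<open>The pairing with a fixed test function is continuous in L2, so the
            values at times tending to T converge to that of the limit state.\<close>
          have lim: "(\<lambda>n. ?pair t - ?pair (\<sigma> n)) \<longlonglongrightarrow> ?pair t - ?pair T"
            if \<sigma>: "\<And>n. T < \<sigma> n \<and> \<sigma> n \<le> t" "\<sigma> \<longlonglongrightarrow> T" for \<sigma> :: "nat \<Rightarrow> real"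
          proof -
            have "(\<lambda>n. ?pair (\<sigma> n) - ?pair T) \<longlonglongrightarrow> 0"
            proof (rule Lim_null_comparison)
              have "norm (?pair (\<sigma> n) - ?pair T) \<le> distT L G (v (\<sigma> n)) * q2" for n
              proof -
                have vs: "rep (v (\<sigma> n)) \<in> L2T L" using \<sigma>(1)[of n] by (intro rep_L2_fun mem) simp
                have g: "rep G \<in> L2T L" by (rule rep_L2_fun[OF G])
                note \<phi>2 = smooth_periodic_L2(1)[OF \<phi>]
                have "?pair (\<sigma> n) - ?pair T = (LINT x|torus L. rep (v (\<sigma> n)) x * \<phi> x) - (LINT x|torus L. rep G x * \<phi> x)"
                  using \<sigma>(1)[of n] by (simp add: wT wv)
                also have "\<dots> = (LINT x|torus L. rep (v (\<sigma> n)) x * \<phi> x - rep G x * \<phi> x)"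
                  by (rule Bochner_Integration.integral_diff[OF L2_fun_prod_integrable[OF vs \<phi>2] L2_fun_prod_integrable[OF g \<phi>2], symmetric])
                also have "\<dots> = (LINT x|torus L. (rep (v (\<sigma> n)) x - rep G x) * \<phi> x)"
                  by (simp only: left_diff_distrib)
                also have "norm \<dots> \<le> sqrt (sqT L (\<lambda>x. rep (v (\<sigma> n)) x - rep G x)) * sqrt (sqT L \<phi>)"
                  by (rule pairing_bound[OF L2_fun_diff[OF vs g] \<phi>2])
                also have "\<dots> = distT L G (v (\<sigma> n)) * q2"
                  by (simp add: q2_def sqn_eq_L2_dist L2_dist_commute)
                finally show ?thesis .
              qed
              then show "\<forall>\<^sub>F n in sequentially. norm (?pair (\<sigma> n) - ?pair T) \<le> distT L G (v (\<sigma> n)) * q2"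
                by (intro always_eventually allI)
              have "(\<lambda>n. distT L G (v (\<sigma> n))) \<longlonglongrightarrow> 0"
              proof (rule LIMSEQ_I)
                fix e :: real assume "e > 0"
                from Glim[OF this] obtain d where d: "d > 0" "\<forall>s. T < s \<longrightarrow> s < T + d \<longrightarrow> distT L G (v s) < e"
                  by (elim exE conjE)
                have "T < T + d" using d(1) by simp
                from order_tendstoD(2)[OF \<sigma>(2) this] obtain N where "\<forall>n\<ge>N. \<sigma> n < T + d"
                  unfolding eventually_sequentially by (elim exE)
                then show "\<exists>N. \<forall>n\<ge>N. norm (distT L G (v (\<sigma> n)) - 0) < e"
                  using d(2) \<sigma>(1) by (intro exI[of _ N]) simp
              qed
              from tendsto_mult_left[OF this, of q2]
              show "(\<lambda>n. distT L G (v (\<sigma> n)) * q2) \<longlonglongrightarrow> 0" by (simp add: mult.commute)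
            qed
            then have "(\<lambda>n. ?pair t - ?pair T - (?pair (\<sigma> n) - ?pair T)) \<longlonglongrightarrow> ?pair t - ?pair T - 0"
              by (rule tendsto_diff[OF tendsto_const])
            then show ?thesis by simp
          qed
          show ?thesis unfolding sT
          proof (rule has_bochner_of_integral)
            have hs: "(?h has_integral ?pair t - ?pair s) {s..t}" if "T < s" "s \<le> t" for s
              by (rule has_integral_of_bochner[OF away[OF that]])
            show "?h absolutely_integrable_on {T..t}"
              by (rule has_integral_left_limit(1)[OF Tt Z hs Bi bound lim])
            show "(?h has_integral ?pair t - ?pair T) {T..t}"
              by (rule has_integral_left_limit(2)[OF Tt Z hs Bi bound lim])
          qed
        qed
      qed
    qed
  qed
qed

end

theorem theorem3p2:
  fixes L a b \<delta> \<alpha> \<beta> :: real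
    and u :: "real \<Rightarrow> (real \<Rightarrow> complex) set"
    and A :: "(real \<Rightarrow> complex) set set"
  assumes "L > 0" and "a > 0" and "\<alpha> > 0"
    and "cgl_solution L a b \<delta> \<alpha> \<beta> {0..} u"
    and "cgl_global_attractor L a b \<delta> \<alpha> \<beta> A"
    and "\<not> u ` {0..} \<subseteq> A"
  shows "(\<nexists>v. cgl_extension L a b \<delta> \<alpha> \<beta> u UNIV v) \<and>
         (\<forall>J v. cgl_extension L a b \<delta> \<alpha> \<beta> u J v \<longrightarrow> cgl_blows_up_backward L a b \<delta> \<alpha> \<beta> J v)"
proof -
  have no_global: False if ext: "cgl_extension L a b \<delta> \<alpha> \<beta> u UNIV v" for v
  proof -
    note e = ext[unfolded cgl_extension_def, THEN conjunct2, THEN conjunct2]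
    note v = e[THEN conjunct1] and vu = e[THEN conjunct2]
    have "u t \<in> A" if "t \<ge> 0" for t
      using cgl_global_in_attractor[OF assms(1-3) v assms(5), of t] vu that by simp
    then have "u ` {0..} \<subseteq> A" by (intro image_subsetI) simp
    then show False using assms(6) by (rule notE[rotated])
  qed
  have blow_up: "cgl_blows_up_backward L a b \<delta> \<alpha> \<beta> J v" if ext: "cgl_extension L a b \<delta> \<alpha> \<beta> u J v" for J v
  proof -
    note e = ext[unfolded cgl_extension_def]
    note J = e[THEN conjunct1] and J0 = e[THEN conjunct2, THEN conjunct1]
      and v = e[THEN conjunct2, THEN conjunct2, THEN conjunct1]
    \<comment> \<open>\<open>J\<close> is an interval that contains all nonnegative times, so it is
      upward closed. Hence it is the whole line unless it is bounded below.\<close>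
    have up: "x \<in> J" if "z \<in> J" "z < x" for x z
    proof -
      have "max x 0 \<in> J" by (rule subsetD[OF J0]) simp
      show ?thesis
        by (rule mem_is_interval_1_I[OF J that(1) \<open>max x 0 \<in> J\<close>]) (use that(2) in simp_all)
    qed
    have bdd: "bdd_below J"
    proof (rule ccontr)
      assume nb: "\<not> bdd_below J"
      have "x \<in> J" for x
      proof -
        have "\<exists>z\<in>J. z < x"
        proof (rule ccontr)
          assume "\<not> (\<exists>z\<in>J. z < x)"
          then have "\<And>z. z \<in> J \<Longrightarrow> x \<le> z" unfolding bex_simps not_less by (rule bspec)
          then have "bdd_below J" by (rule bdd_belowI)
          then show False using nb by (rule notE[rotated])
        qed
        then obtain z where "z \<in> J" "z < x" by (elim bexE)
        then show ?thesis by (rule up)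
      qed
      then have "J = UNIV" by auto
      then have "cgl_extension L a b \<delta> \<alpha> \<beta> u UNIV v" using ext by (simp only:)
      then show False by (rule no_global)
    qed
    define T where "T = Inf J"
    have ge: "T \<le> x" if "x \<in> J" for x unfolding T_def by (rule cInf_lower[OF that bdd])
    have gt: "x \<in> J" if "T < x" for x
    proof -
      have "J \<noteq> {}" using J0 by auto
      from cInf_lessD[OF this] that obtain z where "z \<in> J" "z < x" unfolding T_def by blast
      then show ?thesis by (rule up)
    qed
    have "filterlim (\<lambda>t. L2_norm (torus L) (v t)) at_top (at_right T)"
      if no_start: "\<nexists>w. cgl_solution L a b \<delta> \<alpha> \<beta> {T..} w \<and> (\<forall>t\<in>J. w t = v t)"
    proof (rule ccontr)
      assume nf: "\<not> filterlim (\<lambda>t. L2_norm (torus L) (v t)) at_top (at_right T)"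
      \<comment> \<open>If T belonged to \<open>J\<close>, then \<open>J\<close> would be the closed
        half-line from T and \<open>v\<close> itself would be a solution starting at T, which
        \<open>no_start\<close> excludes.\<close>
      have "T \<notin> J"
      proof
        assume "T \<in> J"
        have "J = {T..}"
        proof (intro equalityI subsetI)
          show "x \<in> {T..}" if "x \<in> J" for x using ge[OF that] by simp
          show "x \<in> J" if "x \<in> {T..}" for x using gt[of x] that \<open>T \<in> J\<close> by (cases "x = T") auto
        qed
        then have "cgl_solution L a b \<delta> \<alpha> \<beta> {T..} v \<and> (\<forall>t\<in>J. v t = v t)" using v by simp
        then have "\<exists>w. cgl_solution L a b \<delta> \<alpha> \<beta> {T..} w \<and> (\<forall>t\<in>J. w t = v t)" by (rule exI[of _ v])
        then show False by (rule notE[OF no_start])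
      qed
      have JT: "J = {T<..}"
      proof (intro equalityI subsetI)
        show "x \<in> {T<..}" if "x \<in> J" for x using ge[OF that] that \<open>T \<notin> J\<close> by (cases "x = T") auto
        show "x \<in> J" if "x \<in> {T<..}" for x using gt[of x] that by simp
      qed
      obtain K0 where K0: "\<not> eventually (\<lambda>t. K0 \<le> L2_norm (torus L) (v t)) (at_right T)"
        using nf unfolding filterlim_at_top not_all by (elim exE)
      have recur: "\<exists>s. T < s \<and> s < r \<and> L2_norm (torus L) (v s) < K0" if r: "T < r" for r
      proof (rule ccontr)
        assume none: "\<nexists>s. T < s \<and> s < r \<and> L2_norm (torus L) (v s) < K0"
        have "\<forall>s>T. s < r \<longrightarrow> K0 \<le> L2_norm (torus L) (v s)"
        proof (intro allI impI leI notI)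
          fix s assume "T < s" "s < r" "L2_norm (torus L) (v s) < K0"
          then show False using none by simp
        qed
        then have "eventually (\<lambda>t. K0 \<le> L2_norm (torus L) (v t)) (at_right T)"
          unfolding eventually_at_right_field using r by (intro exI[of _ r] conjI)
        then show False using K0 by simp
      qed
      show False
      proof (rule cgl_solution_data[OF v])
        fix p assume "cgl_data L a b \<delta> \<alpha> \<beta> J v p"
        then have "cgl_open_start L a b \<delta> \<alpha> \<beta> T v p K0"
          unfolding JT by (rule cgl_open_start.intro[OF assms(1-3) _ recur])
        then show False
          by (rule notE[OF no_start[unfolded JT] cgl_open_start.extension_to_start])
      qed
    qed
    then show ?thesis
      unfolding cgl_blows_up_backward_def T_def[symmetric] by (intro conjI impI bdd)
  qed
  show ?thesis
  proof (intro conjI allI impI notI)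
    assume "\<exists>v. cgl_extension L a b \<delta> \<alpha> \<beta> u UNIV v"
    then show False by (elim exE) (rule no_global)
  qed (rule blow_up)
qed

end
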